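(* Let $A$ be a finite-dimensional, associative, unital algebra over an algebraically closed field $\Bbbk$ such that $\operatorname{fdim}(A)<\infty$. Assume that there exist a duality $\star$ on $A\text{-mod}$ and a generalized tilting $A$-module $T$ such that $Q^{\star}\cong Q$ for every indecomposable module $Q\in\operatorname{Add}(T)$. Then $\operatorname{fdim}(A)=2\cdot\operatorname{pd}(T)$.
   Context: $A\text{-mod}$ denotes the category of finite-dimensional left $A$-modules. A duality on $A\text{-mod}$ is a contravariant exact self-equivalence of $A\text{-mod}$. A generalized tilting module is a module $T$ of finite projective dimension with $\operatorname{Ext}^i_A(T,T)=0$ for all $i>0$, such that ${}_AA$ admits a finite coresolution $0\to {}_AA\to T_0\to T_1\to\dots\to T_m\to 0$ with all $T_i\in\operatorname{Add}(T)$ (the additive closure of $T$: direct summands of finite direct sums of copies of $T$). The (projectively defined) finitistic dimension $\operatorname{fdim}(A)$ is the supremum of $\operatorname{pd}(M)$ over all $M\in A\text{-mod}$ of finite projective dimension. *)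

theory Defs
  imports "HOL-Computational_Algebra.Polynomial" "HOL-Library.Extended_Nat"
begin

(* Concrete model of A-mod for a finite-dimensional algebra A over a field 'k.
   Matrices are functions nat => nat => 'k, required to vanish outside their
   declared size; vectors are nat => 'k vanishing outside their length. *)

type_synonym 'k mx = "nat \<Rightarrow> nat \<Rightarrow> 'k"

definition alg_closed :: "'k::field itself \<Rightarrow> bool" where
  "alg_closed _ \<equiv> \<forall>p::'k poly. degree p > 0 \<longrightarrow> (\<exists>x. poly p x = 0)"

definition mat_wf :: "nat \<Rightarrow> nat \<Rightarrow> 'k::zero mx \<Rightarrow> bool" where
  "mat_wf r c X \<equiv> \<forall>i j. \<not>(i < r \<and> j < c) \<longrightarrow> X i j = 0"

definition vec_wf :: "nat \<Rightarrow> (nat \<Rightarrow> 'k::zero) \<Rightarrow> bool" where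
  "vec_wf n v \<equiv> \<forall>i\<ge>n. v i = 0"

definition mmul :: "nat \<Rightarrow> 'k::comm_semiring_1 mx \<Rightarrow> 'k mx \<Rightarrow> 'k mx" where
  "mmul n X Y = (\<lambda>i j. \<Sum>k<n. X i k * Y k j)"

definition mvec :: "nat \<Rightarrow> 'k::comm_semiring_1 mx \<Rightarrow> (nat \<Rightarrow> 'k) \<Rightarrow> (nat \<Rightarrow> 'k)" where
  "mvec n X v = (\<lambda>i. \<Sum>j<n. X i j * v j)"

definition idm :: "nat \<Rightarrow> 'k::comm_semiring_1 mx" where
  "idm n = (\<lambda>i j. if i = j \<and> i < n then 1 else 0)"

definition zmx :: "'k::zero mx" where
  "zmx = (\<lambda>_ _. 0)"

(* A finite-dimensional unital associative algebra given by a basis e_0..e_{d-1},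
   structure constants  e_i e_j = sum_l amult i j l e_l,  unit = sum_i aunit i e_i *)
record 'k alg =
  adim :: nat
  amult :: "nat \<Rightarrow> nat \<Rightarrow> nat \<Rightarrow> 'k"
  aunit :: "nat \<Rightarrow> 'k"

definition is_fd_algebra :: "'k::field alg \<Rightarrow> bool" where
  "is_fd_algebra A \<equiv>
     (\<forall>i<adim A. \<forall>j<adim A. \<forall>k<adim A. \<forall>m<adim A.
        (\<Sum>l<adim A. amult A i j l * amult A l k m) = (\<Sum>l<adim A. amult A j k l * amult A i l m)) \<and>
     (\<forall>j<adim A. \<forall>m<adim A. (\<Sum>i<adim A. aunit A i * amult A i j m) = (if j = m then 1 else 0)) \<and>
     (\<forall>j<adim A. \<forall>m<adim A. (\<Sum>i<adim A. aunit A i * amult A j i m) = (if j = m then 1 else 0))"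

(* A finite-dimensional left module: k^n with basis elements e_i acting by n x n matrices *)
record 'k modl =
  mdim :: nat
  mact :: "nat \<Rightarrow> 'k mx"

definition is_module :: "'k::field alg \<Rightarrow> 'k modl \<Rightarrow> bool" where
  "is_module A M \<equiv>
     (\<forall>i<adim A. mat_wf (mdim M) (mdim M) (mact M i)) \<and>
     (\<forall>i\<ge>adim A. mact M i = zmx) \<and>
     (\<forall>i<adim A. \<forall>j<adim A. mmul (mdim M) (mact M i) (mact M j)
         = (\<lambda>r s. \<Sum>l<adim A. amult A i j l * mact M l r s)) \<and>
     (\<lambda>r s. \<Sum>i<adim A. aunit A i * mact M i r s) = idm (mdim M)"

definition is_hom :: "'k::field alg \<Rightarrow> 'k modl \<Rightarrow> 'k modl \<Rightarrow> 'k mx \<Rightarrow> bool" where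
  "is_hom A M N f \<equiv> mat_wf (mdim N) (mdim M) f \<and>
     (\<forall>i<adim A. mmul (mdim N) (mact N i) f = mmul (mdim M) f (mact M i))"

definition inj_map :: "nat \<Rightarrow> 'k::field mx \<Rightarrow> bool" where
  "inj_map n f \<equiv> \<forall>v. vec_wf n v \<and> mvec n f v = (\<lambda>_. 0) \<longrightarrow> v = (\<lambda>_. 0)"

definition surj_map :: "nat \<Rightarrow> nat \<Rightarrow> 'k::field mx \<Rightarrow> bool" where
  "surj_map n m f \<equiv> \<forall>w. vec_wf m w \<longrightarrow> (\<exists>v. vec_wf n v \<and> mvec n f v = w)"

definition exact_at :: "nat \<Rightarrow> nat \<Rightarrow> 'k::field mx \<Rightarrow> 'k mx \<Rightarrow> bool" where
  "exact_at nL nM f g \<equiv> \<forall>v. vec_wf nM v \<longrightarrow>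
     (mvec nM g v = (\<lambda>_. 0) \<longleftrightarrow> (\<exists>u. vec_wf nL u \<and> mvec nL f u = v))"

definition is_iso :: "'k::field alg \<Rightarrow> 'k modl \<Rightarrow> 'k modl \<Rightarrow> bool" where
  "is_iso A M N \<equiv> \<exists>f g. is_hom A M N f \<and> is_hom A N M g \<and>
     mmul (mdim N) g f = idm (mdim M) \<and> mmul (mdim M) f g = idm (mdim N)"

definition zmod :: "'k::zero modl" where
  "zmod = \<lparr>mdim = 0, mact = (\<lambda>_ _ _. 0)\<rparr>"

definition dsum :: "'k::zero modl \<Rightarrow> 'k modl \<Rightarrow> 'k modl" where
  "dsum M N = \<lparr>mdim = mdim M + mdim N,
     mact = (\<lambda>i r s. if r < mdim M \<and> s < mdim M then mact M i r s
                     else if mdim M \<le> r \<and> mdim M \<le> s then mact N i (r - mdim M) (s - mdim M)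
                     else 0)\<rparr>"

primrec mpow :: "'k::zero modl \<Rightarrow> nat \<Rightarrow> 'k modl" where
  "mpow T 0 = zmod"
| "mpow T (Suc r) = dsum T (mpow T r)"

definition in_Add :: "'k::field alg \<Rightarrow> 'k modl \<Rightarrow> 'k modl \<Rightarrow> bool" where
  "in_Add A T M \<equiv> is_module A M \<and> (\<exists>r s p. is_hom A M (mpow T r) s \<and> is_hom A (mpow T r) M p \<and>
      mmul (mdim (mpow T r)) p s = idm (mdim M))"

definition indecomposable :: "'k::field alg \<Rightarrow> 'k modl \<Rightarrow> bool" where
  "indecomposable A M \<equiv> is_module A M \<and> mdim M \<noteq> 0 \<and>
     \<not> (\<exists>X Y. is_module A X \<and> is_module A Y \<and> mdim X \<noteq> 0 \<and> mdim Y \<noteq> 0 \<and> is_iso A M (dsum X Y))"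

definition projective :: "'k::field alg \<Rightarrow> 'k modl \<Rightarrow> bool" where
  "projective A P \<equiv> is_module A P \<and>
     (\<forall>M N g h. is_module A M \<and> is_module A N \<and> is_hom A M N g \<and> surj_map (mdim M) (mdim N) g
        \<and> is_hom A P N h \<longrightarrow> (\<exists>h'. is_hom A P M h' \<and> mmul (mdim M) g h' = h))"

definition proj_resolution :: "'k::field alg \<Rightarrow> 'k modl \<Rightarrow> (nat \<Rightarrow> 'k modl) \<Rightarrow> (nat \<Rightarrow> 'k mx) \<Rightarrow> bool" where
  "proj_resolution A M P d \<equiv> is_module A M \<and>
     (\<forall>i. projective A (P i)) \<and>
     is_hom A (P 0) M (d 0) \<and> (\<forall>i. is_hom A (P (Suc i)) (P i) (d (Suc i))) \<and>
     surj_map (mdim (P 0)) (mdim M) (d 0) \<and>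
     (\<forall>i. exact_at (mdim (P (Suc i))) (mdim (P i)) (d (Suc i)) (d i))"

definition pd_le :: "'k::field alg \<Rightarrow> 'k modl \<Rightarrow> nat \<Rightarrow> bool" where
  "pd_le A M m \<equiv> \<exists>P d. proj_resolution A M P d \<and> (\<forall>i>m. mdim (P i) = 0)"

definition finite_pd :: "'k::field alg \<Rightarrow> 'k modl \<Rightarrow> bool" where
  "finite_pd A M \<equiv> \<exists>m. pd_le A M m"

definition pd :: "'k::field alg \<Rightarrow> 'k modl \<Rightarrow> nat" where
  "pd A M = (LEAST m. pd_le A M m)"

definition fdim :: "'k::field alg \<Rightarrow> enat" where
  "fdim A = Sup {enat (pd A M) | M. is_module A M \<and> finite_pd A M}"

(* Ext^n_A(M,N) = 0 (n >= 1), computed from (any) projective resolution of M *)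
definition ext_zero :: "'k::field alg \<Rightarrow> nat \<Rightarrow> 'k modl \<Rightarrow> 'k modl \<Rightarrow> bool" where
  "ext_zero A n M N \<equiv> \<forall>P d. proj_resolution A M P d \<longrightarrow>
     (\<forall>f. is_hom A (P n) N f \<and> mmul (mdim (P n)) f (d (Suc n)) = zmx \<longrightarrow>
        (\<exists>g. is_hom A (P (n - 1)) N g \<and> f = mmul (mdim (P (n - 1))) g (d n)))"

definition regmod :: "'k::field alg \<Rightarrow> 'k modl" where
  "regmod A = \<lparr>mdim = adim A,
     mact = (\<lambda>i r s. if i < adim A \<and> r < adim A \<and> s < adim A then amult A i s r else 0)\<rparr>"

definition exact_seq :: "'k::field alg \<Rightarrow> (nat \<Rightarrow> 'k modl) \<Rightarrow> (nat \<Rightarrow> 'k mx) \<Rightarrow> nat \<Rightarrow> bool" where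
  "exact_seq A X f n \<equiv> 1 \<le> n \<and> (\<forall>i\<le>n. is_module A (X i)) \<and>
     (\<forall>i<n. is_hom A (X i) (X (Suc i)) (f i)) \<and>
     inj_map (mdim (X 0)) (f 0) \<and> surj_map (mdim (X (n - 1))) (mdim (X n)) (f (n - 1)) \<and>
     (\<forall>i. Suc i < n \<longrightarrow> exact_at (mdim (X i)) (mdim (X (Suc i))) (f i) (f (Suc i)))"

definition gen_tilting :: "'k::field alg \<Rightarrow> 'k modl \<Rightarrow> bool" where
  "gen_tilting A T \<equiv> is_module A T \<and> finite_pd A T \<and> (\<forall>n\<ge>1. ext_zero A n T T) \<and>
     (\<exists>m X f. X 0 = regmod A \<and> (\<forall>i\<in>{1..Suc m}. in_Add A T (X i)) \<and> exact_seq A X f (Suc m))"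

definition is_duality :: "'k::field alg \<Rightarrow> ('k modl \<Rightarrow> 'k modl) \<Rightarrow> ('k modl \<Rightarrow> 'k modl \<Rightarrow> 'k mx \<Rightarrow> 'k mx) \<Rightarrow> bool" where
  "is_duality A Fo Fm \<equiv>
     (\<forall>M. is_module A M \<longrightarrow> is_module A (Fo M)) \<and>
     (\<forall>M N f. is_module A M \<and> is_module A N \<and> is_hom A M N f \<longrightarrow> is_hom A (Fo N) (Fo M) (Fm M N f)) \<and>
     (\<forall>M. is_module A M \<longrightarrow> Fm M M (idm (mdim M)) = idm (mdim (Fo M))) \<and>
     (\<forall>L M N f g. is_module A L \<and> is_module A M \<and> is_module A N \<and> is_hom A L M f \<and> is_hom A M N g \<longrightarrow>
        Fm L N (mmul (mdim M) g f) = mmul (mdim (Fo M)) (Fm L M f) (Fm M N g)) \<and>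
     (\<forall>L M N f g. is_module A L \<and> is_module A M \<and> is_module A N \<and> is_hom A L M f \<and> is_hom A M N g \<and>
        inj_map (mdim L) f \<and> surj_map (mdim M) (mdim N) g \<and> exact_at (mdim L) (mdim M) f g \<longrightarrow>
        inj_map (mdim (Fo N)) (Fm M N g) \<and> surj_map (mdim (Fo M)) (mdim (Fo L)) (Fm L M f) \<and>
        exact_at (mdim (Fo N)) (mdim (Fo M)) (Fm M N g) (Fm L M f)) \<and>
     (\<forall>M N. is_module A M \<and> is_module A N \<longrightarrow>
        bij_betw (Fm M N) {f. is_hom A M N f} {g. is_hom A (Fo N) (Fo M) g}) \<and>
     (\<forall>N. is_module A N \<longrightarrow> (\<exists>M. is_module A M \<and> is_iso A N (Fo M)))"

end

theory Submission
  imports Defs "HOL-Library.Function_Algebras"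
begin

text \<open>
  Let \<open>p = pd T\<close>, and let \<open>0 \<rightarrow> A \<rightarrow> T\<^sub>0 \<rightarrow> \<dots> \<rightarrow> T\<^sub>m \<rightarrow> 0\<close> be a coresolution with terms in \<open>Add(T)\<close>, first of minimal
  length \<open>m\<close> and then with \<open>T\<^sub>m\<close> of minimal dimension. A module \<open>M\<close> of finite projective dimension has
  \<open>pd M \<le> n\<close> as soon as \<open>Ext\<^sup>i(M, A) = 0\<close> for all \<open>i > n\<close>. Applied to \<open>T\<close> this gives \<open>p \<le> m\<close>.

  Every object of \<open>Add(T)\<close> is self-dual by decomposition into indecomposables, so \<open>T \<cong> T\<^sup>\<star>\<close> has injective
  dimension at most \<open>p\<close>. Shifting along the coresolution, \<open>Ext\<^sup>i(M, A) = 0\<close> for \<open>i > p + m\<close>; hence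
  \<open>pd M \<le> p + m\<close>.

  Conversely \<open>A\<^sup>\<star>\<close> is resolved by the \<open>T\<^sub>i\<^sup>\<star> \<cong> T\<^sub>i\<close>, and \<open>Ext\<^sup>2\<^sup>m(A\<^sup>\<star>, A)\<close> is the group of maps
  \<open>T\<^sub>m\<^sup>\<star> \<rightarrow> T\<^sub>m\<close> modulo those factoring through \<open>T\<^sub>m\<^sup>\<star> \<rightarrow> T\<^sub>m\<^sub>-\<^sub>1\<^sup>\<star>\<close> plus those factoring through
  \<open>T\<^sub>m\<^sub>-\<^sub>1 \<rightarrow> T\<^sub>m\<close>. If it vanished, an isomorphism \<open>Q\<^sup>\<star> \<cong> Q\<close> for an indecomposable summand \<open>Q\<close> of \<open>T\<^sub>m\<close> would make
  \<open>T\<^sub>m\<^sub>-\<^sub>1 \<rightarrow> T\<^sub>m \<rightarrow> Q\<close> split, because \<open>End Q\<close> is local, contradicting minimality. So \<open>2m \<le> pd A\<^sup>\<star> \<le> p + m\<close>, which forces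
  \<open>m = p\<close>.
\<close>

section \<open>Linear maps between coordinate spaces\<close>

text \<open>Only the vanishing of Ext is ever needed, so no Ext group is formed: each module gets
  one fixed free cover, and the long exact sequences appear as the single implications used in
  dimension shifting. In the first variable the covers of the three modules of an exact sequence are
  unrelated; there Ext^1 is recomputed through injectives, which the duality supplies. The duality
  is a functor on matrices whose additivity is not among its axioms. Direct sums therefore pass
  through it as split short exact sequences, and zero maps need an argument of their own. Splitting
  off one indecomposable \<open>Q\<close> shrinks the last term without shortening the coresolution,
  whence the double minimality; only a zero last term lowers the length. Null-homotopy writes the
  identity of \<open>Q\<close> as \<open>u + w\<close>, where \<open>w\<close> factors through
  \<open>T\<^sub>m\<^sub>-\<^sub>1\<close> and \<open>u\<close> through its dual. Locality makes one
  of them invertible. If it is \<open>u\<close>, fullness and faithfulness of the duality still turn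
  the splitting through the dual into one through \<open>T\<^sub>m\<^sub>-\<^sub>1\<close>.\<close>

definition scl :: "'k::field \<Rightarrow> (nat \<Rightarrow> 'k) \<Rightarrow> nat \<Rightarrow> 'k" where
  "scl c v = (\<lambda>i. c * v i)"

lemma scl_apply: "scl c v i = c * v i"
  by (simp add: scl_def)

text \<open>As simp rules, these would rewrite \<open>\<lambda>i. (\<phi> u + \<phi> v) i\<close>, the \<open>\<eta>\<close>-expanded form in which
  additivity rules for a variable map are applied, and so break up sums of vectors.\<close>
lemmas vec_apply = plus_fun_apply zero_fun_apply minus_apply uminus_apply scl_apply
declare vec_apply [simp del]

text \<open>The type constraint restricts these rules to maps applied to vectors; sums of vectors
  stay closed.\<close>

lemma map_apply [simp]:
  fixes \<phi> \<psi> :: "(nat \<Rightarrow> 'k::field) \<Rightarrow> nat \<Rightarrow> 'k"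
  shows "(\<phi> + \<psi>) v = \<phi> v + \<psi> v" "(\<phi> - \<psi>) v = \<phi> v - \<psi> v" "(0 :: (nat \<Rightarrow> 'k) \<Rightarrow> nat \<Rightarrow> 'k) v = 0"
  by (simp_all add: vec_apply)

interpretation vs: vector_space scl
  by unfold_locales (auto simp: fun_eq_iff vec_apply algebra_simps)

interpretation vp: vector_space_pair scl scl ..

abbreviation lin :: "((nat \<Rightarrow> 'k::field) \<Rightarrow> nat \<Rightarrow> 'k) \<Rightarrow> bool" where
  "lin \<equiv> Vector_Spaces.linear scl scl"

text \<open>The projection of all sequences onto the first \<open>n\<close> coordinates. It will be
  the identity morphism of an \<open>n\<close>-dimensional module, and invariance under
  precomposition with it says that a map ignores the remaining coordinates.\<close>

definition trunc :: "nat \<Rightarrow> (nat \<Rightarrow> 'k::zero) \<Rightarrow> nat \<Rightarrow> 'k" where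
  "trunc n v = (\<lambda>i. if i < n then v i else 0)"

definition vecs :: "nat \<Rightarrow> (nat \<Rightarrow> 'k::zero) set" where
  "vecs n = {v. vec_wf n v}"

definition unit_vec :: "nat \<Rightarrow> nat \<Rightarrow> 'k::zero_neq_one" where
  "unit_vec j = (\<lambda>i. if i = j then 1 else 0)"

lemma sum_fun_apply: "(\<Sum>s\<in>S. f s) x = (\<Sum>s\<in>S. f s x :: 'b::comm_monoid_add)"
  by (induction S rule: infinite_finite_induct) (auto simp: vec_apply)

lemma linI:
  assumes "\<And>u v. \<phi> (u + v) = \<phi> u + \<phi> v" "\<And>c v. \<phi> (scl c v) = scl c (\<phi> v)"
  shows "lin \<phi>"
  by (rule Vector_Spaces.linear.intro, unfold_locales) (simp_all add: assms)

lemma lin_simps: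
  assumes "lin \<phi>"
  shows "\<phi> (u + v) = \<phi> u + \<phi> v" "\<phi> (scl c v) = scl c (\<phi> v)" "\<phi> 0 = 0"
    "\<phi> (u - v) = \<phi> u - \<phi> v" "\<phi> (- v) = - \<phi> v"
  using vp.linear_add[OF assms] vp.linear_scale[OF assms] vp.linear_0[OF assms]
    vp.linear_diff[OF assms] vp.linear_neg[OF assms] by blast+

lemma lin_sum: "lin \<phi> \<Longrightarrow> \<phi> (\<Sum>s\<in>S. f s) = (\<Sum>s\<in>S. \<phi> (f s))"
  by (rule vp.linear_sum)

lemma lin_comp: "lin \<psi> \<Longrightarrow> lin \<phi> \<Longrightarrow> lin (\<psi> \<circ> \<phi>)"
  by (intro linI) (simp_all add: lin_simps)

lemma lin_add: "lin \<psi> \<Longrightarrow> lin \<phi> \<Longrightarrow> lin (\<psi> + \<phi>)"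
  by (intro linI) (simp_all add: lin_simps algebra_simps vec_apply fun_eq_iff)

lemma lin_diff: "lin \<psi> \<Longrightarrow> lin \<phi> \<Longrightarrow> lin (\<psi> - \<phi>)"
  by (intro linI) (simp_all add: lin_simps algebra_simps vec_apply fun_eq_iff)

lemma lin_0: "lin 0"
  by (intro linI) simp_all

lemma mem_vecs: "v \<in> vecs n \<longleftrightarrow> (\<forall>i\<ge>n. v i = 0)"
  by (simp add: vecs_def vec_wf_def)

lemma trunc_in_vecs [simp]: "trunc n v \<in> vecs n"
  by (simp add: mem_vecs trunc_def)

lemma trunc_vecs: "v \<in> vecs n \<Longrightarrow> trunc n v = v"
  by (auto simp: mem_vecs trunc_def fun_eq_iff)

lemma trunc_trunc [simp]: "trunc n (trunc n v) = trunc n v"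
  by (simp add: trunc_vecs)

lemma lin_trunc: "lin (trunc n)"
  by (intro linI) (auto simp: trunc_def fun_eq_iff vec_apply)

lemma subspace_vecs: "vs.subspace (vecs n)"
  by (auto simp: vs.subspace_def mem_vecs vec_apply)

lemma trunc_eq_sum: "trunc n v = (\<Sum>j<n. scl (v j) (unit_vec j))"
proof
  fix i
  have "(\<Sum>j<n. scl (v j) (unit_vec j)) i = (\<Sum>j<n. if j = i then v i else 0)"
    unfolding sum_fun_apply by (rule sum.cong) (auto simp: unit_vec_def vec_apply)
  then show "trunc n v i = (\<Sum>j<n. scl (v j) (unit_vec j)) i"
    by (simp add: trunc_def)
qed

lemma unit_vec_in_vecs [simp]: "unit_vec j \<in> vecs n \<longleftrightarrow> j < n"
  by (auto simp: mem_vecs unit_vec_def)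

lemma inj_unit_vec: "inj unit_vec"
  by (rule injI) (metis unit_vec_def zero_neq_one)

lemma vecs_span: "vecs n = vs.span (unit_vec ` {..<n} :: (nat \<Rightarrow> 'a::field) set)"
proof (rule equalityI[OF subsetI])
  fix v :: "nat \<Rightarrow> 'a" assume "v \<in> vecs n"
  then have "v = (\<Sum>j<n. scl (v j) (unit_vec j))"
    by (metis trunc_eq_sum trunc_vecs)
  also have "\<dots> \<in> vs.span (unit_vec ` {..<n})"
    by (intro vs.span_sum vs.span_scale vs.span_base) auto
  finally show "v \<in> vs.span (unit_vec ` {..<n})" .
qed (rule vs.span_minimal, auto simp: subspace_vecs)

lemma independent_unit_vec: "vs.independent (unit_vec ` {..<n} :: (nat \<Rightarrow> 'a::field) set)"
proof (rule vs.independent_if_scalars_zero)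
  fix f :: "(nat \<Rightarrow> 'a) \<Rightarrow> 'a" and x :: "nat \<Rightarrow> 'a"
  assume 0: "(\<Sum>x\<in>unit_vec ` {..<n}. scl (f x) x) = 0" and "x \<in> unit_vec ` {..<n}"
  then obtain j where j: "j < n" "x = unit_vec j" by auto
  have "trunc n (\<lambda>j. f (unit_vec j)) = 0"
    using 0 by (subst (asm) sum.reindex) (auto intro: inj_on_subset[OF inj_unit_vec] simp: trunc_eq_sum)
  from fun_cong[OF this, of j] show "f x = 0"
    using j by (simp add: trunc_def vec_apply)
qed simp

text \<open>The images of the unit vectors stay independent, so the exchange lemma bounds their
  number. The ambient space of sequences is infinite-dimensional, hence a comparison of finite
  spanning sets.\<close>

lemma lin_inj_dim_le:
  assumes "lin \<phi>" "\<And>v. v \<in> vecs a \<Longrightarrow> \<phi> v \<in> vecs b" "\<And>v. v \<in> vecs a \<Longrightarrow> \<phi> v = 0 \<Longrightarrow> v = 0"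
  shows "a \<le> b"
proof -
  have inj: "inj_on \<phi> (vecs a)"
  proof (rule inj_onI)
    fix u v assume "u \<in> vecs a" "v \<in> vecs a" "\<phi> u = \<phi> v"
    then show "u = v" using assms(3)[of "u - v"] assms(1)
      by (simp add: lin_simps vs.subspace_diff[OF subspace_vecs])
  qed
  then have "vs.independent (\<phi> ` unit_vec ` {..<a})"
    unfolding vecs_span by (rule vp.linear_independent_injective_image[OF assms(1) independent_unit_vec])
  moreover have "\<phi> ` unit_vec ` {..<a} \<subseteq> vs.span (unit_vec ` {..<b})"
    using assms(2) by (auto simp flip: vecs_span)
  ultimately have "card (\<phi> ` unit_vec ` {..<a}) \<le> card (unit_vec ` {..<b} :: (nat \<Rightarrow> 'a) set)"
    using vs.independent_span_bound[of "unit_vec ` {..<b}"] by blast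
  moreover have "inj_on \<phi> (unit_vec ` {..<a})"
    by (rule inj_on_subset[OF inj]) auto
  ultimately show ?thesis
    by (simp add: card_image inj_on_subset[OF inj_unit_vec])
qed

text \<open>Substructures of coordinate modules must again be coordinate modules. A basis of
  \<open>S\<close> gives the chart \<open>\<beta>\<close>; \<open>\<gamma>\<close> is a linear left
  inverse of it, defined on the whole space.\<close>

lemma subspace_coordinates:
  assumes S: "vs.subspace S" "S \<subseteq> vecs n"
  obtains d \<beta> \<gamma> where "lin \<beta>" "lin \<gamma>" "range \<beta> = S" "\<And>v. \<beta> (trunc d v) = \<beta> v"
    "\<And>v. \<gamma> v \<in> vecs d" "\<And>v. \<gamma> (\<beta> v) = trunc d v" "\<And>s. s \<in> S \<Longrightarrow> \<beta> (\<gamma> s) = s"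
proof -
  obtain B where B: "B \<subseteq> S" "vs.independent B" "S \<subseteq> vs.span B"
    using vs.maximal_independent_subset by blast
  have fin: "finite B"
    using vs.independent_span_bound[of "unit_vec ` {..<n}" B] B S(2) by (auto simp: vecs_span)
  then obtain b where b: "bij_betw b {..<card B} B"
    using ex_bij_betw_nat_finite[of B] by (auto simp: atLeast0LessThan)
  let ?d = "card B"
  define \<beta> where "\<beta> v = (\<Sum>j<?d. scl (v j) (b j))" for v :: "nat \<Rightarrow> 'a"
  have lin: "lin \<beta>"
    by (intro linI) (auto simp: \<beta>_def fun_eq_iff sum_fun_apply vec_apply algebra_simps sum.distrib sum_distrib_left)
  have tr: "\<beta> (trunc ?d v) = \<beta> v" for v
    unfolding \<beta>_def by (rule sum.cong) (auto simp: trunc_def)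
  have bS: "b j \<in> S" if "j < ?d" for j
    using that b B(1) by (auto simp: bij_betw_def)
  have ran: "range \<beta> = S"
  proof
    show "range \<beta> \<subseteq> S"
      unfolding \<beta>_def using S(1) bS by (auto intro!: vs.subspace_sum vs.subspace_scale)
    show "S \<subseteq> range \<beta>"
    proof
      fix s assume "s \<in> S"
      then obtain u where "s = (\<Sum>x\<in>B. scl (u x) x)"
        using B(3) by (auto simp: vs.span_finite[OF fin])
      also have "\<dots> = \<beta> (\<lambda>j. u (b j))"
        unfolding \<beta>_def by (rule sum.reindex_bij_betw[OF b, symmetric])
      finally show "s \<in> range \<beta>" by blast
    qed
  qed
  have inj0: "v = 0" if v: "v \<in> vecs ?d" "\<beta> v = 0" for v
  proof
    fix i
    show "v i = 0 i"
    proof (cases "i < ?d")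
      case True
      \<comment> \<open>Independence speaks of coefficient functions on the set \<open>B\<close>, so
        the coordinates are moved there along the inverse of the enumeration
        \<open>b\<close>.\<close>
      let ?u = "\<lambda>x. v (the_inv_into {..<?d} b x)"
      have inv: "the_inv_into {..<?d} b (b j) = j" if "j < ?d" for j
        using that b by (auto simp: bij_betw_def the_inv_into_f_f)
      have "(\<Sum>x\<in>B. scl (?u x) x) = (\<Sum>j<?d. scl (?u (b j)) (b j))"
        by (rule sum.reindex_bij_betw[OF b, symmetric])
      also have "\<dots> = \<beta> v" unfolding \<beta>_def by (rule sum.cong) (auto simp: inv)
      finally have "?u x = 0" if "x \<in> B" for x
        using vs.independentD[OF B(2) fin subset_refl _ that, of ?u] v(2) by simp
      from this[of "b i"] show ?thesis
        using True b inv by (auto simp: bij_betw_def vec_apply)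
    qed (use v in \<open>auto simp: mem_vecs vec_apply\<close>)
  qed
  have "inj_on \<beta> (vecs ?d)"
  proof (rule inj_onI)
    fix u v assume "u \<in> vecs ?d" "v \<in> vecs ?d" "\<beta> u = \<beta> v"
    then show "u = v" using inj0[of "u - v"] lin
      by (simp add: lin_simps vs.subspace_diff[OF subspace_vecs])
  qed
  from vp.linear_exists_left_inverse_on[OF lin subspace_vecs this]
  obtain \<gamma> where g: "range \<gamma> \<subseteq> vecs ?d" "lin \<gamma>" "\<And>v. v \<in> vecs ?d \<Longrightarrow> \<gamma> (\<beta> v) = v" by blast
  have gb: "\<gamma> (\<beta> v) = trunc ?d v" for v
    using g(3)[of "trunc ?d v"] by (simp add: tr)
  have "\<beta> (\<gamma> s) = s" if "s \<in> S" for s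
    using that ran gb tr by (metis rangeE)
  with lin g(1,2) ran tr gb show ?thesis by (intro that[of \<beta> \<gamma> ?d]) auto
qed

text \<open>The quotient is modelled on a complement: \<open>r\<close> is the projection of
  \<open>vecs n\<close> with kernel \<open>S\<close>, and a chart of its range gives both the
  quotient map and the section.\<close>

lemma quotient_coordinates:
  assumes S: "vs.subspace S" "S \<subseteq> vecs n"
  obtains d \<pi> \<sigma> where "lin \<pi>" "lin \<sigma>" "\<And>v. \<pi> (trunc n v) = \<pi> v" "\<And>v. \<pi> v \<in> vecs d"
    "\<And>v. \<sigma> v \<in> vecs n" "\<And>v. \<pi> (\<sigma> v) = trunc d v" "\<And>v. v \<in> vecs n \<Longrightarrow> \<pi> v = 0 \<longleftrightarrow> v \<in> S"
proof -
  from vp.linear_exists_left_inverse_on[OF vs.linear_id S(1), simplified]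
  obtain g where g: "range g \<subseteq> S" "lin g" "\<And>v. v \<in> S \<Longrightarrow> g v = v" by auto
  define r where "r v = trunc n v - g (trunc n v)" for v
  have lr: "lin r"
    by (intro linI) (simp_all add: r_def lin_simps[OF lin_trunc] lin_simps[OF g(2)] algebra_simps vs.scale_right_diff_distrib)
  have rv: "r v \<in> vecs n" for v
    using g(1) S(2) unfolding r_def by (intro vs.subspace_diff subspace_vecs) auto
  have rr: "r (r v) = r v" for v
  proof -
    have "g (g (trunc n v)) = g (trunc n v)" using g(1,3) by blast
    then have "g (r v) = 0" by (simp add: r_def lin_simps[OF g(2)])
    then show ?thesis using trunc_vecs[OF rv] by (simp add: r_def[of "r v"])
  qed
  have "vs.subspace (range r)"
    using vp.linear_subspace_image[OF lr vs.subspace_UNIV] .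
  then obtain d \<beta> \<gamma> where b: "lin \<beta>" "lin \<gamma>" "range \<beta> = range r" "\<And>v. \<beta> (trunc d v) = \<beta> v"
    "\<And>v. \<gamma> v \<in> vecs d" "\<And>v. \<gamma> (\<beta> v) = trunc d v" "\<And>s. s \<in> range r \<Longrightarrow> \<beta> (\<gamma> s) = s"
    using rv by (elim subspace_coordinates) auto
  have r_beta: "r (\<beta> v) = \<beta> v" for v
    using b(3) rr by (metis rangeE rangeI)
  show ?thesis
  proof
    show "lin (\<gamma> \<circ> r)" "lin \<beta>" using b lr by (auto intro: lin_comp)
    show "(\<gamma> \<circ> r) (trunc n v) = (\<gamma> \<circ> r) v" for v by (simp add: r_def)
    show "(\<gamma> \<circ> r) v \<in> vecs d" for v using b by simp
    show "\<beta> v \<in> vecs n" for v using b(3) rv by (metis rangeE rangeI)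
    show "(\<gamma> \<circ> r) (\<beta> v) = trunc d v" for v using b(6) r_beta by simp
    show "(\<gamma> \<circ> r) v = 0 \<longleftrightarrow> v \<in> S" if v: "v \<in> vecs n" for v
    proof -
      have "(\<gamma> \<circ> r) v = 0 \<longleftrightarrow> r v = 0"
        using b(7)[of "r v"] by (auto simp: lin_simps[OF b(1)] lin_simps[OF b(2)])
      also have "\<dots> \<longleftrightarrow> v \<in> S"
        using g(1,3) v by (auto simp: r_def trunc_vecs)
      finally show ?thesis .
    qed
  qed
qed

subsection \<open>Matrices\<close>

definition mat_of :: "nat \<Rightarrow> ((nat \<Rightarrow> 'k::field) \<Rightarrow> nat \<Rightarrow> 'k) \<Rightarrow> 'k mx" where
  "mat_of n \<phi> = (\<lambda>i j. if j < n then \<phi> (unit_vec j) i else 0)"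

lemma lin_mvec: "lin (mvec n f)"
  by (intro linI) (auto simp: mvec_def fun_eq_iff vec_apply algebra_simps sum.distrib sum_distrib_left)

lemma mvec_trunc [simp]: "mvec n f (trunc n v) = mvec n f v"
  by (auto simp: mvec_def trunc_def fun_eq_iff)

lemma mvec_unit_vec: "j < n \<Longrightarrow> mvec n f (unit_vec j) i = f i j"
  by (simp add: mvec_def unit_vec_def if_distrib cong: if_cong)

lemma mvec_in_vecs: "mat_wf m n f \<Longrightarrow> mvec n f v \<in> vecs m"
  by (auto simp: mem_vecs mvec_def mat_wf_def intro!: sum.neutral)

lemma mvec_mmul: "mvec n (mmul m g f) = mvec m g \<circ> mvec n f"
proof -
  have "(\<Sum>j<n. (\<Sum>k<m. g i k * f k j) * v j) = (\<Sum>k<m. g i k * (\<Sum>j<n. f k j * v j))" for i v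
    by (simp add: sum_distrib_left sum_distrib_right mult.assoc) (rule sum.swap)
  then show ?thesis by (simp add: fun_eq_iff mvec_def mmul_def)
qed

lemma mvec_idm: "mvec n (idm n) = trunc n"
  by (auto simp: fun_eq_iff vec_apply mvec_def idm_def trunc_def if_distrib if_distribR sum.If_cases cong: if_cong)

lemma mvec_zmx: "mvec n zmx = 0"
  by (auto simp: fun_eq_iff vec_apply mvec_def zmx_def)

lemma mat_wf_eqI:
  assumes "mat_wf m n f" "mat_wf m' n g" "mvec n f = mvec n g"
  shows "f = g"
proof (intro ext)
  fix i j show "f i j = g i j"
  proof (cases "j < n")
    case True then show ?thesis using mvec_unit_vec[of j n] assms(3) by metis
  qed (use assms(1,2) in \<open>auto simp: mat_wf_def\<close>)
qed

lemma mat_wf_eq_iff: "mat_wf m n f \<Longrightarrow> mat_wf m' n g \<Longrightarrow> f = g \<longleftrightarrow> mvec n f = mvec n g"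
  using mat_wf_eqI by blast

lemma mat_wf_mmul: "mat_wf m k g \<Longrightarrow> mat_wf k n f \<Longrightarrow> mat_wf m n (mmul k g f)"
  by (auto simp: mat_wf_def mmul_def intro!: sum.neutral)

lemma mat_wf_idm: "mat_wf n n (idm n)"
  by (auto simp: mat_wf_def idm_def)

lemma mat_wf_zmx: "mat_wf m n zmx"
  by (auto simp: mat_wf_def zmx_def)

lemma mvec_mat_of:
  assumes "lin \<phi>" "\<And>v. \<phi> (trunc n v) = \<phi> v"
  shows "mvec n (mat_of n \<phi>) = \<phi>"
proof
  fix v
  have "\<phi> v = (\<Sum>j<n. scl (v j) (\<phi> (unit_vec j)))"
    using assms by (metis (no_types, lifting) lin_sum lin_simps(2) sum.cong trunc_eq_sum)
  then show "mvec n (mat_of n \<phi>) v = \<phi> v"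
    by (simp add: fun_eq_iff sum_fun_apply vec_apply mvec_def mat_of_def mult.commute)
qed

lemma mat_wf_mat_of: "(\<And>v. \<phi> v \<in> vecs m) \<Longrightarrow> mat_wf m n (mat_of n \<phi>)"
  by (auto simp: mat_wf_def mat_of_def mem_vecs)

lemma mat_of_mvec: "mat_wf m n f \<Longrightarrow> mat_of n (mvec n f) = f"
  by (intro ext) (auto simp: mat_of_def mvec_unit_vec mat_wf_def)

section \<open>Modules and homomorphisms as linear maps\<close>

definition act :: "'k::field modl \<Rightarrow> nat \<Rightarrow> (nat \<Rightarrow> 'k) \<Rightarrow> nat \<Rightarrow> 'k" where
  "act M i = mvec (mdim M) (mact M i)"

abbreviation car :: "'k::zero modl \<Rightarrow> (nat \<Rightarrow> 'k) set" where
  "car M \<equiv> vecs (mdim M)"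

abbreviation one :: "'k::zero modl \<Rightarrow> (nat \<Rightarrow> 'k) \<Rightarrow> nat \<Rightarrow> 'k" where
  "one M \<equiv> trunc (mdim M)"

definition monic :: "'k::field modl \<Rightarrow> ((nat \<Rightarrow> 'k) \<Rightarrow> nat \<Rightarrow> 'k) \<Rightarrow> bool" where
  "monic M \<phi> \<longleftrightarrow> (\<forall>v\<in>car M. \<phi> v = 0 \<longrightarrow> v = 0)"

text \<open>Preimages range over all sequences, so the source is not a parameter. For homomorphisms,
  truncating a preimage puts it into the carrier.\<close>

definition epic :: "'k::field modl \<Rightarrow> ((nat \<Rightarrow> 'k) \<Rightarrow> nat \<Rightarrow> 'k) \<Rightarrow> bool" where
  "epic N \<phi> \<longleftrightarrow> (\<forall>w\<in>car N. \<exists>v. \<phi> v = w)"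

lemma lin_act: "lin (act M i)"
  by (simp add: act_def lin_mvec)

lemma act_one [simp]: "act M i (one M v) = act M i v"
  by (simp add: act_def)

locale fd_algebra =
  fixes A :: "'k::field alg"
  assumes fd: "is_fd_algebra A"
begin

abbreviation ob :: "'k modl \<Rightarrow> bool" where
  "ob M \<equiv> is_module A M"

text \<open>A homomorphism is stored as a linear map on all sequences that ignores the coordinates
  beyond the dimension of its source, so that homomorphisms compose by \<open>(\<circ>)\<close>, add pointwise, and
  \<^term>\<open>one M\<close> is the identity of \<open>M\<close>.\<close>
definition Hom :: "'k modl \<Rightarrow> 'k modl \<Rightarrow> ((nat \<Rightarrow> 'k) \<Rightarrow> nat \<Rightarrow> 'k) set" where
  "Hom M N = {\<phi>. lin \<phi> \<and> (\<forall>v. \<phi> (one M v) = \<phi> v) \<and> (\<forall>v. \<phi> v \<in> car N) \<and>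
     (\<forall>i<adim A. \<forall>v. \<phi> (act M i v) = act N i (\<phi> v))}"

lemma HomI:
  assumes "lin \<phi>" "\<And>v. \<phi> (one M v) = \<phi> v" "\<And>v. \<phi> v \<in> car N"
    "\<And>i v. i < adim A \<Longrightarrow> \<phi> (act M i v) = act N i (\<phi> v)"
  shows "\<phi> \<in> Hom M N"
  using assms by (simp add: Hom_def)

lemma HomD:
  assumes "\<phi> \<in> Hom M N"
  shows "lin \<phi>" "\<phi> (one M v) = \<phi> v" "\<phi> v \<in> car N" "i < adim A \<Longrightarrow> \<phi> (act M i v) = act N i (\<phi> v)"
  using assms by (simp_all add: Hom_def)

lemmas Hom_lin = lin_simps[OF HomD(1)]

lemma Hom_one_left: "\<phi> \<in> Hom M N \<Longrightarrow> one N (\<phi> v) = \<phi> v"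
  by (simp add: HomD(3) trunc_vecs)

lemma Hom_comp_one: "\<phi> \<in> Hom M N \<Longrightarrow> \<phi> \<circ> one M = \<phi>"
  by (simp add: fun_eq_iff[where f = "_ \<circ> _"] HomD(2))

lemma Hom_one_comp: "\<phi> \<in> Hom M N \<Longrightarrow> one N \<circ> \<phi> = \<phi>"
  by (simp add: fun_eq_iff[where f = "_ \<circ> _"] Hom_one_left)

lemma Hom_comp: "\<psi> \<in> Hom N L \<Longrightarrow> \<phi> \<in> Hom M N \<Longrightarrow> \<psi> \<circ> \<phi> \<in> Hom M L"
  by (rule HomI) (auto simp: HomD lin_comp)

lemma Hom_add: "\<psi> \<in> Hom M N \<Longrightarrow> \<phi> \<in> Hom M N \<Longrightarrow> \<psi> + \<phi> \<in> Hom M N"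
  by (rule HomI) (auto simp: HomD lin_add lin_simps[OF lin_act] vs.subspace_add[OF subspace_vecs])

lemma Hom_diff: "\<psi> \<in> Hom M N \<Longrightarrow> \<phi> \<in> Hom M N \<Longrightarrow> \<psi> - \<phi> \<in> Hom M N"
  by (rule HomI) (auto simp: HomD lin_diff lin_simps[OF lin_act] vs.subspace_diff[OF subspace_vecs])

lemma Hom_zero: "0 \<in> Hom M N"
  by (rule HomI) (auto simp: lin_0 lin_simps[OF lin_act] vs.subspace_0[OF subspace_vecs])

lemma Hom_eqI:
  assumes "\<phi> \<in> Hom M N" "\<psi> \<in> Hom M N'" "\<And>v. v \<in> car M \<Longrightarrow> \<phi> v = \<psi> v"
  shows "\<phi> = \<psi>"
proof
  fix v show "\<phi> v = \<psi> v" using assms(3)[of "one M v"] HomD(2)[OF assms(1)] HomD(2)[OF assms(2)] by simp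
qed

lemma act_in_car: "ob M \<Longrightarrow> i < adim A \<Longrightarrow> act M i v \<in> car M"
  by (simp add: act_def is_module_def mvec_in_vecs)

lemma Hom_one: "ob M \<Longrightarrow> one M \<in> Hom M M"
  by (rule HomI) (auto simp: lin_trunc trunc_vecs act_in_car)

lemma module_iff:
  "ob M \<longleftrightarrow> (\<forall>i<adim A. mat_wf (mdim M) (mdim M) (mact M i)) \<and> (\<forall>i\<ge>adim A. mact M i = zmx) \<and>
     (\<forall>i<adim A. \<forall>j<adim A. \<forall>v. act M i (act M j v) = (\<Sum>l<adim A. scl (amult A i j l) (act M l v))) \<and>
     (\<forall>v. (\<Sum>i<adim A. scl (aunit A i) (act M i v)) = one M v)"
proof -
  let ?n = "mdim M"
  have lc: "mvec ?n (\<lambda>r s. \<Sum>l<adim A. c l * mact M l r s) = (\<lambda>v. \<Sum>l<adim A. scl (c l) (act M l v))" for c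
  proof (intro ext)
    fix v r
    have "(\<Sum>s<?n. (\<Sum>l<adim A. c l * mact M l r s) * v s) = (\<Sum>l<adim A. c l * (\<Sum>s<?n. mact M l r s * v s))"
      by (simp add: sum_distrib_left sum_distrib_right mult.assoc) (rule sum.swap)
    then show "mvec ?n (\<lambda>r s. \<Sum>l<adim A. c l * mact M l r s) v r = (\<Sum>l<adim A. scl (c l) (act M l v)) r"
      by (simp add: mvec_def act_def sum_fun_apply vec_apply)
  qed
  have wf_lc: "mat_wf ?n ?n (\<lambda>r s. \<Sum>l<adim A. c l * mact M l r s)"
    if "\<forall>i<adim A. mat_wf ?n ?n (mact M i)" for c
    using that by (auto simp: mat_wf_def intro!: sum.neutral)
  have "(mmul ?n (mact M i) (mact M j) = (\<lambda>r s. \<Sum>l<adim A. amult A i j l * mact M l r s)) \<longleftrightarrow>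
     (\<forall>v. act M i (act M j v) = (\<Sum>l<adim A. scl (amult A i j l) (act M l v)))"
    if "\<forall>i<adim A. mat_wf ?n ?n (mact M i)" "i < adim A" "j < adim A" for i j
  proof -
    have "mat_wf ?n ?n (mmul ?n (mact M i) (mact M j))"
      using that by (intro mat_wf_mmul) auto
    then have "(mmul ?n (mact M i) (mact M j) = (\<lambda>r s. \<Sum>l<adim A. amult A i j l * mact M l r s)) \<longleftrightarrow>
       mvec ?n (mmul ?n (mact M i) (mact M j)) = mvec ?n (\<lambda>r s. \<Sum>l<adim A. amult A i j l * mact M l r s)"
      by (rule mat_wf_eq_iff[OF _ wf_lc[OF that(1)]])
    moreover have "mvec ?n (mmul ?n (mact M i) (mact M j)) = (\<lambda>v. act M i (act M j v))"
      by (simp add: mvec_mmul act_def comp_def)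
    ultimately show ?thesis unfolding lc by (simp only: fun_eq_iff[where f = "\<lambda>v. act M i (act M j v)"])
  qed
  moreover have "((\<lambda>r s. \<Sum>i<adim A. aunit A i * mact M i r s) = idm ?n) \<longleftrightarrow>
     (\<forall>v. (\<Sum>i<adim A. scl (aunit A i) (act M i v)) = one M v)"
    if "\<forall>i<adim A. mat_wf ?n ?n (mact M i)"
  proof -
    have "((\<lambda>r s. \<Sum>i<adim A. aunit A i * mact M i r s) = idm ?n) \<longleftrightarrow>
       mvec ?n (\<lambda>r s. \<Sum>i<adim A. aunit A i * mact M i r s) = mvec ?n (idm ?n)"
      by (rule mat_wf_eq_iff[OF wf_lc[OF that] mat_wf_idm])
    then show ?thesis
      unfolding lc mvec_idm by (simp only: fun_eq_iff[where g = "one M"])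
  qed
  ultimately show ?thesis
    unfolding is_module_def by blast
qed

lemma act_act:
  "ob M \<Longrightarrow> i < adim A \<Longrightarrow> j < adim A \<Longrightarrow> act M i (act M j v) = (\<Sum>l<adim A. scl (amult A i j l) (act M l v))"
  by (simp add: module_iff)

lemma act_unit: "ob M \<Longrightarrow> (\<Sum>i<adim A. scl (aunit A i) (act M i v)) = one M v"
  by (simp add: module_iff)

section \<open>Submodules, quotient modules, kernels, cokernels and factorizations\<close>

lemma module_of_operators:
  assumes "\<And>i. i < adim A \<Longrightarrow> lin (\<alpha> i)" "\<And>i v. i < adim A \<Longrightarrow> \<alpha> i (trunc n v) = \<alpha> i v"
    "\<And>i v. i < adim A \<Longrightarrow> \<alpha> i v \<in> vecs n"
    "\<And>i j v. i < adim A \<Longrightarrow> j < adim A \<Longrightarrow> \<alpha> i (\<alpha> j v) = (\<Sum>l<adim A. scl (amult A i j l) (\<alpha> l v))"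
    "\<And>v. (\<Sum>i<adim A. scl (aunit A i) (\<alpha> i v)) = trunc n v"
  obtains M where "ob M" "mdim M = n" "\<And>i. i < adim A \<Longrightarrow> act M i = \<alpha> i"
proof -
  let ?M = "\<lparr>mdim = n, mact = \<lambda>i. if i < adim A then mat_of n (\<alpha> i) else zmx\<rparr>"
  have a: "act ?M i = \<alpha> i" if "i < adim A" for i
    using that assms(1,2) by (simp add: act_def mvec_mat_of)
  have "ob ?M"
    unfolding module_iff using assms(3-5) by (simp add: a mat_wf_mat_of)
  with a show ?thesis by (intro that[of ?M]) auto
qed

lemma submodule:
  assumes M: "ob M" and S: "vs.subspace S" "S \<subseteq> car M" "\<And>i v. i < adim A \<Longrightarrow> v \<in> S \<Longrightarrow> act M i v \<in> S"
  obtains K \<iota> where "ob K" "\<iota> \<in> Hom K M" "monic K \<iota>" "range \<iota> = S"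
proof -
  obtain d \<beta> \<gamma> where b: "lin \<beta>" "lin \<gamma>" "range \<beta> = S" "\<And>v. \<beta> (trunc d v) = \<beta> v"
    "\<And>v. \<gamma> v \<in> vecs d" "\<And>v. \<gamma> (\<beta> v) = trunc d v" "\<And>s. s \<in> S \<Longrightarrow> \<beta> (\<gamma> s) = s"
    by (rule subspace_coordinates[OF S(1,2)], rule that)
  have bS: "\<beta> v \<in> S" for v using b(3) by blast
  \<comment> \<open>The transported action is \<open>\<gamma>\<close> after \<open>act M i\<close>
    after \<open>\<beta>\<close>; invariance of \<open>S\<close> makes \<open>\<gamma>\<close>
    lossless on the vectors that occur, so the module relations carry over.\<close>
  have ab: "\<beta> (\<gamma> (act M i (\<beta> v))) = act M i (\<beta> v)" if "i < adim A" for i v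
    using that bS S(3) b(7) by blast
  obtain K where K: "ob K" "mdim K = d" "\<And>i. i < adim A \<Longrightarrow> act K i = (\<lambda>v. \<gamma> (act M i (\<beta> v)))"
  proof (rule module_of_operators)
    show "lin (\<lambda>v. \<gamma> (act M i (\<beta> v)))" for i
      using lin_comp[OF b(2) lin_comp[OF lin_act[of M i] b(1)]] by (simp add: comp_def)
    show "\<gamma> (act M i (\<beta> (\<gamma> (act M j (\<beta> v))))) = (\<Sum>l<adim A. scl (amult A i j l) (\<gamma> (act M l (\<beta> v))))"
      if "i < adim A" "j < adim A" for i j v
      using that by (simp add: ab act_act[OF M] lin_sum[OF b(2)] lin_simps(2)[OF b(2)])
    show "(\<Sum>i<adim A. scl (aunit A i) (\<gamma> (act M i (\<beta> v)))) = trunc d v" for v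
    proof -
      have "(\<Sum>i<adim A. scl (aunit A i) (\<gamma> (act M i (\<beta> v)))) = \<gamma> (\<Sum>i<adim A. scl (aunit A i) (act M i (\<beta> v)))"
        by (simp add: lin_sum[OF b(2)] lin_simps(2)[OF b(2)])
      also have "\<dots> = \<gamma> (\<beta> v)"
        unfolding act_unit[OF M] using bS S(2) by (metis subsetD trunc_vecs)
      finally show ?thesis by (simp add: b(6))
    qed
  qed (use b(4,5) in auto)
  show ?thesis
  proof
    show "\<beta> \<in> Hom K M"
      using b(1,4) K bS S(2) by (intro HomI) (auto simp: ab)
    show "monic K \<beta>"
      unfolding monic_def using b(6) K(2) lin_simps(3)[OF b(2)] by (metis trunc_vecs)
  qed (use K b in auto)
qed

lemma quotient_module:
  assumes M: "ob M" and S: "vs.subspace S" "S \<subseteq> car M" "\<And>i v. i < adim A \<Longrightarrow> v \<in> S \<Longrightarrow> act M i v \<in> S"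
  obtains C \<pi> where "ob C" "\<pi> \<in> Hom M C" "epic C \<pi>" "\<And>v. v \<in> car M \<Longrightarrow> \<pi> v = 0 \<longleftrightarrow> v \<in> S"
proof -
  obtain d \<pi> \<sigma> where p: "lin \<pi>" "lin \<sigma>" "\<And>v. \<pi> (trunc (mdim M) v) = \<pi> v" "\<And>v. \<pi> v \<in> vecs d"
    "\<And>v. \<sigma> v \<in> vecs (mdim M)" "\<And>v. \<pi> (\<sigma> v) = trunc d v" "\<And>v. v \<in> vecs (mdim M) \<Longrightarrow> \<pi> v = 0 \<longleftrightarrow> v \<in> S"
    by (rule quotient_coordinates[OF S(1,2)], rule that)
  \<comment> \<open>The induced action does not depend on the section:
    \<open>\<sigma> (\<pi> v)\<close> and \<open>v\<close> differ by an element of \<open>S\<close>,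
    which the action preserves.\<close>
  have sec: "\<pi> (act M i (\<sigma> (\<pi> v))) = \<pi> (act M i v)" if i: "i < adim A" for i v
  proof -
    have "\<pi> (\<sigma> (\<pi> v) - one M v) = 0"
      using p(4) by (simp add: lin_simps[OF p(1)] p(3,6) trunc_vecs)
    then have "\<sigma> (\<pi> v) - one M v \<in> S"
      using p(5,7) by (metis subspace_vecs trunc_in_vecs vs.subspace_diff)
    then have "\<pi> (act M i (\<sigma> (\<pi> v) - one M v)) = 0"
      using p(7) S(3)[OF i] act_in_car[OF M i] by blast
    then show ?thesis
      by (simp add: lin_simps[OF p(1)] lin_simps[OF lin_act])
  qed
  have sig: "\<sigma> (trunc d v) \<in> car M" "\<pi> (\<sigma> (trunc d v)) = \<pi> (\<sigma> v)" for v
    using p(5,6) by auto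
  obtain C where C: "ob C" "mdim C = d" "\<And>i. i < adim A \<Longrightarrow> act C i = (\<lambda>v. \<pi> (act M i (\<sigma> v)))"
  proof (rule module_of_operators)
    show "lin (\<lambda>v. \<pi> (act M i (\<sigma> v)))" for i
      using lin_comp[OF p(1) lin_comp[OF lin_act[of M i] p(2)]] by (simp add: comp_def)
    show "\<pi> (act M i (\<sigma> (trunc d v))) = \<pi> (act M i (\<sigma> v))" if "i < adim A" for i v
      using sec[OF that, of "\<sigma> v"] p(6) by simp
    show "\<pi> (act M i (\<sigma> (\<pi> (act M j (\<sigma> v))))) = (\<Sum>l<adim A. scl (amult A i j l) (\<pi> (act M l (\<sigma> v))))"
      if "i < adim A" "j < adim A" for i j v
      using that by (simp add: sec act_act[OF M] lin_sum[OF p(1)] lin_simps(2)[OF p(1)])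
    show "(\<Sum>i<adim A. scl (aunit A i) (\<pi> (act M i (\<sigma> v)))) = trunc d v" for v
    proof -
      have "(\<Sum>i<adim A. scl (aunit A i) (\<pi> (act M i (\<sigma> v)))) = \<pi> (\<Sum>i<adim A. scl (aunit A i) (act M i (\<sigma> v)))"
        by (simp add: lin_sum[OF p(1)] lin_simps(2)[OF p(1)])
      also have "\<dots> = \<pi> (\<sigma> v)"
        unfolding act_unit[OF M] by (rule p(3))
      finally show ?thesis by (simp add: p(6))
    qed
  qed (use p(4) in auto)
  show ?thesis
  proof
    show "\<pi> \<in> Hom M C"
      using p C by (intro HomI) (auto simp: sec)
    show "epic C \<pi>"
      unfolding epic_def using p(6) C(2) by (metis trunc_vecs)
  qed (use C p in auto)
qed

lemma exists_kernel:
  assumes "ob M" "\<phi> \<in> Hom M N"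
  obtains K \<iota> where "ob K" "\<iota> \<in> Hom K M" "monic K \<iota>" "\<And>v. v \<in> car M \<Longrightarrow> \<phi> v = 0 \<longleftrightarrow> (\<exists>u. \<iota> u = v)"
proof -
  have sub: "vs.subspace {v \<in> car M. \<phi> v = 0}"
    using subspace_vecs[of "mdim M"] assms(2)
    by (auto simp: vs.subspace_def Hom_lin intro: vs.subspace_add vs.subspace_scale)
  have "act M i v \<in> {v \<in> car M. \<phi> v = 0}" if "i < adim A" "v \<in> {v \<in> car M. \<phi> v = 0}" for i v
    using that assms by (auto simp: act_in_car HomD(4) lin_simps[OF lin_act])
  from submodule[OF assms(1) sub _ this] obtain K \<iota>
    where K: "ob K" "\<iota> \<in> Hom K M" "monic K \<iota>" and ran: "range \<iota> = {v \<in> car M. \<phi> v = 0}" by auto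
  have "\<phi> v = 0 \<longleftrightarrow> (\<exists>u. \<iota> u = v)" if "v \<in> car M" for v
  proof -
    have "(\<exists>u. \<iota> u = v) \<longleftrightarrow> v \<in> range \<iota>" by blast
    then show ?thesis using that by (simp add: ran)
  qed
  with K show ?thesis by (rule that)
qed

lemma range_submodule:
  assumes "\<phi> \<in> Hom M N"
  shows "vs.subspace (range \<phi>)" "range \<phi> \<subseteq> car N" "i < adim A \<Longrightarrow> v \<in> range \<phi> \<Longrightarrow> act N i v \<in> range \<phi>"
proof -
  show "vs.subspace (range \<phi>)"
    using vp.linear_subspace_image[OF HomD(1)[OF assms] vs.subspace_UNIV] .
  show "range \<phi> \<subseteq> car N" using HomD(3)[OF assms] by auto
  show "act N i v \<in> range \<phi>" if i: "i < adim A" and v: "v \<in> range \<phi>"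
  proof -
    obtain u where "v = \<phi> u" using v by blast
    then have "act N i v = \<phi> (act M i u)" by (simp add: HomD(4)[OF assms i])
    then show ?thesis by simp
  qed
qed

lemma exists_cokernel:
  assumes "ob N" "\<phi> \<in> Hom M N"
  obtains C \<pi> where "ob C" "\<pi> \<in> Hom N C" "epic C \<pi>" "\<And>v. v \<in> car N \<Longrightarrow> \<pi> v = 0 \<longleftrightarrow> (\<exists>u. \<phi> u = v)"
proof -
  from quotient_module[OF assms(1) range_submodule[OF assms(2)]]
  obtain C \<pi> where "ob C" "\<pi> \<in> Hom N C" "epic C \<pi>" "\<And>v. v \<in> car N \<Longrightarrow> \<pi> v = 0 \<longleftrightarrow> v \<in> range \<phi>" by blast
  then show ?thesis by (intro that[of C \<pi>]) auto
qed

lemma exists_image: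
  assumes "ob N" "\<phi> \<in> Hom M N"
  obtains I \<iota> where "ob I" "\<iota> \<in> Hom I N" "monic I \<iota>" "range \<iota> = range \<phi>"
  using submodule[OF assms(1) range_submodule[OF assms(2)]] by blast

lemma monicD: "monic K \<iota> \<Longrightarrow> \<iota> \<in> Hom K M \<Longrightarrow> \<iota> u = \<iota> v \<Longrightarrow> u \<in> car K \<Longrightarrow> v \<in> car K \<Longrightarrow> u = v"
  unfolding monic_def by (metis Hom_lin(4) eq_iff_diff_eq_0 subspace_vecs vs.subspace_diff)

lemma epicD: "epic N \<pi> \<Longrightarrow> w \<in> car N \<Longrightarrow> \<pi> \<in> Hom M N \<Longrightarrow> \<exists>v\<in>car M. \<pi> v = w"
  unfolding epic_def by (metis HomD(2) trunc_in_vecs)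

text \<open>A merely linear left inverse of \<open>\<iota>\<close> gives the factorization; its
  compatibility with the action can be tested after applying the injective
  \<open>\<iota>\<close>.\<close>

lemma factor_monic:
  assumes M: "\<iota> \<in> Hom K M" "monic K \<iota>" and L: "ob L" "ob K" "\<phi> \<in> Hom L M" "\<And>v. v \<in> car L \<Longrightarrow> \<exists>u. \<iota> u = \<phi> v"
  obtains \<psi> where "\<psi> \<in> Hom L K" "\<iota> \<circ> \<psi> = \<phi>"
proof -
  have "inj_on \<iota> (car K)" by (rule inj_onI) (use monicD[OF M(2,1)] in blast)
  from vp.linear_exists_left_inverse_on[OF HomD(1)[OF M(1)] subspace_vecs this]
  obtain g where g: "range g \<subseteq> car K" "lin g" "\<And>v. v \<in> car K \<Longrightarrow> g (\<iota> v) = v" by blast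
  let ?p = "g \<circ> \<phi>"
  have eq: "\<iota> (?p v) = \<phi> v" for v
  proof -
    obtain u where "\<iota> u = \<phi> v" using L(4)[of "one L v"] HomD(2)[OF L(3)] by auto
    then have "\<iota> (one K u) = \<phi> v" by (simp add: HomD(2)[OF M(1)])
    then show ?thesis using g(3)[of "one K u"] by auto
  qed
  have "?p \<in> Hom L K"
  proof (rule HomI)
    show "lin ?p" by (intro lin_comp g HomD(1)[OF L(3)])
    show "?p (one L v) = ?p v" for v by (simp add: HomD(2)[OF L(3)])
    show "?p v \<in> car K" for v using g(1) by auto
    show "?p (act L i v) = act K i (?p v)" if i: "i < adim A" for i v
    proof (rule monicD[OF M(2,1)])
      show "\<iota> (?p (act L i v)) = \<iota> (act K i (?p v))"
        unfolding HomD(4)[OF M(1) i] eq HomD(4)[OF L(3) i] ..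
    qed (use g(1) act_in_car[OF L(2) i] in auto)
  qed
  then show ?thesis using eq by (intro that[of ?p]) (auto simp: comp_def)
qed

text \<open>Composing \<open>\<phi>\<close> with a linear section of \<open>\<pi>\<close> works
  because \<open>\<phi>\<close> is constant on the fibres of \<open>\<pi>\<close>; equivariance
  follows since every element of \<open>C\<close> comes from \<open>M\<close>.\<close>

lemma factor_epic:
  assumes C: "\<pi> \<in> Hom M C" "epic C \<pi>" and N: "ob C" "\<phi> \<in> Hom M N" "\<And>v. v \<in> car M \<Longrightarrow> \<pi> v = 0 \<Longrightarrow> \<phi> v = 0"
  obtains \<psi> where "\<psi> \<in> Hom C N" "\<psi> \<circ> \<pi> = \<phi>"
proof -
  from vp.linear_exists_right_inverse_on[OF HomD(1)[OF C(1)] vs.subspace_UNIV]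
  obtain \<sigma> where s: "lin \<sigma>" "\<And>w. w \<in> range \<pi> \<Longrightarrow> \<pi> (\<sigma> w) = w" by blast
  have ps: "\<pi> (\<sigma> w) = w" if "w \<in> car C" for w
    using s(2) C(2) that unfolding epic_def by (metis rangeI)
  let ?p = "\<phi> \<circ> \<sigma> \<circ> one C"
  have ker: "\<phi> u = \<phi> v" if "\<pi> u = \<pi> v" for u v
  proof -
    have "\<phi> (one M (u - v)) = 0"
      using N(3)[of "one M (u - v)"] that by (simp add: HomD(2)[OF C(1)] Hom_lin[OF C(1)])
    then show ?thesis by (simp add: HomD(2)[OF N(2)] Hom_lin[OF N(2)])
  qed
  have eq: "?p (\<pi> v) = \<phi> v" for v
    using ps[OF HomD(3)[OF C(1)]] by (auto simp: Hom_one_left[OF C(1)] intro: ker)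
  have "?p \<in> Hom C N"
  proof (rule HomI)
    show "lin ?p" by (intro lin_comp s lin_trunc HomD(1)[OF N(2)])
    show "?p (one C v) = ?p v" for v by simp
    show "?p v \<in> car N" for v by (simp add: HomD(3)[OF N(2)])
    show "?p (act C i w) = act N i (?p w)" if i: "i < adim A" for i w
    proof -
      obtain v where v: "\<pi> v = one C w"
        using C(2) unfolding epic_def by (meson trunc_in_vecs)
      have "?p (act C i w) = ?p (act C i (\<pi> v))" by (simp add: v)
      also have "\<dots> = \<phi> (act M i v)" using eq[of "act M i v"] by (simp only: HomD(4)[OF C(1) i])
      also have "\<dots> = act N i (?p (\<pi> v))" by (simp only: eq HomD(4)[OF N(2) i])
      finally show ?thesis by (simp add: v)
    qed
  qed
  then show ?thesis using eq by (intro that[of ?p]) auto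
qed

subsection \<open>Short exact sequences\<close>

definition ses where
  "ses X f Y g Z \<longleftrightarrow> ob X \<and> ob Y \<and> ob Z \<and> f \<in> Hom X Y \<and> g \<in> Hom Y Z \<and> monic X f \<and> epic Z g \<and>
     (\<forall>v\<in>car Y. g v = 0 \<longleftrightarrow> (\<exists>u. f u = v))"

lemma sesD:
  assumes "ses X f Y g Z"
  shows "ob X" "ob Y" "ob Z" "f \<in> Hom X Y" "g \<in> Hom Y Z" "monic X f" "epic Z g" "g \<circ> f = 0" "g (f v) = 0"
proof -
  show *: "g (f v) = 0" for v using assms by (auto simp: ses_def HomD(3))
  then show "g \<circ> f = 0" by (simp add: fun_eq_iff[where f = "_ \<circ> _"])
qed (use assms in \<open>auto simp: ses_def\<close>)

lemma ses_exact: "ses X f Y g Z \<Longrightarrow> v \<in> car Y \<Longrightarrow> g v = 0 \<Longrightarrow> \<exists>u\<in>car X. f u = v"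
  unfolding ses_def by (metis HomD(2) trunc_in_vecs)

lemma ses_factor_left:
  assumes "ses X f Y g Z" "ob L" "\<phi> \<in> Hom L Y" "g \<circ> \<phi> = 0"
  obtains \<psi> where "\<psi> \<in> Hom L X" "f \<circ> \<psi> = \<phi>"
proof (rule factor_monic[OF sesD(4,6)[OF assms(1)] assms(2) sesD(1)[OF assms(1)] assms(3)])
  show "\<exists>u. f u = \<phi> v" for v
    using ses_exact[OF assms(1) HomD(3)[OF assms(3)], of v] fun_cong[OF assms(4), of v] by auto
qed (use that in auto)

lemma ses_factor_right:
  assumes "ses X f Y g Z" "\<phi> \<in> Hom Y L" "\<phi> \<circ> f = 0"
  obtains \<psi> where "\<psi> \<in> Hom Z L" "\<psi> \<circ> g = \<phi>"
proof (rule factor_epic[OF sesD(5,7)[OF assms(1)] sesD(3)[OF assms(1)] assms(2)])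
  show "\<phi> v = 0" if "v \<in> car Y" "g v = 0" for v
    using ses_exact[OF assms(1) that] fun_cong[OF assms(3)] by auto
qed (use that in auto)

lemma epic_cancel:
  assumes "\<pi> \<in> Hom M C" "epic C \<pi>" "\<phi> \<in> Hom C N" "\<psi> \<in> Hom C N'" "\<phi> \<circ> \<pi> = \<psi> \<circ> \<pi>"
  shows "\<phi> = \<psi>"
proof (rule Hom_eqI[OF assms(3,4)])
  fix w assume "w \<in> car C"
  then obtain v where "\<pi> v = w" using assms(2) by (auto simp: epic_def)
  then show "\<phi> w = \<psi> w" using fun_cong[OF assms(5), of v] by auto
qed

lemma monic_cancel:
  assumes "\<iota> \<in> Hom K M" "monic K \<iota>" "\<phi> \<in> Hom L K" "\<psi> \<in> Hom L K" "\<iota> \<circ> \<phi> = \<iota> \<circ> \<psi>"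
  shows "\<phi> = \<psi>"
proof
  fix v show "\<phi> v = \<psi> v"
    using monicD[OF assms(2,1)] fun_cong[OF assms(5), of v] HomD(3)[OF assms(3)] HomD(3)[OF assms(4)] by auto
qed

lemma ses_of_monic:
  assumes "ob X" "ob Y" "f \<in> Hom X Y" "monic X f"
  obtains Z g where "ses X f Y g Z"
  using exists_cokernel[OF assms(2,3)] assms unfolding ses_def by metis

lemma ses_of_epic:
  assumes "ob Y" "ob Z" "g \<in> Hom Y Z" "epic Z g"
  obtains X f where "ses X f Y g Z"
  using exists_kernel[OF assms(1,3)] assms unfolding ses_def by metis

text \<open>The idempotent \<open>one Y - (s \<circ> g)\<close> is killed by \<open>g\<close>, so it
  factors through \<open>f\<close>; the factor is the retraction. Its vanishing on \<open>s\<close>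
  is what later allows the sequence to be reversed.\<close>

lemma ses_retraction:
  assumes "ses X f Y g Z" "s \<in> Hom Z Y" "g \<circ> s = one Z"
  obtains r where "r \<in> Hom Y X" "r \<circ> f = one X" "r \<circ> s = 0" "f \<circ> r = one Y - (s \<circ> g)"
proof -
  note S = sesD[OF assms(1)]
  have gs: "g (s v) = one Z v" for v using fun_cong[OF assms(3), of v] by simp
  have h: "one Y - (s \<circ> g) \<in> Hom Y Y"
    by (rule Hom_diff[OF Hom_one[OF S(2)] Hom_comp[OF assms(2) S(5)]])
  have "g \<circ> (one Y - (s \<circ> g)) = 0"
    by (rule ext) (simp add: Hom_lin[OF S(5)] gs HomD(2)[OF S(5)] Hom_one_left[OF S(5)])
  from ses_factor_left[OF assms(1) S(2) h this]
  obtain r where r: "r \<in> Hom Y X" "f \<circ> r = one Y - (s \<circ> g)" .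
  have fr: "f (r v) = one Y v - s (g v)" for v using fun_cong[OF r(2), of v] by simp
  have "r \<circ> f = one X"
    by (rule monic_cancel[OF S(4,6) Hom_comp[OF r(1) S(4)] Hom_one[OF S(1)]])
      (rule ext, simp add: fr S(9) Hom_lin[OF assms(2)] HomD(2)[OF S(4)] Hom_one_left[OF S(4)])
  moreover have "r \<circ> s = 0"
    by (rule monic_cancel[OF S(4,6) Hom_comp[OF r(1) assms(2)] Hom_zero])
      (rule ext, simp add: fr gs Hom_lin[OF S(4)] HomD(2)[OF assms(2)] Hom_one_left[OF assms(2)])
  ultimately show ?thesis using r that by blast
qed

lemma ses_section:
  assumes "ses X f Y g Z" "r \<in> Hom Y X" "r \<circ> f = one X"
  obtains s where "s \<in> Hom Z Y" "g \<circ> s = one Z"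
proof -
  note S = sesD[OF assms(1)]
  have rf: "r (f v) = one X v" for v using fun_cong[OF assms(3), of v] by simp
  have h: "one Y - (f \<circ> r) \<in> Hom Y Y"
    by (rule Hom_diff[OF Hom_one[OF S(2)] Hom_comp[OF S(4) assms(2)]])
  have "(one Y - (f \<circ> r)) \<circ> f = 0"
    by (rule ext) (simp add: rf HomD(2)[OF S(4)] Hom_one_left[OF S(4)])
  from ses_factor_right[OF assms(1) h this]
  obtain s where s: "s \<in> Hom Z Y" "s \<circ> g = one Y - (f \<circ> r)" .
  have sg: "s (g v) = one Y v - f (r v)" for v using fun_cong[OF s(2), of v] by simp
  have "g \<circ> s = one Z"
    by (rule epic_cancel[OF S(5,7) Hom_comp[OF S(5) s(1)] Hom_one[OF S(3)]])
      (rule ext, simp add: sg Hom_lin[OF S(5)] S(9) HomD(2)[OF S(5)] Hom_one_left[OF S(5)])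
  with s that show ?thesis by blast
qed

end

subsection \<open>Direct sums\<close>

text \<open>A vector of a direct sum is a concatenation. Hence the inclusion and the projection of
  the first summand are the same truncation in two roles, while those of the second shift by
  \<open>mdim M\<close>.\<close>

definition inl :: "'k::zero modl \<Rightarrow> (nat \<Rightarrow> 'k) \<Rightarrow> nat \<Rightarrow> 'k" where
  "inl M = one M"

definition inr :: "'k::zero modl \<Rightarrow> 'k modl \<Rightarrow> (nat \<Rightarrow> 'k) \<Rightarrow> nat \<Rightarrow> 'k" where
  "inr M N w = (\<lambda>i. if mdim M \<le> i then one N w (i - mdim M) else 0)"

definition prl :: "'k::zero modl \<Rightarrow> (nat \<Rightarrow> 'k) \<Rightarrow> nat \<Rightarrow> 'k" where
  "prl M = one M"

definition prr :: "'k::zero modl \<Rightarrow> 'k modl \<Rightarrow> (nat \<Rightarrow> 'k) \<Rightarrow> nat \<Rightarrow> 'k" where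
  "prr M N w = one N (\<lambda>i. w (i + mdim M))"

lemma lin_inr: "lin (inr M N)"
  by (intro linI) (auto simp: inr_def fun_eq_iff vec_apply trunc_def)

lemma lin_prr: "lin (prr M N)"
  by (intro linI) (auto simp: prr_def fun_eq_iff vec_apply trunc_def)

lemma mdim_dsum [simp]: "mdim (dsum M N) = mdim M + mdim N"
  by (simp add: dsum_def)

lemma biproduct_apply:
  fixes M N :: "'k::field modl"
  shows "prl M (inl M v) = one M v" "prr M N (inr M N w) = one N w" "prl M (inr M N w) = 0" "prr M N (inl M v) = 0"
  "inl M (prl M u) + inr M N (prr M N u) = one (dsum M N) u"
  by (auto simp: prl_def inl_def prr_def inr_def trunc_def fun_eq_iff vec_apply)

lemma act_dsum:
  assumes "mat_wf (mdim M) (mdim M) (mact M i)" "mat_wf (mdim N) (mdim N) (mact N i)"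
  shows "act (dsum M N) i v = inl M (act M i (prl M v)) + inr M N (act N i (prr M N v))"
proof
  fix r
  have split: "(\<Sum>s<m+n. f s) = (\<Sum>s<m. f s) + (\<Sum>s<n. f (s + m) :: 'a)" for m n :: nat and f
    by (induction n) (simp_all add: algebra_simps)
  show "act (dsum M N) i v r = (inl M (act M i (prl M v)) + inr M N (act N i (prr M N v))) r"
  proof (cases "r < mdim M")
    case True
    then show ?thesis
      by (simp add: act_def mvec_def dsum_def split vec_apply inl_def inr_def prl_def trunc_def)
  next
    case False
    then show ?thesis using assms(2)
      by (auto simp: act_def mvec_def dsum_def split vec_apply inl_def inr_def prr_def trunc_def mat_wf_def
          intro!: sum.neutral)
  qed
qed

context fd_algebra
begin

lemma ob_dsum:
  assumes "ob M" "ob N"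
  shows "ob (dsum M N)"
proof -
  have wf: "mat_wf (mdim M) (mdim M) (mact M i)" "mat_wf (mdim N) (mdim N) (mact N i)" if "i < adim A" for i
    using assms that by (auto simp: is_module_def)
  note a = act_dsum[OF wf]
  have "act (dsum M N) i (act (dsum M N) j v) = (\<Sum>l<adim A. scl (amult A i j l) (act (dsum M N) l v))"
    if "i < adim A" "j < adim A" for i j v
    using that assms
    by (simp add: a act_act lin_simps[OF lin_inr] lin_simps[OF lin_trunc] lin_simps[OF lin_prr] inl_def prl_def
        biproduct_apply[unfolded inl_def prl_def] lin_sum[OF lin_inr] lin_sum[OF lin_trunc] sum.distrib
        vs.scale_right_distrib)
  moreover have "(\<Sum>i<adim A. scl (aunit A i) (act (dsum M N) i v)) = one (dsum M N) v" for v
  proof -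
    have "(\<Sum>i<adim A. scl (aunit A i) (act (dsum M N) i v)) =
       inl M (\<Sum>i<adim A. scl (aunit A i) (act M i (prl M v))) + inr M N (\<Sum>i<adim A. scl (aunit A i) (act N i (prr M N v)))"
      by (simp add: a lin_sum[OF lin_inr] lin_sum[OF lin_trunc] lin_simps[OF lin_inr] lin_simps[OF lin_trunc]
          sum.distrib vs.scale_right_distrib inl_def)
    also have "\<dots> = inl M (prl M v) + inr M N (prr M N v)"
      using assms by (simp add: act_unit prl_def inl_def inr_def prr_def)
    finally show ?thesis by (simp add: biproduct_apply)
  qed
  moreover have "mat_wf (mdim M + mdim N) (mdim M + mdim N) (mact (dsum M N) i)" if "i < adim A" for i
  proof -
    have "mact N i (r - mdim M) (c - mdim M) = 0"
      if rc: "mdim M \<le> r" "mdim M \<le> c" "\<not> (r < mdim M + mdim N \<and> c < mdim M + mdim N)" for r c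
    proof -
      have "\<not> (r - mdim M < mdim N \<and> c - mdim M < mdim N)" using rc by linarith
      then show ?thesis using wf(2)[OF \<open>i < adim A\<close>] by (simp add: mat_wf_def)
    qed
    then show ?thesis by (auto simp: mat_wf_def dsum_def)
  qed
  moreover have "mact (dsum M N) i = zmx" if "i \<ge> adim A" for i
  proof -
    have "mact M i = zmx" "mact N i = zmx" using that assms by (auto simp: is_module_def)
    then show ?thesis by (simp add: dsum_def zmx_def fun_eq_iff)
  qed
  ultimately show ?thesis
    unfolding module_iff by simp
qed

lemma biproduct_Hom:
  assumes "ob M" "ob N"
  shows "inl M \<in> Hom M (dsum M N)" "inr M N \<in> Hom N (dsum M N)"
    "prl M \<in> Hom (dsum M N) M" "prr M N \<in> Hom (dsum M N) N"
proof -
  have wf: "mat_wf (mdim M) (mdim M) (mact M i)" "mat_wf (mdim N) (mdim N) (mact N i)" if "i < adim A" for i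
    using assms that by (auto simp: is_module_def)
  note a = act_dsum[OF wf]
  note act0 = lin_simps(3)[OF lin_act]
  show "inl M \<in> Hom M (dsum M N)"
  proof (rule HomI)
    show "inl M (act M i v) = act (dsum M N) i (inl M v)" if "i < adim A" for i v
      using that by (simp add: a biproduct_apply act0 lin_simps[OF lin_inr])
  qed (auto simp: inl_def lin_trunc, auto simp: mem_vecs trunc_def)
  show "inr M N \<in> Hom N (dsum M N)"
  proof (rule HomI)
    show "inr M N (act N i v) = act (dsum M N) i (inr M N v)" if "i < adim A" for i v
      using that by (simp add: a biproduct_apply act0 inl_def lin_simps[OF lin_trunc])
  qed (auto simp: lin_inr, auto simp: mem_vecs trunc_def inr_def)
  show "prl M \<in> Hom (dsum M N) M"
  proof (rule HomI)
    show "prl M (act (dsum M N) i v) = act M i (prl M v)" if "i < adim A" for i v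
      using that act_in_car[OF assms(1) that]
      by (simp add: a lin_simps[OF lin_trunc] biproduct_apply[unfolded prl_def] prl_def biproduct_apply trunc_vecs)
  qed (auto simp: prl_def lin_trunc trunc_def fun_eq_iff mem_vecs)
  show "prr M N \<in> Hom (dsum M N) N"
  proof (rule HomI)
    show "prr M N (act (dsum M N) i v) = act N i (prr M N v)" if "i < adim A" for i v
      using that act_in_car[OF assms(2) that]
      by (simp add: a lin_simps[OF lin_prr] biproduct_apply trunc_vecs)
  qed (auto simp: lin_prr, auto simp: prr_def trunc_def fun_eq_iff mem_vecs)
qed

lemma copair:
  assumes "ob M" "ob N" "\<phi> \<in> Hom M L" "\<psi> \<in> Hom N L"
  obtains \<theta> where "\<theta> \<in> Hom (dsum M N) L" "\<theta> \<circ> inl M = \<phi>" "\<theta> \<circ> inr M N = \<psi>"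
    "\<And>v. \<theta> v = \<phi> (prl M v) + \<psi> (prr M N v)"
proof -
  let ?t = "(\<phi> \<circ> prl M) + (\<psi> \<circ> prr M N)"
  have "?t \<in> Hom (dsum M N) L"
    by (intro Hom_add Hom_comp[OF assms(3)] Hom_comp[OF assms(4)] biproduct_Hom assms)
  moreover have "?t \<circ> inl M = \<phi>" "?t \<circ> inr M N = \<psi>"
    by (rule ext, simp add: biproduct_apply Hom_lin[OF assms(3)] Hom_lin[OF assms(4)] HomD(2)[OF assms(3)] HomD(2)[OF assms(4)])+
  ultimately show ?thesis by (intro that[of ?t]) auto
qed

lemma ses_dsum: "ob M \<Longrightarrow> ob N \<Longrightarrow> ses M (inl M) (dsum M N) (prr M N) N"
  unfolding ses_def
proof (intro conjI ballI)
  assume M: "ob M" "ob N"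
  show "monic M (inl M)" by (simp add: monic_def inl_def trunc_vecs)
  show "epic N (prr M N)" unfolding epic_def by (metis biproduct_apply(2) trunc_vecs)
  show "prr M N v = 0 \<longleftrightarrow> (\<exists>u. inl M u = v)" if "v \<in> car (dsum M N)" for v
  proof
    assume "prr M N v = 0"
    then have "inl M (prl M v) = v"
      using biproduct_apply(5)[of M v N] trunc_vecs[OF that] by (simp add: lin_simps[OF lin_inr])
    then show "\<exists>u. inl M u = v" by blast
  qed (auto simp: biproduct_apply)
qed (auto intro: ob_dsum biproduct_Hom)

lemma ob_zmod: "ob zmod"
proof -
  have "v = 0" if "v \<in> vecs 0" for v :: "nat \<Rightarrow> 'k" using that by (auto simp: mem_vecs fun_eq_iff vec_apply)
  moreover have "act zmod i v \<in> vecs 0" "one zmod v \<in> vecs 0" for i and v :: "nat \<Rightarrow> 'k"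
    by (simp_all add: act_def mvec_def zmod_def mem_vecs trunc_def)
  ultimately have "act zmod i v = 0" "one zmod v = 0" for i and v :: "nat \<Rightarrow> 'k" by blast+
  then show ?thesis
    unfolding module_iff by (simp add: zmod_def mat_wf_def zmx_def)
qed

lemma ob_mpow: "ob T \<Longrightarrow> ob (mpow T r)"
  by (induction r) (simp_all add: ob_zmod ob_dsum)

lemma car_zero: "mdim M = 0 \<Longrightarrow> v \<in> car M \<Longrightarrow> v = 0"
  by (auto simp: mem_vecs fun_eq_iff vec_apply)

lemma Hom_from_zero: "mdim M = 0 \<Longrightarrow> \<phi> \<in> Hom M N \<Longrightarrow> \<phi> = 0"
  by (rule Hom_eqI[OF _ Hom_zero]) (use car_zero Hom_lin(3) in force)+

lemma Hom_to_zero: "mdim N = 0 \<Longrightarrow> \<phi> \<in> Hom M N \<Longrightarrow> \<phi> = 0"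
  by (rule ext) (use car_zero HomD(3) in force)

lemma one_zero_iff:
  fixes M :: "'k modl"
  shows "one M = 0 \<longleftrightarrow> mdim M = 0"
proof
  assume "one M = 0"
  then have "one M (unit_vec 0) 0 = 0" by (simp add: vec_apply)
  then show "mdim M = 0" by (simp add: trunc_def unit_vec_def split: if_splits)
qed (auto simp: trunc_def fun_eq_iff vec_apply)

subsection \<open>Dimensions\<close>

lemma mdim_monic: "\<phi> \<in> Hom M N \<Longrightarrow> monic M \<phi> \<Longrightarrow> mdim M \<le> mdim N"
  by (rule lin_inj_dim_le[of \<phi>]) (auto simp: HomD monic_def)

lemma mdim_bij:
  assumes "\<phi> \<in> Hom M N" "monic M \<phi>" "epic N \<phi>" "ob M" "ob N"
  obtains \<psi> where "\<psi> \<in> Hom N M" "\<psi> \<circ> \<phi> = one M" "\<phi> \<circ> \<psi> = one N"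
proof -
  have "\<exists>u. \<phi> u = one N v" for v
    using assms(3) by (auto simp: epic_def)
  from factor_monic[OF assms(1,2,5,4) Hom_one[OF assms(5)] this]
  obtain \<psi> where p: "\<psi> \<in> Hom N M" "\<phi> \<circ> \<psi> = one N" by blast
  moreover have "\<psi> \<circ> \<phi> = one M"
  proof (rule monic_cancel[OF assms(1,2) Hom_comp[OF p(1) assms(1)] Hom_one[OF assms(4)]])
    show "\<phi> \<circ> (\<psi> \<circ> \<phi>) = \<phi> \<circ> one M"
      using p(2) by (simp flip: comp_assoc add: Hom_comp_one[OF assms(1)] Hom_one_comp[OF assms(1)])
  qed
  ultimately show ?thesis using that by blast
qed

text \<open>Both middle terms are direct sums of their ends. The statement avoids
  \<open>dsum\<close> because a duality visibly preserves exact sequences and sections, but not a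
  chosen model of the direct sum.\<close>

lemma ses_split_iso:
  assumes "ses X f Y g Z" "s \<in> Hom Z Y" "g \<circ> s = one Z"
    and "ses X' f' Y' g' Z'" "s' \<in> Hom Z' Y'" "g' \<circ> s' = one Z'"
    and "a \<in> Hom X X'" "a' \<in> Hom X' X" "a' \<circ> a = one X" "a \<circ> a' = one X'"
    and "c \<in> Hom Z Z'" "c' \<in> Hom Z' Z" "c' \<circ> c = one Z" "c \<circ> c' = one Z'"
  obtains b b' where "b \<in> Hom Y Y'" "b' \<in> Hom Y' Y" "b' \<circ> b = one Y" "b \<circ> b' = one Y'"
proof -
  \<comment> \<open>Stated for arbitrary data, so that exchanging the two sequences yields the other
    composite. In each direction the map is block diagonal with respect to the splittings.\<close>
  have key: "(f \<circ> a' \<circ> r') + (s \<circ> c' \<circ> g') \<in> Hom Y' Y \<and> ((f \<circ> a' \<circ> r') + (s \<circ> c' \<circ> g')) \<circ> ((f' \<circ> a \<circ> r) + (s' \<circ> c \<circ> g)) = one Y"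
    if S: "ses X f Y g Z" "s \<in> Hom Z Y"
    and S': "ses X' f' Y' g' Z'" "s' \<in> Hom Z' Y'" "g' \<circ> s' = one Z'"
    and a: "a' \<in> Hom X' X" "a' \<circ> a = one X"
    and c: "c' \<in> Hom Z' Z" "c' \<circ> c = one Z"
    and r: "f \<circ> r = one Y - (s \<circ> g)"
    and r': "r' \<in> Hom Y' X'" "r' \<circ> f' = one X'" "r' \<circ> s' = 0"
    for X f Y g Z s X' f' Y' g' Z' s' a a' c c' r r'
  proof
    note D = sesD[OF S(1)] and D' = sesD[OF S'(1)]
    show "(f \<circ> a' \<circ> r') + (s \<circ> c' \<circ> g') \<in> Hom Y' Y"
      by (rule Hom_add[OF Hom_comp[OF Hom_comp[OF D(4) a(1)] r'(1)] Hom_comp[OF Hom_comp[OF S(2) c(1)] D'(5)]])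
    show "((f \<circ> a' \<circ> r') + (s \<circ> c' \<circ> g')) \<circ> ((f' \<circ> a \<circ> r) + (s' \<circ> c \<circ> g)) = one Y"
    proof
      fix v
      have e: "r' (f' x) = one X' x" "r' (s' z) = 0" "g' (f' x) = 0" "g' (s' z) = one Z' z" "a' (a y) = one X y"
        "c' (c w) = one Z w" "f (r v) = one Y v - s (g v)" for x z y w
        using fun_cong[OF r'(2), of x] fun_cong[OF r'(3), of z] D'(9)[of x] fun_cong[OF S'(3), of z]
          fun_cong[OF a(2), of y] fun_cong[OF c(2), of w] fun_cong[OF r, of v] by auto
      show "(((f \<circ> a' \<circ> r') + (s \<circ> c' \<circ> g')) \<circ> ((f' \<circ> a \<circ> r) + (s' \<circ> c \<circ> g))) v = one Y v"
        by (simp add: Hom_lin[OF r'(1)] Hom_lin[OF D'(5)] Hom_lin[OF a(1)] Hom_lin[OF D(4)] Hom_lin[OF S(2)]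
            Hom_lin[OF c(1)] e HomD(2)[OF a(1)] HomD(2)[OF c(1)] HomD(2)[OF D(4)] HomD(2)[OF S(2)])
    qed
  qed
  obtain r where r: "r \<in> Hom Y X" "r \<circ> f = one X" "r \<circ> s = 0" "f \<circ> r = one Y - (s \<circ> g)"
    by (rule ses_retraction[OF assms(1-3)])
  obtain r' where r': "r' \<in> Hom Y' X'" "r' \<circ> f' = one X'" "r' \<circ> s' = 0" "f' \<circ> r' = one Y' - (s' \<circ> g')"
    by (rule ses_retraction[OF assms(4-6)])
  show ?thesis
    using key[OF assms(1,2,4,5,6,8,9,12,13) r(4) r'(1-3)] key[OF assms(4,5,1,2,3,7,10,11,14) r'(4) r(1-3)] that by blast
qed

subsection \<open>The regular module and projectives\<close>

abbreviation R :: "'k modl" where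
  "R \<equiv> regmod A"

text \<open>The product \<open>a v\<close> of the algebra element with coordinates \<open>a\<close>
  and the module element \<open>v\<close>; as a function of \<open>a\<close> it is the homomorphism
  from the regular module that sends the unit to \<open>v\<close>.\<close>

definition act_gen :: "'k modl \<Rightarrow> (nat \<Rightarrow> 'k) \<Rightarrow> (nat \<Rightarrow> 'k) \<Rightarrow> nat \<Rightarrow> 'k" where
  "act_gen M v a = (\<Sum>i<adim A. scl (a i) (act M i v))"

lemma mdim_R [simp]: "mdim R = adim A"
  by (simp add: regmod_def)

lemma act_R: "act R i v r = (if i < adim A \<and> r < adim A then \<Sum>s<adim A. amult A i s r * v s else 0)"
  by (auto simp: act_def mvec_def regmod_def intro!: sum.neutral)

lemma ob_R: "ob R"
proof -
  have "act R i (act R j v) = (\<Sum>l<adim A. scl (amult A i j l) (act R l v))"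
    if ij: "i < adim A" "j < adim A" for i j v
  proof
    fix r show "act R i (act R j v) r = (\<Sum>l<adim A. scl (amult A i j l) (act R l v)) r"
    proof (cases "r < adim A")
      case True
      have "act R i (act R j v) r = (\<Sum>k<adim A. \<Sum>s<adim A. amult A i k r * amult A j s k * v s)"
        using ij True by (simp add: act_R sum_distrib_left mult.assoc)
      also have "\<dots> = (\<Sum>s<adim A. (\<Sum>k<adim A. amult A j s k * amult A i k r) * v s)"
        by (subst sum.swap) (simp add: sum_distrib_left sum_distrib_right mult_ac)
      also have "\<dots> = (\<Sum>s<adim A. (\<Sum>l<adim A. amult A i j l * amult A l s r) * v s)"
        using fd ij True by (simp add: is_fd_algebra_def)
      also have "\<dots> = (\<Sum>l<adim A. amult A i j l * (\<Sum>s<adim A. amult A l s r * v s))"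
        by (simp add: sum_distrib_left sum_distrib_right mult.assoc) (rule sum.swap)
      finally show ?thesis using True by (simp add: act_R sum_fun_apply vec_apply)
    qed (simp add: act_R sum_fun_apply vec_apply)
  qed
  moreover have "(\<Sum>i<adim A. scl (aunit A i) (act R i v)) = one R v" for v
  proof
    fix r show "(\<Sum>i<adim A. scl (aunit A i) (act R i v)) r = one R v r"
    proof (cases "r < adim A")
      case True
      have "(\<Sum>i<adim A. scl (aunit A i) (act R i v)) r = (\<Sum>i<adim A. \<Sum>s<adim A. aunit A i * amult A i s r * v s)"
        using True by (simp add: act_R sum_fun_apply vec_apply sum_distrib_left mult.assoc)
      also have "\<dots> = (\<Sum>s<adim A. (\<Sum>i<adim A. aunit A i * amult A i s r) * v s)"
        by (subst sum.swap) (simp add: sum_distrib_right)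
      also have "\<dots> = (\<Sum>s<adim A. (if s = r then 1 else 0) * v s)"
        using fd True by (simp add: is_fd_algebra_def)
      also have "\<dots> = (\<Sum>s<adim A. if s = r then v s else 0)"
        by (rule sum.cong) auto
      finally show ?thesis using True by (simp add: trunc_def)
    qed (simp add: act_R sum_fun_apply vec_apply trunc_def)
  qed
  ultimately show ?thesis
    unfolding module_iff by (auto simp: regmod_def mat_wf_def zmx_def)
qed

lemma act_gen_Hom:
  assumes "ob M"
  shows "act_gen M v \<in> Hom R M"
proof (rule HomI)
  show "lin (act_gen M v)"
    by (intro linI) (simp_all add: act_gen_def fun_eq_iff sum_fun_apply vec_apply algebra_simps sum.distrib sum_distrib_left)
  show "act_gen M v (one R a) = act_gen M v a" for a
    by (simp add: act_gen_def trunc_def)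
  show "act_gen M v a \<in> car M" for a
    unfolding act_gen_def using act_in_car[OF assms]
    by (intro vs.subspace_sum vs.subspace_scale subspace_vecs) auto
  show "act_gen M v (act R j a) = act M j (act_gen M v a)" if j: "j < adim A" for j a
  proof
    fix r
    have "act M j (act_gen M v a) r = (\<Sum>i<adim A. a i * (\<Sum>l<adim A. amult A j i l * act M l v r))"
      using j assms by (simp add: act_gen_def lin_sum[OF lin_act] lin_simps[OF lin_act] act_act sum_fun_apply vec_apply)
    also have "\<dots> = (\<Sum>l<adim A. (\<Sum>i<adim A. amult A j i l * a i) * act M l v r)"
      by (simp add: sum_distrib_left sum_distrib_right mult_ac) (rule sum.swap)
    also have "\<dots> = act_gen M v (act R j a) r"
      using j by (simp add: act_gen_def act_R sum_fun_apply vec_apply)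
    finally show "act_gen M v (act R j a) r = act M j (act_gen M v a) r" ..
  qed
qed

lemma act_gen_unit: "ob M \<Longrightarrow> v \<in> car M \<Longrightarrow> act_gen M v (aunit A) = v"
  by (simp add: act_gen_def act_unit trunc_vecs)

lemma act_gen_Hom_comp: "h \<in> Hom M N \<Longrightarrow> h \<circ> act_gen M v = act_gen N (h v)"
  by (rule ext) (simp add: act_gen_def lin_sum[OF HomD(1)] Hom_lin(2) HomD(4))

lemma act_gen_R_unit: "act_gen R (aunit A) = one R"
proof (intro ext)
  fix a r show "act_gen R (aunit A) a r = one R a r"
  proof (cases "r < adim A")
    case True
    have "act_gen R (aunit A) a r = (\<Sum>i<adim A. a i * (\<Sum>s<adim A. aunit A s * amult A i s r))"
      using True by (simp add: act_gen_def act_R sum_fun_apply vec_apply mult.commute)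
    also have "\<dots> = (\<Sum>i<adim A. a i * (if i = r then 1 else 0))"
      using fd True by (simp add: is_fd_algebra_def)
    finally show ?thesis using True by (simp add: trunc_def if_distrib cong: if_cong)
  qed (simp add: act_gen_def act_R sum_fun_apply vec_apply trunc_def)
qed

definition proj :: "'k modl \<Rightarrow> bool" where
  "proj P \<longleftrightarrow> ob P \<and> (\<forall>M N g h. ob M \<longrightarrow> ob N \<longrightarrow> g \<in> Hom M N \<longrightarrow> epic N g \<longrightarrow> h \<in> Hom P N \<longrightarrow>
     (\<exists>h'\<in>Hom P M. g \<circ> h' = h))"

lemma projD:
  assumes "proj P" "g \<in> Hom M N" "epic N g" "h \<in> Hom P N" "ob M" "ob N"
  obtains h' where "h' \<in> Hom P M" "g \<circ> h' = h"
  using assms unfolding proj_def by meson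

text \<open>A map out of the regular module is determined by the image of the unit, so a preimage of
  that single element already gives a lift.\<close>

lemma proj_R: "proj R"
  unfolding proj_def
proof (intro conjI allI impI)
  fix M N g h assume M: "ob M" "ob N" and g: "g \<in> Hom M N" "epic N g" and h: "h \<in> Hom R N"
  obtain v where v: "g v = h (aunit A)"
    using g(2) HomD(3)[OF h] by (auto simp: epic_def)
  have "g \<circ> act_gen M v = h \<circ> act_gen R (aunit A)"
    by (simp add: act_gen_Hom_comp[OF g(1)] act_gen_Hom_comp[OF h] v)
  then show "\<exists>h'\<in>Hom R M. g \<circ> h' = h"
    using act_gen_Hom[OF M(1), of v] unfolding act_gen_R_unit Hom_comp_one[OF h] by blast
qed (rule ob_R)

lemma proj_dsum:
  assumes "proj P" "proj Q"
  shows "proj (dsum P Q)"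
  unfolding proj_def
proof (intro conjI allI impI)
  have ob: "ob P" "ob Q" using assms by (auto simp: proj_def)
  then show "ob (dsum P Q)" by (rule ob_dsum)
  fix M N g h assume M: "ob M" "ob N" and g: "g \<in> Hom M N" "epic N g" and h: "h \<in> Hom (dsum P Q) N"
  obtain p where p: "p \<in> Hom P M" "g \<circ> p = h \<circ> inl P"
    by (rule projD[OF assms(1) g Hom_comp[OF h biproduct_Hom(1)[OF ob]] M])
  obtain q where q: "q \<in> Hom Q M" "g \<circ> q = h \<circ> inr P Q"
    by (rule projD[OF assms(2) g Hom_comp[OF h biproduct_Hom(2)[OF ob]] M])
  obtain t where t: "t \<in> Hom (dsum P Q) M" "\<And>v. t v = p (prl P v) + q (prr P Q v)"
    by (rule copair[OF ob p(1) q(1)], rule that)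
  have "g \<circ> t = h"
  proof
    fix v
    have "(g \<circ> t) v = (g \<circ> p) (prl P v) + (g \<circ> q) (prr P Q v)"
      by (simp add: t(2) Hom_lin[OF g(1)])
    also have "\<dots> = h (inl P (prl P v) + inr P Q (prr P Q v))"
      by (simp add: p(2) q(2) Hom_lin[OF h])
    finally show "(g \<circ> t) v = h v"
      by (simp only: biproduct_apply(5) HomD(2)[OF h])
  qed
  with t(1) show "\<exists>h'\<in>Hom (dsum P Q) M. g \<circ> h' = h" by blast
qed

lemma proj_zero:
  assumes "ob Z" "mdim Z = 0"
  shows "proj Z"
  unfolding proj_def
proof (intro conjI allI impI)
  fix M N g h assume g: "g \<in> Hom M N" and h: "h \<in> Hom Z N"
  have "g \<circ> 0 = h"
    unfolding Hom_from_zero[OF assms(2) h] by (rule ext) (simp add: Hom_lin[OF g])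
  then show "\<exists>h'\<in>Hom Z M. g \<circ> h' = h" using Hom_zero by blast
qed (rule assms)

lemma mdim_zmod [simp]: "mdim zmod = 0"
  by (simp add: zmod_def)

lemma proj_mpow_R: "proj (mpow R r)"
  by (induction r) (simp_all add: proj_zero ob_zmod proj_dsum proj_R)

lemma proj_retract:
  assumes "proj P" "ob Q" "s \<in> Hom Q P" "p \<in> Hom P Q" "p \<circ> s = one Q"
  shows "proj Q"
  unfolding proj_def
proof (intro conjI allI impI)
  fix M N g h assume M: "ob M" "ob N" and g: "g \<in> Hom M N" "epic N g" and h: "h \<in> Hom Q N"
  obtain h' where h': "h' \<in> Hom P M" "g \<circ> h' = h \<circ> p"
    by (rule projD[OF assms(1) g Hom_comp[OF h assms(4)] M])
  have "g \<circ> (h' \<circ> s) = h"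
    using h'(2) assms(5) by (metis comp_assoc Hom_comp_one[OF h])
  then show "\<exists>h'\<in>Hom Q M. g \<circ> h' = h" using Hom_comp[OF h'(1) assms(3)] by blast
qed (rule assms)

lemma exists_free_cover:
  assumes "ob M"
  obtains r \<pi> where "\<pi> \<in> Hom (mpow R r) M" "epic M \<pi>"
proof -
  \<comment> \<open>One free summand per unit vector. The guard \<open>j < mdim M\<close> lets the
    induction run over every \<open>r\<close>, although later unit vectors lie outside the
    carrier.\<close>
  have "\<exists>\<pi>\<in>Hom (mpow R r) M. \<forall>j<r. j < mdim M \<longrightarrow> unit_vec j \<in> range \<pi>" for r
  proof (induction r)
    case (Suc r)
    then obtain \<pi> where p: "\<pi> \<in> Hom (mpow R r) M" "\<forall>j<r. j < mdim M \<longrightarrow> unit_vec j \<in> range \<pi>" by blast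
    obtain t where t: "t \<in> Hom (dsum R (mpow R r)) M" "t \<circ> inl R = act_gen M (unit_vec r)" "t \<circ> inr R (mpow R r) = \<pi>"
      by (rule copair[OF ob_R ob_mpow[OF ob_R] act_gen_Hom[OF assms] p(1)], rule that)
    have "unit_vec j \<in> range t" if "j < Suc r" "j < mdim M" for j
    proof (cases "j = r")
      case True
      then have "unit_vec j = t (inl R (aunit A))"
        using act_gen_unit[OF assms, of "unit_vec r"] fun_cong[OF t(2), of "aunit A"] that by simp
      then show ?thesis by blast
    next
      case False
      then have "unit_vec j \<in> range (t \<circ> inr R (mpow R r))" using p(2) t(3) that by auto
      then show ?thesis by auto
    qed
    with t(1) show ?case by auto
  qed (use Hom_zero in auto)
  then obtain \<pi> where p: "\<pi> \<in> Hom (mpow R (mdim M)) M" "\<forall>j<mdim M. unit_vec j \<in> range \<pi>"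
    by blast
  have "vs.span (unit_vec ` {..<mdim M}) \<subseteq> range \<pi>"
    by (rule vs.span_minimal) (use p(2) range_submodule(1)[OF p(1)] in auto)
  then have "epic M \<pi>"
    unfolding epic_def vecs_span by blast
  with p(1) show ?thesis by (rule that)
qed

end

section \<open>Vanishing of Ext\<close>

context fd_algebra
begin

section \<open>Chosen free covers, syzygies and Ext in terms of them\<close>

lemma exists_cover: "ob M \<Longrightarrow> \<exists>c. case c of (P, \<pi>, K, \<iota>) \<Rightarrow> ses K \<iota> P \<pi> M \<and> (\<exists>r. P = mpow R r)"
  by (rule exists_free_cover, assumption, rule ses_of_epic[OF ob_mpow[OF ob_R]]) auto

text \<open>Fixing one cover per module removes the quantifier over resolutions from every statement
  about Ext. The components are the free module, its projection, the syzygy and the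
  inclusion.\<close>

definition cover where
  "cover M = (SOME c. case c of (P, \<pi>, K, \<iota>) \<Rightarrow> ses K \<iota> P \<pi> M \<and> (\<exists>r. P = mpow R r))"

definition "Cov M = fst (cover M)"
definition "cov M = fst (snd (cover M))"
definition "Syz M = fst (snd (snd (cover M)))"
definition "syz M = snd (snd (snd (cover M)))"

lemma cover:
  assumes "ob M"
  shows "ses (Syz M) (syz M) (Cov M) (cov M) M" "\<exists>r. Cov M = mpow R r"
  using someI_ex[OF exists_cover[OF assms]]
  by (auto simp: Cov_def cov_def Syz_def syz_def cover_def case_prod_beta)

lemma proj_Cov: "ob M \<Longrightarrow> proj (Cov M)"
  using cover(2) proj_mpow_R by force

lemma ob_Syz: "ob M \<Longrightarrow> ob (Syz M)"
  using sesD(1)[OF cover(1)] .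

lemma ob_Syz_pow: "ob M \<Longrightarrow> ob ((Syz ^^ n) M)"
  by (induction n) (simp_all add: ob_Syz)

text \<open>\<open>ext_van k M N\<close> stands for \<open>Ext\<^sup>k\<^sup>+\<^sup>1(M, N) = 0\<close>: the index is shifted by one.\<close>
primrec ext_van :: "nat \<Rightarrow> 'k modl \<Rightarrow> 'k modl \<Rightarrow> bool" where
  "ext_van 0 M N \<longleftrightarrow> (\<forall>h\<in>Hom (Syz M) N. \<exists>h'\<in>Hom (Cov M) N. h' \<circ> syz M = h)"
| "ext_van (Suc k) M N \<longleftrightarrow> ext_van k (Syz M) N"

lemma ext_van_add: "ext_van (k + n) M N \<longleftrightarrow> ext_van k ((Syz ^^ n) M) N"
  by (induction n arbitrary: M) (simp_all add: funpow_swap1)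

lemma ext_van_Syz: "ext_van n M N \<longleftrightarrow> ext_van 0 ((Syz ^^ n) M) N"
  using ext_van_add[of 0 n] by simp

text \<open>Exactness of Hom(M,Y) -> Hom(M,Z) -> Ext^1(M,X). The map \<open>h\<close> lifts on the
  free cover, and the obstruction on the syzygy takes values in \<open>X\<close>; vanishing of Ext^1
  allows it to be subtracted.\<close>

lemma ext_lift:
  assumes S: "ses X f Y g Z" and M: "ob M" "ext_van 0 M X" and h: "h \<in> Hom M Z"
  obtains h' where "h' \<in> Hom M Y" "g \<circ> h' = h"
proof -
  note D = sesD[OF S] and C = sesD[OF cover(1)[OF M(1)]]
  obtain u where u: "u \<in> Hom (Cov M) Y" "g \<circ> u = h \<circ> cov M"
    by (rule projD[OF proj_Cov[OF M(1)] D(5,7) Hom_comp[OF h C(5)] D(2,3)])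
  have gu: "g (u v) = h (cov M v)" for v using fun_cong[OF u(2), of v] by simp
  have "g \<circ> (u \<circ> syz M) = 0" by (rule ext) (simp add: gu C(9) Hom_lin[OF h])
  from ses_factor_left[OF S C(1) Hom_comp[OF u(1) C(4)] this]
  obtain k where k: "k \<in> Hom (Syz M) X" "f \<circ> k = u \<circ> syz M" .
  obtain k' where k': "k' \<in> Hom (Cov M) X" "k' \<circ> syz M = k" using M(2) k(1) by auto
  have fk: "f (k' (syz M v)) = u (syz M v)" for v
    using fun_cong[OF k(2), of v] fun_cong[OF k'(2), of v] by simp
  have w: "u - (f \<circ> k') \<in> Hom (Cov M) Y" by (rule Hom_diff[OF u(1) Hom_comp[OF D(4) k'(1)]])
  have "(u - (f \<circ> k')) \<circ> syz M = 0" by (rule ext) (simp add: fk)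
  from ses_factor_right[OF cover(1)[OF M(1)] w this]
  obtain h' where h': "h' \<in> Hom M Y" "h' \<circ> cov M = u - (f \<circ> k')" .
  have "g \<circ> h' = h"
  proof (rule epic_cancel[OF C(5,7) Hom_comp[OF D(5) h'(1)] h])
    show "g \<circ> h' \<circ> cov M = h \<circ> cov M"
      unfolding comp_assoc h'(2) by (rule ext) (simp add: Hom_lin[OF D(5)] gu D(9))
  qed
  with h'(1) show ?thesis by (rule that)
qed

text \<open>Comparing the sequence with a projective presentation of \<open>Z\<close> exhibits
  \<open>Y\<close> as the pushout of \<open>\<iota>\<close> and \<open>v\<close>. This links an
  arbitrary sequence ending in \<open>Z\<close> to a presentation chosen beforehand.\<close>

lemma ses_rotate:
  assumes S: "ses X f Y g Z" and K: "ses K \<iota> P \<pi> Z" and P: "proj P"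
  obtains v \<kappa> \<theta> where "v \<in> Hom K X" "ses K \<kappa> (dsum X P) \<theta> Y" "\<And>x. \<kappa> x = inl X (v x) - inr X P (\<iota> x)"
    "\<theta> \<circ> inl X = f"
proof -
  note D = sesD[OF S] and C = sesD[OF K]
  note B = biproduct_Hom[OF D(1) C(2)]
  obtain u where u: "u \<in> Hom P Y" "g \<circ> u = \<pi>"
    by (rule projD[OF P D(5,7) C(5) D(2,3)])
  have gu: "g (u v) = \<pi> v" for v using fun_cong[OF u(2), of v] by simp
  have "g \<circ> (u \<circ> \<iota>) = 0" by (rule ext) (simp add: gu C(9))
  from ses_factor_left[OF S C(1) Hom_comp[OF u(1) C(4)] this]
  obtain k where k: "k \<in> Hom K X" "f \<circ> k = u \<circ> \<iota>" .
  have fk: "f (k w) = u (\<iota> w)" for w using fun_cong[OF k(2), of w] by simp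
  obtain \<theta> where t: "\<theta> \<in> Hom (dsum X P) Y" "\<theta> \<circ> inl X = f" "\<theta> \<circ> inr X P = u"
    "\<And>x. \<theta> x = f (prl X x) + u (prr X P x)"
    by (rule copair[OF D(1) C(2) D(4) u(1)], rule that)
  have ti: "\<theta> (inl X x) = f x" "\<theta> (inr X P x) = u x" for x
    using fun_cong[OF t(2), of x] fun_cong[OF t(3), of x] by auto
  let ?\<kappa> = "(inl X \<circ> k) - (inr X P \<circ> \<iota>)"
  have kap: "?\<kappa> \<in> Hom K (dsum X P)"
    by (intro Hom_diff Hom_comp[OF B(1) k(1)] Hom_comp[OF B(2) C(4)])
  have "monic K ?\<kappa>"
    unfolding monic_def
  proof (intro ballI impI)
    fix v assume v: "v \<in> car K" "?\<kappa> v = 0"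
    then have "prr X P (?\<kappa> v) = 0" by (simp add: lin_simps[OF lin_prr])
    then have "\<iota> v = 0"
      by (simp add: lin_simps[OF lin_prr] biproduct_apply Hom_one_left[OF C(4)])
    then show "v = 0" using C(6) v(1) by (simp add: monic_def)
  qed
  moreover have "epic Y \<theta>"
    unfolding epic_def
  proof
    fix y assume y: "y \<in> car Y"
    obtain p where p: "p \<in> car P" "\<pi> p = g y" using epicD[OF C(7) HomD(3)[OF D(5)] C(5)] by blast
    have "g (y - u p) = 0" by (simp add: Hom_lin[OF D(5)] gu p(2))
    moreover have "y - u p \<in> car Y" by (intro vs.subspace_diff subspace_vecs y HomD(3)[OF u(1)])
    ultimately obtain x where x: "x \<in> car X" "f x = y - u p" using ses_exact[OF S] by blast
    have "\<theta> (inl X x + inr X P p) = y"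
      by (simp add: Hom_lin[OF t(1)] ti x)
    then show "\<exists>z. \<theta> z = y" by blast
  qed
  moreover have "\<theta> z = 0 \<longleftrightarrow> (\<exists>w. ?\<kappa> w = z)" if z: "z \<in> car (dsum X P)" for z
  proof
    let ?x = "prl X z" and ?p = "prr X P z"
    assume "\<theta> z = 0"
    then have fu: "f ?x + u ?p = 0" by (simp add: t(4))
    have x: "?x \<in> car X" and pc: "?p \<in> car P" by (auto simp: prl_def prr_def)
    have "g (f ?x + u ?p) = 0" using fu by (simp add: Hom_lin[OF D(5)])
    then have "\<pi> ?p = 0" by (simp add: Hom_lin[OF D(5)] D(9) gu)
    then obtain w where w: "\<iota> w = ?p" using ses_exact[OF K pc] by auto
    then have "f (?x + k w) = 0" using fu by (simp add: Hom_lin[OF D(4)] fk)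
    moreover have "?x + k w \<in> car X"
      by (intro vs.subspace_add subspace_vecs x HomD(3)[OF k(1)])
    ultimately have "?x + k w = 0" using D(6) by (simp add: monic_def)
    \<comment> \<open>The minus sign in \<open>\<kappa>\<close> makes \<open>- w\<close>, not
      \<open>w\<close>, the preimage of \<open>z\<close>.\<close>
    then have "k (- w) = ?x" using minus_unique[of "k w" ?x] by (simp add: Hom_lin[OF k(1)] add.commute)
    moreover have "\<iota> (- w) = - ?p" using w by (simp add: Hom_lin[OF C(4)])
    ultimately have "?\<kappa> (- w) = inl X ?x + inr X P ?p" by (simp add: lin_simps[OF lin_inr])
    then have "?\<kappa> (- w) = z" by (simp only: biproduct_apply(5) trunc_vecs[OF z])
    then show "\<exists>w. ?\<kappa> w = z" by blast
  qed (auto simp: Hom_lin[OF t(1)] ti fk)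
  ultimately have "ses K ?\<kappa> (dsum X P) \<theta> Y"
    unfolding ses_def using kap t(1) C(1) D(2) ob_dsum[OF D(1) C(2)] by blast
  then show ?thesis using k(1) t(2) by (intro that[of k ?\<kappa> \<theta>]) simp_all
qed

text \<open>Passes from the chosen cover of \<open>M\<close> to any sequence ending in
  \<open>M\<close>: by the pushout description, a map on \<open>Y\<close> is a pair of maps on
  \<open>X\<close> and \<open>Cov M\<close> that are compatible on \<open>Syz M\<close>.\<close>

lemma ext_extend:
  assumes S: "ses X f Y g M" and N: "ext_van 0 M N" and h: "h \<in> Hom X N"
  obtains h' where "h' \<in> Hom Y N" "h' \<circ> f = h"
proof -
  note D = sesD[OF S] and C = sesD[OF cover(1)[OF sesD(3)[OF S]]]
  obtain v \<kappa> \<theta> where v: "v \<in> Hom (Syz M) X" and r: "ses (Syz M) \<kappa> (dsum X (Cov M)) \<theta> Y"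
    and k: "\<And>x. \<kappa> x = inl X (v x) - inr X (Cov M) (syz M x)" and t: "\<theta> \<circ> inl X = f"
    by (rule ses_rotate[OF S cover(1)[OF D(3)] proj_Cov[OF D(3)]], rule that)
  obtain w where w: "w \<in> Hom (Cov M) N" "w \<circ> syz M = h \<circ> v" using N Hom_comp[OF h v] by auto
  obtain \<phi> where p: "\<phi> \<in> Hom (dsum X (Cov M)) N" "\<phi> \<circ> inl X = h" "\<phi> \<circ> inr X (Cov M) = w"
    by (rule copair[OF D(1) C(2) h w(1)], rule that)
  have "\<phi> \<circ> \<kappa> = 0"
  proof
    fix x show "(\<phi> \<circ> \<kappa>) x = 0 x"
      using fun_cong[OF p(2), of "v x"] fun_cong[OF p(3), of "syz M x"] fun_cong[OF w(2), of x]
      by (simp add: k Hom_lin[OF p(1)])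
  qed
  from ses_factor_right[OF r p(1) this] obtain h' where h': "h' \<in> Hom Y N" "h' \<circ> \<theta> = \<phi>" .
  have "h' \<circ> f = h" using t p(2) h'(2) by (metis comp_assoc)
  with h'(1) show ?thesis by (rule that)
qed

text \<open>\<open>\<theta>\<close> represents a class in \<open>Ext\<^sup>2(C', C)\<close>, which is zero iff \<open>\<theta>\<close> is null-homotopic.\<close>
lemma ext2_null_homotopic:
  assumes S: "ses C c X d Y" and S': "ses Y' d' X' c' C'"
    and E: "ext_van 1 C' C" "ext_van 0 X' X" and \<theta>: "\<theta> \<in> Hom Y' Y"
  obtains t s where "t \<in> Hom X' Y" "s \<in> Hom Y' X" "\<theta> = (t \<circ> d') + (d \<circ> s)"
proof -
  note D = sesD[OF S] and D' = sesD[OF S']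
  let ?K = "Syz C'" and ?P = "Cov C'"
  note B = biproduct_Hom[OF D'(1) sesD(2)[OF cover(1)[OF D'(3)]]]
  obtain v \<kappa> \<Theta> where v: "v \<in> Hom ?K Y'" and r: "ses ?K \<kappa> (dsum Y' ?P) \<Theta> X'"
    and k: "\<And>x. \<kappa> x = inl Y' (v x) - inr Y' ?P (syz C' x)" and t: "\<Theta> \<circ> inl Y' = d'"
    by (rule ses_rotate[OF S' cover(1)[OF D'(3)] proj_Cov[OF D'(3)]], rule that)
  \<comment> \<open>Ext^2 of \<open>C'\<close> is Ext^1 of its syzygy, so its vanishing lifts
    \<open>\<theta> \<circ> v\<close> through \<open>d\<close>.\<close>
  obtain w where w: "w \<in> Hom ?K X" "d \<circ> w = \<theta> \<circ> v"
    using ext_lift[OF S ob_Syz[OF D'(3)] _ Hom_comp[OF \<theta> v]] E(1) by auto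
  \<comment> \<open>Vanishing of Ext^1(X', X) extends the lift over the pushout. What remains of
    \<open>\<theta>\<close> then vanishes on the syzygy and descends to \<open>X'\<close>.\<close>
  obtain W where W: "W \<in> Hom (dsum Y' ?P) X" "W \<circ> \<kappa> = w" by (rule ext_extend[OF r E(2) w(1)])
  let ?\<phi> = "(\<theta> \<circ> prl Y') - (d \<circ> W)"
  have "?\<phi> \<circ> \<kappa> = 0"
  proof
    fix x
    have "prl Y' (\<kappa> x) = v x"
      by (simp add: k prl_def lin_simps[OF lin_trunc] biproduct_apply[unfolded prl_def] Hom_one_left[OF v])
    then show "(?\<phi> \<circ> \<kappa>) x = 0 x"
      using fun_cong[OF W(2), of x] fun_cong[OF w(2), of x] by simp
  qed
  from ses_factor_right[OF r Hom_diff[OF Hom_comp[OF \<theta> B(3)] Hom_comp[OF D(5) W(1)]] this]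
  obtain t where t': "t \<in> Hom X' Y" "t \<circ> \<Theta> = ?\<phi>" .
  have "\<theta> = (t \<circ> d') + (d \<circ> (W \<circ> inl Y'))"
  proof
    fix y
    have "t (d' y) = ?\<phi> (inl Y' y)"
      using fun_cong[OF t, of y] fun_cong[OF t'(2), of "inl Y' y"] by simp
    then show "\<theta> y = ((t \<circ> d') + (d \<circ> (W \<circ> inl Y'))) y"
      by (simp add: biproduct_apply HomD(2)[OF \<theta>])
  qed
  with t'(1) Hom_comp[OF W(1) B(1)] show ?thesis by (rule that)
qed

text \<open>Exactness of Ext^{k+1}(M,Y) -> Ext^{k+1}(M,Z) -> Ext^{k+2}(M,X). Replacing
  \<open>M\<close> by syzygies reduces to \<open>k = 0\<close>.\<close>

lemma ext_van_quotient:
  assumes "ses X f Y g Z" "ob M" "ext_van k M Y" "ext_van (Suc k) M X"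
  shows "ext_van k M Z"
  using assms(2-)
proof (induction k arbitrary: M)
  case 0
  note C = sesD[OF cover(1)[OF 0(1)]]
  show ?case
    unfolding ext_van.simps(1)
  proof
    fix h assume h: "h \<in> Hom (Syz M) Z"
    obtain h1 where h1: "h1 \<in> Hom (Syz M) Y" "g \<circ> h1 = h"
      using ext_lift[OF assms(1) C(1) _ h] 0(3) by auto
    obtain h2 where "h2 \<in> Hom (Cov M) Y" "h2 \<circ> syz M = h1" using 0(2) h1(1) by auto
    then have "g \<circ> h2 \<in> Hom (Cov M) Z" "g \<circ> h2 \<circ> syz M = h"
      using h1(2) Hom_comp[OF sesD(5)[OF assms(1)]] by (auto simp: comp_assoc)
    then show "\<exists>h'\<in>Hom (Cov M) Z. h' \<circ> syz M = h" by blast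
  qed
next
  case (Suc k)
  then show ?case using ob_Syz by simp
qed

text \<open>Exactness of Ext^{k+1}(M,Z) -> Ext^{k+2}(M,X) -> Ext^{k+2}(M,Y).\<close>

lemma ext_van_sub:
  assumes S: "ses X f Y g Z" and "ob M" "ext_van k M Z" "ext_van (Suc k) M Y"
  shows "ext_van (Suc k) M X"
  using assms(2-)
proof (induction k arbitrary: M)
  case 0
  note D = sesD[OF S]
  let ?M = "Syz M"
  note C = sesD[OF cover(1)[OF 0(1)]]
  note C' = sesD[OF cover(1)[OF C(1)]]
  show ?case
    unfolding ext_van.simps
  proof
    fix h assume h: "h \<in> Hom (Syz ?M) X"
    obtain u where u: "u \<in> Hom (Cov ?M) Y" "u \<circ> syz ?M = f \<circ> h"
      using 0(3) Hom_comp[OF D(4) h] by auto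
    have uio: "u (syz ?M v) = f (h v)" for v using fun_cong[OF u(2), of v] by simp
    have "g \<circ> u \<circ> syz ?M = 0" by (rule ext) (simp add: uio D(9))
    from ses_factor_right[OF cover(1)[OF C(1)] Hom_comp[OF D(5) u(1)] this]
    obtain w where w: "w \<in> Hom ?M Z" "w \<circ> cov ?M = g \<circ> u" .
    obtain w1 where w1: "w1 \<in> Hom (Cov M) Z" "w1 \<circ> syz M = w" using 0(2) w(1) by auto
    obtain w2 where w2: "w2 \<in> Hom (Cov M) Y" "g \<circ> w2 = w1"
      by (rule projD[OF proj_Cov[OF 0(1)] D(5,7) w1(1) D(2,3)])
    have gw: "g (w2 (syz M (cov ?M v))) = g (u v)" for v
      using fun_cong[OF w2(2)] fun_cong[OF w1(2)] fun_cong[OF w(2)] by simp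
    \<comment> \<open>The extension \<open>u\<close> of \<open>f \<circ> h\<close> need not take
      values in \<open>X\<close>. Its image in \<open>Z\<close> comes from a map on the syzygy of
      \<open>M\<close>, which extends to \<open>Cov M\<close> and lifts to \<open>Y\<close>; the
      correction leaves the restriction to \<open>Syz ?M\<close> unchanged.\<close>
    let ?u = "u - (w2 \<circ> syz M \<circ> cov ?M)"
    have u': "?u \<in> Hom (Cov ?M) Y"
      by (rule Hom_diff[OF u(1) Hom_comp[OF Hom_comp[OF w2(1) C(4)] C'(5)]])
    have "g \<circ> ?u = 0" by (rule ext) (simp add: Hom_lin[OF D(5)] gw)
    from ses_factor_left[OF S C'(2) u' this]
    obtain h' where h': "h' \<in> Hom (Cov ?M) X" "f \<circ> h' = ?u" .
    have "h' \<circ> syz ?M = h"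
    proof (rule monic_cancel[OF D(4,6) Hom_comp[OF h'(1) C'(4)] h])
      have "?u \<circ> syz ?M = f \<circ> h"
        by (rule ext) (simp add: C'(9) uio Hom_lin[OF C(4)] Hom_lin[OF w2(1)])
      then show "f \<circ> (h' \<circ> syz ?M) = f \<circ> h" by (simp flip: comp_assoc add: h'(2))
    qed
    then show "\<exists>h'\<in>Hom (Cov ?M) X. h' \<circ> syz ?M = h" using h'(1) by blast
  qed
next
  case (Suc k)
  then show ?case using ob_Syz by simp
qed

section \<open>Direct summands and direct sums in the second variable\<close>

definition retract :: "'k modl \<Rightarrow> 'k modl \<Rightarrow> bool" where
  "retract N N' \<longleftrightarrow> (\<exists>s\<in>Hom N N'. \<exists>p\<in>Hom N' N. p \<circ> s = one N)"

lemma retractI: "s \<in> Hom N N' \<Longrightarrow> p \<in> Hom N' N \<Longrightarrow> p \<circ> s = one N \<Longrightarrow> retract N N'"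
  by (auto simp: retract_def)

lemma retract_trans: 
  assumes "retract L M" "retract M N"
  shows "retract L N"
proof -
  obtain s p where sp: "s \<in> Hom L M" "p \<in> Hom M L" "p \<circ> s = one L" using assms(1) by (auto simp: retract_def)
  obtain s' p' where sp': "s' \<in> Hom M N" "p' \<in> Hom N M" "p' \<circ> s' = one M" using assms(2) by (auto simp: retract_def)
  have "(p \<circ> p') \<circ> (s' \<circ> s) = one L"
    using sp(3) sp'(3) Hom_one_comp[OF sp(1)] by (metis comp_assoc)
  then show ?thesis using Hom_comp sp sp' by (meson retractI)
qed

lemma ext_van_retract_right:
  assumes "retract N N'" "ext_van k M N'"
  shows "ext_van k M N"
  using assms(2)
proof (induction k arbitrary: M)
  case 0
  obtain s p where sp: "s \<in> Hom N N'" "p \<in> Hom N' N" "p \<circ> s = one N" using assms(1) by (auto simp: retract_def)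
  show ?case
    unfolding ext_van.simps
  proof
    fix h assume h: "h \<in> Hom (Syz M) N"
    obtain h' where h': "h' \<in> Hom (Cov M) N'" "h' \<circ> syz M = s \<circ> h" using 0 Hom_comp[OF sp(1) h] by auto
    have "p \<circ> h' \<circ> syz M = h" using h'(2) sp(3) Hom_one_comp[OF h] by (metis comp_assoc)
    then show "\<exists>h'\<in>Hom (Cov M) N. h' \<circ> syz M = h" using Hom_comp[OF sp(2) h'(1)] by blast
  qed
qed simp

lemma ext_van_zero_right:
  assumes "mdim N = 0" "ob M"
  shows "ext_van k M N"
  using assms(2)
proof (induction k arbitrary: M)
  case 0
  show ?case
    unfolding ext_van.simps
  proof
    fix h assume "h \<in> Hom (Syz M) N"
    then have "h = 0" by (rule Hom_to_zero[OF assms(1)])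
    then have "0 \<circ> syz M = h" by (simp add: fun_eq_iff[where f = "_ \<circ> _"])
    then show "\<exists>h'\<in>Hom (Cov M) N. h' \<circ> syz M = h" using Hom_zero by blast
  qed
qed (simp add: ob_Syz)

lemma ext_van_dsum_right:
  assumes N: "ob N" "ob N'" and M: "ext_van k M N" "ext_van k M N'"
  shows "ext_van k M (dsum N N')"
  using M
proof (induction k arbitrary: M)
  case 0
  note B = biproduct_Hom[OF N]
  show ?case
    unfolding ext_van.simps
  proof
    fix h assume h: "h \<in> Hom (Syz M) (dsum N N')"
    obtain a where a: "a \<in> Hom (Cov M) N" "a \<circ> syz M = prl N \<circ> h" using 0 Hom_comp[OF B(3) h] by auto
    obtain b where b: "b \<in> Hom (Cov M) N'" "b \<circ> syz M = prr N N' \<circ> h" using 0 Hom_comp[OF B(4) h] by auto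
    have "((inl N \<circ> a) + (inr N N' \<circ> b)) \<circ> syz M = h"
    proof
      fix v
      have "(((inl N \<circ> a) + (inr N N' \<circ> b)) \<circ> syz M) v = inl N (prl N (h v)) + inr N N' (prr N N' (h v))"
        using fun_cong[OF a(2), of v] fun_cong[OF b(2), of v] by simp
      then show "(((inl N \<circ> a) + (inr N N' \<circ> b)) \<circ> syz M) v = h v"
        by (simp only: biproduct_apply(5) Hom_one_left[OF h])
    qed
    moreover have "(inl N \<circ> a) + (inr N N' \<circ> b) \<in> Hom (Cov M) (dsum N N')"
      by (intro Hom_add Hom_comp[OF B(1) a(1)] Hom_comp[OF B(2) b(1)])
    ultimately show "\<exists>h'\<in>Hom (Cov M) (dsum N N'). h' \<circ> syz M = h" by blast
  qed
qed simp

lemma ext_van_mpow_right: "ob M \<Longrightarrow> ob N \<Longrightarrow> ext_van k M N \<Longrightarrow> ext_van k M (mpow N r)"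
  by (induction r) (simp_all add: ext_van_zero_right ext_van_dsum_right ob_mpow)

subsection \<open>Injective modules and the contravariant variable\<close>

definition inj_mod :: "'k modl \<Rightarrow> bool" where
  "inj_mod I \<longleftrightarrow> ob I \<and> (\<forall>X Y f h. ob X \<longrightarrow> ob Y \<longrightarrow> f \<in> Hom X Y \<longrightarrow> monic X f \<longrightarrow> h \<in> Hom X I \<longrightarrow>
     (\<exists>h'\<in>Hom Y I. h' \<circ> f = h))"

lemma inj_modD:
  assumes "inj_mod I" "f \<in> Hom X Y" "monic X f" "h \<in> Hom X I" "ob X" "ob Y"
  obtains h' where "h' \<in> Hom Y I" "h' \<circ> f = h"
  using assms unfolding inj_mod_def by meson

lemma ext_van_inj: "inj_mod I \<Longrightarrow> ob M \<Longrightarrow> ext_van k M I"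
proof (induction k arbitrary: M)
  case 0
  then show ?case
    using sesD[OF cover(1)[OF 0(2)]] by (auto elim: inj_modD)
qed (simp add: ob_Syz)

lemma ext_van_dimension_shift:
  assumes "ses N j I q S" "inj_mod I" "ob M"
  shows "ext_van (Suc k) M N \<longleftrightarrow> ext_van k M S"
  using ext_van_quotient[OF assms(1,3)] ext_van_sub[OF assms(1,3)] ext_van_inj[OF assms(2,3)] by blast

text \<open>Ext^1(M,N) is also the cokernel of Hom(M,I) -> Hom(M,S). In this form \<open>M\<close>
  enters without its chosen cover, which makes it usable for changes of the first variable.\<close>

lemma ext_van_0_injI:
  assumes S: "ses N j I q S" and "inj_mod I" "ob M"
    and lift: "\<And>h. h \<in> Hom M S \<Longrightarrow> \<exists>h'\<in>Hom M I. q \<circ> h' = h"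
  shows "ext_van 0 M N"
  unfolding ext_van.simps
proof
  fix h assume h: "h \<in> Hom (Syz M) N"
  note D = sesD[OF S] and C = sesD[OF cover(1)[OF assms(3)]]
  obtain u where u: "u \<in> Hom (Cov M) I" "u \<circ> syz M = j \<circ> h"
    by (rule inj_modD[OF assms(2) C(4,6) Hom_comp[OF D(4) h] C(1,2)])
  have uio: "u (syz M v) = j (h v)" for v using fun_cong[OF u(2), of v] by simp
  have "q \<circ> u \<circ> syz M = 0" by (rule ext) (simp add: uio D(9))
  from ses_factor_right[OF cover(1)[OF assms(3)] Hom_comp[OF D(5) u(1)] this]
  obtain w where w: "w \<in> Hom M S" "w \<circ> cov M = q \<circ> u" .
  obtain w' where w': "w' \<in> Hom M I" "q \<circ> w' = w" using lift[OF w(1)] by blast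
  have qw: "q (w' (cov M v)) = q (u v)" for v
    using fun_cong[OF w(2), of v] fun_cong[OF w'(2)] by simp
  have u': "u - (w' \<circ> cov M) \<in> Hom (Cov M) I" by (rule Hom_diff[OF u(1) Hom_comp[OF w'(1) C(5)]])
  have "q \<circ> (u - (w' \<circ> cov M)) = 0" by (rule ext) (simp add: Hom_lin[OF D(5)] qw)
  from ses_factor_left[OF S C(2) u' this]
  obtain h' where h': "h' \<in> Hom (Cov M) N" "j \<circ> h' = u - (w' \<circ> cov M)" .
  have "h' \<circ> syz M = h"
  proof (rule monic_cancel[OF D(4,6) Hom_comp[OF h'(1) C(4)] h])
    have "(u - (w' \<circ> cov M)) \<circ> syz M = j \<circ> h" by (rule ext) (simp add: uio C(9) Hom_lin[OF w'(1)])
    then show "j \<circ> (h' \<circ> syz M) = j \<circ> h" by (simp flip: comp_assoc add: h'(2))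
  qed
  then show "\<exists>h'\<in>Hom (Cov M) N. h' \<circ> syz M = h" using h'(1) by blast
qed

end

text \<open>Embeddings into injectives will be obtained by dualizing free covers. The vector-space
  dual would lead to right modules instead.\<close>

locale fd_algebra_inj = fd_algebra +
  assumes enough_inj: "is_module A N \<Longrightarrow> \<exists>I j q S. inj_mod I \<and> ses N j I q S"
begin

text \<open>Exactness of Ext^{k+1}(Y,N) -> Ext^{k+1}(X,N) -> Ext^{k+2}(Z,N); the induction now
  replaces \<open>N\<close> by cosyzygies.\<close>

lemma ext_van_left_sub:
  assumes S: "ses X f Y g Z" and "ob N" "ext_van k Y N" "ext_van (Suc k) Z N"
  shows "ext_van k X N"
  using assms(2-)
proof (induction k arbitrary: N)
  case 0
  note D = sesD[OF S]
  obtain I j q C where I: "inj_mod I" "ses N j I q C" using enough_inj[OF 0(1)] by blast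
  show ?case
  proof (rule ext_van_0_injI[OF I(2,1) D(1)])
    fix h assume h: "h \<in> Hom X C"
    obtain h1 where h1: "h1 \<in> Hom Y C" "h1 \<circ> f = h"
      using ext_extend[OF S _ h] ext_van_dimension_shift[OF I(2,1) D(3)] 0(3) by blast
    obtain h2 where h2: "h2 \<in> Hom Y I" "q \<circ> h2 = h1"
      using ext_lift[OF I(2) D(2) 0(2) h1(1)] by blast
    have "q \<circ> (h2 \<circ> f) = h" using h1 h2 by (simp flip: comp_assoc)
    then show "\<exists>h'\<in>Hom X I. q \<circ> h' = h" using Hom_comp[OF h2(1) D(4)] by blast
  qed
next
  case (Suc k)
  obtain I j q C where I: "inj_mod I" "ses N j I q C" using enough_inj[OF Suc.prems(1)] by blast
  note * = ext_van_dimension_shift[OF I(2,1)]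
  show ?case
    using Suc.IH[of C] Suc.prems(2,3) sesD(3)[OF I(2)]
    unfolding *[OF sesD(1)[OF S]] *[OF sesD(2)[OF S]] *[OF sesD(3)[OF S]] by blast
qed

text \<open>Exactness of Ext^{k+1}(X,N) -> Ext^{k+2}(Z,N) -> Ext^{k+2}(Y,N).\<close>

lemma ext_van_left_quotient:
  assumes S: "ses X f Y g Z" and "ob N" "ext_van k X N" "ext_van (Suc k) Y N"
  shows "ext_van (Suc k) Z N"
  using assms(2-)
proof (induction k arbitrary: N)
  case 0
  note D = sesD[OF S]
  obtain I j q C where I: "inj_mod I" "ses N j I q C" using enough_inj[OF 0(1)] by blast
  note E = sesD[OF I(2)]
  \<comment> \<open>Already the base case concerns Ext^2(Z,N), which is Ext^1(Z,C); computing the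
    latter takes a second injective embedding.\<close>
  obtain I' j' q' C' where I': "inj_mod I'" "ses C j' I' q' C'" using enough_inj[OF E(3)] by blast
  note E' = sesD[OF I'(2)]
  have "ext_van 0 Z C"
  proof (rule ext_van_0_injI[OF I'(2,1) D(3)])
    fix h assume h: "h \<in> Hom Z C'"
    have "ext_van 0 Y C" using 0(3) ext_van_dimension_shift[OF I(2,1) D(2)] by blast
    then obtain u where u: "u \<in> Hom Y I'" "q' \<circ> u = h \<circ> g"
      using ext_lift[OF I'(2) D(2) _ Hom_comp[OF h D(5)]] by blast
    have qu: "q' (u v) = h (g v)" for v using fun_cong[OF u(2), of v] by simp
    have "q' \<circ> (u \<circ> f) = 0" by (rule ext) (simp add: qu D(9) Hom_lin[OF h])
    from ses_factor_left[OF I'(2) D(1) Hom_comp[OF u(1) D(4)] this]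
    obtain w where w: "w \<in> Hom X C" "j' \<circ> w = u \<circ> f" .
    obtain w1 where w1: "w1 \<in> Hom X I" "q \<circ> w1 = w" using ext_lift[OF I(2) D(1) 0(2) w(1)] by blast
    obtain w2 where w2: "w2 \<in> Hom Y I" "w2 \<circ> f = w1" by (rule inj_modD[OF I(1) D(4,6) w1(1) D(1,2)])
    have jw: "j' (q (w2 (f v))) = u (f v)" for v
      using fun_cong[OF w2(2), of v] fun_cong[OF w1(2), of v] fun_cong[OF w(2), of v] by simp
    let ?u = "u - (j' \<circ> q \<circ> w2)"
    have u': "?u \<in> Hom Y I'" by (rule Hom_diff[OF u(1) Hom_comp[OF Hom_comp[OF E'(4) E(5)] w2(1)]])
    have "?u \<circ> f = 0" by (rule ext) (simp add: jw)
    from ses_factor_right[OF S u' this] obtain h' where h': "h' \<in> Hom Z I'" "h' \<circ> g = ?u" .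
    have "q' \<circ> h' = h"
    proof (rule epic_cancel[OF D(5,7) Hom_comp[OF E'(5) h'(1)] h])
      show "q' \<circ> h' \<circ> g = h \<circ> g"
        unfolding comp_assoc h'(2) by (rule ext) (simp add: Hom_lin[OF E'(5)] E'(9) qu)
    qed
    then show "\<exists>h'\<in>Hom Z I'. q' \<circ> h' = h" using h'(1) by blast
  qed
  then show ?case using ext_van_dimension_shift[OF I(2,1) D(3)] by blast
next
  case (Suc k)
  obtain I j q C where I: "inj_mod I" "ses N j I q C" using enough_inj[OF Suc.prems(1)] by blast
  note * = ext_van_dimension_shift[OF I(2,1)]
  show ?case
    using Suc.IH[of C] Suc.prems(2,3) sesD(3)[OF I(2)]
    unfolding *[OF sesD(1)[OF S]] *[OF sesD(2)[OF S]] *[OF sesD(3)[OF S]] by blast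
qed

lemma ext_van_retract_left:
  assumes M: "retract M M'" "ob M" "ob M'" and "ob N" "ext_van k M' N"
  shows "ext_van k M N"
  using assms(4-)
proof (induction k arbitrary: N)
  case 0
  obtain s p where sp: "s \<in> Hom M M'" "p \<in> Hom M' M" "p \<circ> s = one M" using M(1) by (auto simp: retract_def)
  obtain I j q C where I: "inj_mod I" "ses N j I q C" using enough_inj[OF 0(1)] by blast
  show ?case
  proof (rule ext_van_0_injI[OF I(2,1) M(2)])
    fix h assume h: "h \<in> Hom M C"
    obtain h1 where h1: "h1 \<in> Hom M' I" "q \<circ> h1 = h \<circ> p"
      using ext_lift[OF I(2) M(3) 0(2) Hom_comp[OF h sp(2)]] by blast
    have "q \<circ> (h1 \<circ> s) = h" using h1(2) sp(3) Hom_comp_one[OF h] by (metis comp_assoc)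
    then show "\<exists>h'\<in>Hom M I. q \<circ> h' = h" using Hom_comp[OF h1(1) sp(1)] by blast
  qed
next
  case (Suc k)
  obtain I j q C where I: "inj_mod I" "ses N j I q C" using enough_inj[OF Suc.prems(1)] by blast
  note * = ext_van_dimension_shift[OF I(2,1)]
  show ?case
    using Suc.IH[of C] Suc.prems(2) sesD(3)[OF I(2)] unfolding *[OF M(2)] *[OF M(3)] by blast
qed

lemma ext_van_zero_left:
  assumes "mdim M = 0" "ob M" "ob N"
  shows "ext_van k M N"
  using assms(3)
proof (induction k arbitrary: N)
  case 0
  obtain I j q C where I: "inj_mod I" "ses N j I q C" using enough_inj[OF 0] by blast
  note q = sesD(5)[OF I(2)]
  show ?case
  proof (rule ext_van_0_injI[OF I(2,1) assms(2)])
    fix h assume h: "h \<in> Hom M C"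
    have "q \<circ> 0 = h"
      unfolding Hom_from_zero[OF assms(1) h] by (rule ext) (simp add: Hom_lin[OF q])
    then show "\<exists>h'\<in>Hom M I. q \<circ> h' = h" using Hom_zero by blast
  qed
next
  case (Suc k)
  obtain I j q C where I: "inj_mod I" "ses N j I q C" using enough_inj[OF Suc.prems(1)] by blast
  then show ?case
    using Suc.IH[of C] sesD(3)[OF I(2)] ext_van_dimension_shift[OF I(2,1) assms(2)] by blast
qed

lemma ext_van_dsum_left:
  assumes M: "ob M" "ob M'" and "ob N" "ext_van k M N" "ext_van k M' N"
  shows "ext_van k (dsum M M') N"
  using assms(3-)
proof (induction k arbitrary: N)
  case 0
  note B = biproduct_Hom[OF M]
  obtain I j q C where I: "inj_mod I" "ses N j I q C" using enough_inj[OF 0(1)] by blast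
  show ?case
  proof (rule ext_van_0_injI[OF I(2,1) ob_dsum[OF M]])
    fix h assume h: "h \<in> Hom (dsum M M') C"
    obtain a where a: "a \<in> Hom M I" "q \<circ> a = h \<circ> inl M"
      using ext_lift[OF I(2) M(1) 0(2) Hom_comp[OF h B(1)]] by blast
    obtain b where b: "b \<in> Hom M' I" "q \<circ> b = h \<circ> inr M M'"
      using ext_lift[OF I(2) M(2) 0(3) Hom_comp[OF h B(2)]] by blast
    have "q \<circ> ((a \<circ> prl M) + (b \<circ> prr M M')) = h"
    proof
      fix v
      have "(q \<circ> ((a \<circ> prl M) + (b \<circ> prr M M'))) v = h (inl M (prl M v) + inr M M' (prr M M' v))"
        using fun_cong[OF a(2), of "prl M v"] fun_cong[OF b(2), of "prr M M' v"]
        by (simp add: Hom_lin[OF sesD(5)[OF I(2)]] Hom_lin[OF h])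
      then show "(q \<circ> ((a \<circ> prl M) + (b \<circ> prr M M'))) v = h v"
        by (simp only: biproduct_apply(5) HomD(2)[OF h])
    qed
    moreover have "(a \<circ> prl M) + (b \<circ> prr M M') \<in> Hom (dsum M M') I"
      by (intro Hom_add Hom_comp[OF a(1) B(3)] Hom_comp[OF b(1) B(4)])
    ultimately show "\<exists>h'\<in>Hom (dsum M M') I. q \<circ> h' = h" by blast
  qed
next
  case (Suc k)
  obtain I j q C where I: "inj_mod I" "ses N j I q C" using enough_inj[OF Suc.prems(1)] by blast
  note * = ext_van_dimension_shift[OF I(2,1)]
  show ?case
    using Suc.IH[of C] Suc.prems(2,3) sesD(3)[OF I(2)] unfolding *[OF M(1)] *[OF M(2)] *[OF ob_dsum[OF M]] by blast
qed

lemma ext_van_mpow_left: "ob M \<Longrightarrow> ob N \<Longrightarrow> ext_van k M N \<Longrightarrow> ext_van k (mpow M r) N"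
  by (induction r) (simp_all add: ext_van_zero_left ext_van_dsum_left ob_mpow ob_zmod)

end

section \<open>Translation from matrices\<close>

context fd_algebra
begin

lemma Hom_of_hom:
  assumes "is_hom A M N f"
  shows "mvec (mdim M) f \<in> Hom M N"
proof (rule HomI)
  show "mvec (mdim M) f (act M i v) = act N i (mvec (mdim M) f v)" if "i < adim A" for i v
  proof -
    have "mvec (mdim M) (mmul (mdim M) f (mact M i)) = mvec (mdim M) (mmul (mdim N) (mact N i) f)"
      using assms that by (simp add: is_hom_def)
    from fun_cong[OF this, of v] show ?thesis by (simp add: mvec_mmul act_def)
  qed
qed (use assms in \<open>auto simp: lin_mvec mvec_in_vecs is_hom_def\<close>)

lemma hom_of_Hom:
  assumes "\<phi> \<in> Hom M N" "ob M" "ob N"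
  shows "is_hom A M N (mat_of (mdim M) \<phi>)"
  unfolding is_hom_def
proof (intro conjI allI impI)
  let ?f = "mat_of (mdim M) \<phi>"
  show wf: "mat_wf (mdim N) (mdim M) ?f"
    using HomD(3)[OF assms(1)] by (rule mat_wf_mat_of)
  have f: "mvec (mdim M) ?f = \<phi>" using HomD(1,2)[OF assms(1)] by (rule mvec_mat_of)
  fix i assume i: "i < adim A"
  show "mmul (mdim N) (mact N i) ?f = mmul (mdim M) ?f (mact M i)"
  proof (rule mat_wf_eqI)
    show "mat_wf (mdim N) (mdim M) (mmul (mdim N) (mact N i) ?f)"
      "mat_wf (mdim N) (mdim M) (mmul (mdim M) ?f (mact M i))"
      using assms i wf by (auto simp: is_module_def intro: mat_wf_mmul)
    show "mvec (mdim M) (mmul (mdim N) (mact N i) ?f) = mvec (mdim M) (mmul (mdim M) ?f (mact M i))"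
      using HomD(4)[OF assms(1) i] by (simp add: mvec_mmul f fun_eq_iff[where f = "_ \<circ> _"] act_def)
  qed
qed

lemma mvec_mat_of_Hom: "\<phi> \<in> Hom M N \<Longrightarrow> mvec (mdim M) (mat_of (mdim M) \<phi>) = \<phi>"
  by (rule mvec_mat_of) (simp_all add: HomD)

lemma mat_of_mvec_hom: "is_hom A M N f \<Longrightarrow> mat_of (mdim M) (mvec (mdim M) f) = f"
  unfolding is_hom_def using mat_of_mvec by blast

lemma hom_eqI:
  assumes "is_hom A M N f" "is_hom A M N g" "mvec (mdim M) f = mvec (mdim M) g"
  shows "f = g"
  using assms mat_wf_eqI unfolding is_hom_def by blast

lemma surj_map_iff: "surj_map (mdim M) (mdim N) f \<longleftrightarrow> epic N (mvec (mdim M) f)"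
  unfolding surj_map_def epic_def vecs_def
  by (metis (no_types, lifting) mem_Collect_eq mvec_trunc trunc_in_vecs vecs_def)

lemma inj_map_iff: "inj_map (mdim M) f \<longleftrightarrow> monic M (mvec (mdim M) f)"
  by (auto simp: inj_map_def monic_def vecs_def zero_fun_def)

lemma exact_at_iff:
  "exact_at n (mdim M) f g \<longleftrightarrow> (\<forall>v\<in>car M. mvec (mdim M) g v = 0 \<longleftrightarrow> (\<exists>u. mvec n f u = v))"
proof -
  have "(\<exists>u. vec_wf n u \<and> mvec n f u = v) \<longleftrightarrow> (\<exists>u. mvec n f u = v)" for v
    by (metis mem_Collect_eq mvec_trunc trunc_in_vecs vecs_def)
  then show ?thesis by (auto simp: exact_at_def vecs_def zero_fun_def)
qed

lemma projective_iff: "projective A P \<longleftrightarrow> proj P"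
proof
  assume P: "projective A P"
  then have obP: "ob P" by (simp add: projective_def)
  show "proj P"
    unfolding proj_def
  proof (intro conjI obP allI impI)
    fix M N g h assume M: "ob M" "ob N" and g: "g \<in> Hom M N" "epic N g" and h: "h \<in> Hom P N"
    have "surj_map (mdim M) (mdim N) (mat_of (mdim M) g)"
      using g by (simp add: surj_map_iff mvec_mat_of_Hom)
    then obtain h' where h': "is_hom A P M h'" "mmul (mdim M) (mat_of (mdim M) g) h' = mat_of (mdim P) h"
      using P hom_of_Hom[OF g(1) M] hom_of_Hom[OF h obP M(2)] M unfolding projective_def by blast
    have "mvec (mdim P) (mmul (mdim M) (mat_of (mdim M) g) h') = mvec (mdim P) (mat_of (mdim P) h)"
      by (simp only: h'(2))
    then have "g \<circ> mvec (mdim P) h' = h"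
      by (simp add: mvec_mmul mvec_mat_of_Hom[OF g(1)] mvec_mat_of_Hom[OF h])
    then show "\<exists>h'\<in>Hom P M. g \<circ> h' = h" using Hom_of_hom[OF h'(1)] by blast
  qed
next
  assume P: "proj P"
  then have obP: "ob P" by (simp add: proj_def)
  show "projective A P"
    unfolding projective_def
  proof (intro conjI obP allI impI, elim conjE)
    fix M N g h
    assume M: "ob M" "ob N" and g: "is_hom A M N g" "surj_map (mdim M) (mdim N) g" and h: "is_hom A P N h"
    obtain h' where h': "h' \<in> Hom P M" "mvec (mdim M) g \<circ> h' = mvec (mdim P) h"
      by (rule projD[OF P Hom_of_hom[OF g(1)] g(2)[unfolded surj_map_iff] Hom_of_hom[OF h] M])
    let ?h = "mat_of (mdim P) h'"
    have "mmul (mdim M) g ?h = h"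
    proof (rule mat_wf_eqI)
      show "mat_wf (mdim N) (mdim P) (mmul (mdim M) g ?h)"
        using g(1) hom_of_Hom[OF h'(1) obP M(1)] by (auto simp: is_hom_def intro: mat_wf_mmul)
      show "mat_wf (mdim N) (mdim P) h" using h by (simp add: is_hom_def)
      show "mvec (mdim P) (mmul (mdim M) g ?h) = mvec (mdim P) h"
        by (simp add: mvec_mmul mvec_mat_of_Hom[OF h'(1)] h'(2))
    qed
    then show "\<exists>h'. is_hom A P M h' \<and> mmul (mdim M) g h' = h"
      using hom_of_Hom[OF h'(1) obP M(1)] by blast
  qed
qed

section \<open>Isomorphisms and the additive closure as statements about linear maps\<close>

definition isom :: "'k modl \<Rightarrow> 'k modl \<Rightarrow> bool" where
  "isom M N \<longleftrightarrow> (\<exists>f\<in>Hom M N. \<exists>g\<in>Hom N M. g \<circ> f = one M \<and> f \<circ> g = one N)"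

lemma isomE:
  assumes "isom M N"
  obtains f g where "f \<in> Hom M N" "g \<in> Hom N M" "g \<circ> f = one M" "f \<circ> g = one N"
  using assms by (auto simp: isom_def)

lemma isomI: "f \<in> Hom M N \<Longrightarrow> g \<in> Hom N M \<Longrightarrow> g \<circ> f = one M \<Longrightarrow> f \<circ> g = one N \<Longrightarrow> isom M N"
  by (auto simp: isom_def)

lemma isom_sym: "isom M N \<Longrightarrow> isom N M"
  by (auto simp: isom_def)

lemma isom_retract: "isom M N \<Longrightarrow> retract M N"
  by (auto simp: isom_def retract_def)

lemma retract_monic: "s \<in> Hom M N \<Longrightarrow> p \<in> Hom N M \<Longrightarrow> p \<circ> s = one M \<Longrightarrow> monic M s"
  unfolding monic_def by (metis Hom_lin(3) comp_apply trunc_vecs)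

lemma retract_epic: "p \<circ> s = one M \<Longrightarrow> epic M p"
  unfolding epic_def by (metis comp_apply trunc_vecs)

lemma isom_iff: "ob M \<Longrightarrow> ob N \<Longrightarrow> isom M N \<longleftrightarrow> is_iso A M N"
proof
  assume ob: "ob M" "ob N" and "isom M N"
  then obtain f g where f: "f \<in> Hom M N" "g \<in> Hom N M" "g \<circ> f = one M" "f \<circ> g = one N" by (rule_tac isomE)
  let ?f = "mat_of (mdim M) f" and ?g = "mat_of (mdim N) g"
  note h = hom_of_Hom[OF f(1) ob] hom_of_Hom[OF f(2) ob(2,1)]
  have wf: "mat_wf (mdim N) (mdim M) ?f" "mat_wf (mdim M) (mdim N) ?g" using h by (auto simp: is_hom_def)
  have "mmul (mdim N) ?g ?f = idm (mdim M)"
    by (rule mat_wf_eqI[OF mat_wf_mmul[OF wf(2,1)] mat_wf_idm])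
      (simp add: mvec_mmul mvec_mat_of_Hom[OF f(1)] mvec_mat_of_Hom[OF f(2)] f mvec_idm)
  moreover have "mmul (mdim M) ?f ?g = idm (mdim N)"
    by (rule mat_wf_eqI[OF mat_wf_mmul[OF wf] mat_wf_idm])
      (simp add: mvec_mmul mvec_mat_of_Hom[OF f(1)] mvec_mat_of_Hom[OF f(2)] f mvec_idm)
  ultimately show "is_iso A M N" unfolding is_iso_def using h by blast
next
  assume "is_iso A M N"
  then obtain f g where f: "is_hom A M N f" "is_hom A N M g"
    "mmul (mdim N) g f = idm (mdim M)" "mmul (mdim M) f g = idm (mdim N)" by (auto simp: is_iso_def)
  show "isom M N"
  proof (rule isomI[OF Hom_of_hom[OF f(1)] Hom_of_hom[OF f(2)]])
    show "mvec (mdim N) g \<circ> mvec (mdim M) f = one M"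
      using f(3) by (simp flip: mvec_mmul add: mvec_idm)
    show "mvec (mdim M) f \<circ> mvec (mdim N) g = one N"
      using f(4) by (simp flip: mvec_mmul add: mvec_idm)
  qed
qed

lemma in_Add_iff:
  assumes "ob T"
  shows "in_Add A T M \<longleftrightarrow> ob M \<and> (\<exists>r. retract M (mpow T r))"
proof
  assume "in_Add A T M"
  then obtain r s p where "ob M" and sp: "is_hom A M (mpow T r) s" "is_hom A (mpow T r) M p"
    "mmul (mdim (mpow T r)) p s = idm (mdim M)" by (auto simp: in_Add_def)
  moreover have "mvec (mdim (mpow T r)) p \<circ> mvec (mdim M) s = one M"
    using sp(3) by (simp flip: mvec_mmul add: mvec_idm)
  ultimately show "ob M \<and> (\<exists>r. retract M (mpow T r))"
    using Hom_of_hom by (meson retractI)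
next
  assume "ob M \<and> (\<exists>r. retract M (mpow T r))"
  then obtain r s p where M: "ob M" and sp: "s \<in> Hom M (mpow T r)" "p \<in> Hom (mpow T r) M" "p \<circ> s = one M"
    by (auto simp: retract_def)
  let ?s = "mat_of (mdim M) s" and ?p = "mat_of (mdim (mpow T r)) p"
  note h = hom_of_Hom[OF sp(1) M ob_mpow[OF assms]] hom_of_Hom[OF sp(2) ob_mpow[OF assms] M]
  have "mmul (mdim (mpow T r)) ?p ?s = idm (mdim M)"
    by (rule mat_wf_eqI[OF mat_wf_mmul mat_wf_idm])
      (use h in \<open>auto simp: is_hom_def mvec_mmul mvec_mat_of_Hom[OF sp(1)] mvec_mat_of_Hom[OF sp(2)] sp(3) mvec_idm\<close>)
  then show "in_Add A T M" unfolding in_Add_def using M h by blast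
qed

lemma in_Add_retract: "ob T \<Longrightarrow> in_Add A T N \<Longrightarrow> ob M \<Longrightarrow> retract M N \<Longrightarrow> in_Add A T M"
  using in_Add_iff retract_trans by blast

subsection \<open>Projective resolutions\<close>

lemma pd_leE:
  assumes "pd_le A M n"
  obtains P d where "ob M" "\<And>i. proj (P i)" "d 0 \<in> Hom (P 0) M" "\<And>i. d (Suc i) \<in> Hom (P (Suc i)) (P i)"
    "epic M (d 0)" "\<And>i v. v \<in> car (P i) \<Longrightarrow> d i v = 0 \<longleftrightarrow> (\<exists>u. d (Suc i) u = v)" "\<And>i. i > n \<Longrightarrow> mdim (P i) = 0"
proof -
  obtain P d where Pd: "proj_resolution A M P d" "\<forall>i>n. mdim (P i) = 0"
    using assms by (auto simp: pd_le_def)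
  show ?thesis
    by (rule that[of P "\<lambda>i. mvec (mdim (P i)) (d i)"])
      (use Pd in \<open>auto simp: proj_resolution_def projective_iff surj_map_iff exact_at_iff intro: Hom_of_hom\<close>)
qed

lemma proj_resolutionI:
  assumes "ob M" "\<And>i. proj (P i)" "d 0 \<in> Hom (P 0) M" "\<And>i. d (Suc i) \<in> Hom (P (Suc i)) (P i)"
    "epic M (d 0)" "\<And>i v. v \<in> car (P i) \<Longrightarrow> d i v = 0 \<longleftrightarrow> (\<exists>u. d (Suc i) u = v)"
  shows "proj_resolution A M P (\<lambda>i. mat_of (mdim (P i)) (d i))"
proof -
  have ob: "ob (P i)" for i using assms(2) by (simp add: proj_def)
  have m: "mvec (mdim (P i)) (mat_of (mdim (P i)) (d i)) = d i" for i
    by (cases i) (use assms(3,4) mvec_mat_of_Hom in auto)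
  show ?thesis
    unfolding proj_resolution_def projective_iff surj_map_iff exact_at_iff m
    using assms ob by (auto intro: hom_of_Hom)
qed

lemma pd_leI:
  assumes "ob M" "\<And>i. proj (P i)" "d 0 \<in> Hom (P 0) M" "\<And>i. d (Suc i) \<in> Hom (P (Suc i)) (P i)"
    "epic M (d 0)" "\<And>i v. v \<in> car (P i) \<Longrightarrow> d i v = 0 \<longleftrightarrow> (\<exists>u. d (Suc i) u = v)" "\<And>i. i > n \<Longrightarrow> mdim (P i) = 0"
  shows "pd_le A M n"
  unfolding pd_le_def using proj_resolutionI[OF assms(1-6)] assms(7) by blast

lemma pd_le_ob: "pd_le A M n \<Longrightarrow> ob M"
  by (rule pd_leE)

lemma pd_le_mono: "pd_le A M n \<Longrightarrow> n \<le> m \<Longrightarrow> pd_le A M m"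
  unfolding pd_le_def by (meson le_less_trans)

lemma proj_pd_le_0:
  assumes "proj M"
  shows "pd_le A M 0"
proof (rule pd_leI)
  have M: "ob M" using assms by (simp add: proj_def)
  \<comment> \<open>Resolutions are infinite sequences, so a finite one is padded with zero
    modules.\<close>
  let ?P = "\<lambda>i::nat. if i = 0 then M else zmod" and ?d = "\<lambda>i::nat. if i = 0 then one M else 0"
  show "ob M" by (rule M)
  show "proj (?P i)" for i using assms proj_zero[OF ob_zmod] by simp
  show "?d 0 \<in> Hom (?P 0) M" "?d (Suc i) \<in> Hom (?P (Suc i)) (?P i)" for i
    using Hom_one[OF M] Hom_zero by auto
  show "epic M (?d 0)" by (auto simp: epic_def intro: trunc_vecs)
  show "?d i v = 0 \<longleftrightarrow> (\<exists>u. ?d (Suc i) u = v)" if "v \<in> car (?P i)" for i v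
    using that car_zero[of zmod v] by (auto simp: trunc_vecs split: if_splits)
qed auto

lemma pd_le_SucI:
  assumes S: "ses K \<iota> P0 \<pi> M" and "proj P0" "pd_le A K n"
  shows "pd_le A M (Suc n)"
proof -
  note D = sesD[OF S]
  obtain P d where P: "\<And>i. proj (P i)" "d 0 \<in> Hom (P 0) K" "\<And>i. d (Suc i) \<in> Hom (P (Suc i)) (P i)"
    "epic K (d 0)" "\<And>i v. v \<in> car (P i) \<Longrightarrow> d i v = 0 \<longleftrightarrow> (\<exists>u. d (Suc i) u = v)" "\<And>i. i > n \<Longrightarrow> mdim (P i) = 0"
    by (rule pd_leE[OF assms(3)], rule that)
  let ?P = "\<lambda>i. case i of 0 \<Rightarrow> P0 | Suc j \<Rightarrow> P j"
  \<comment> \<open>Splicing: in degree one, the augmentation of the resolution of \<open>K\<close>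
    is followed by the inclusion of \<open>K\<close>.\<close>
  let ?d = "\<lambda>i. case i of 0 \<Rightarrow> \<pi> | Suc 0 \<Rightarrow> \<iota> \<circ> d 0 | Suc (Suc j) \<Rightarrow> d (Suc j)"
  show ?thesis
  proof (rule pd_leI[where P = ?P and d = ?d])
    show "proj (?P i)" for i using assms(2) P(1) by (cases i) auto
    show "?d (Suc i) \<in> Hom (?P (Suc i)) (?P i)" for i
      using P(3) Hom_comp[OF D(4) P(2)] by (cases i) auto
    show "?d i v = 0 \<longleftrightarrow> (\<exists>u. ?d (Suc i) u = v)" if v: "v \<in> car (?P i)" for i v
    proof (cases i)
      case 0
      then have "(\<exists>u. \<iota> u = v) \<longleftrightarrow> (\<exists>u. \<iota> (d 0 u) = v)"
        using P(4) HomD(2)[OF D(4)] unfolding epic_def by (metis trunc_in_vecs)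
      then show ?thesis using S v 0 by (simp add: ses_def)
    next
      case (Suc j)
      have "\<iota> (d 0 v) = 0 \<longleftrightarrow> d 0 v = 0" for v
        using D(6) HomD(3)[OF P(2)] Hom_lin(3)[OF D(4)] by (auto simp: monic_def)
      then show ?thesis using Suc v P(5)[of v j] by (cases j) auto
    qed
    show "mdim (?P i) = 0" if "i > Suc n" for i using that P(6) by (cases i) auto
  qed (use D in auto)
qed

lemma pd_le_SucE:
  assumes "pd_le A M (Suc n)"
  obtains K \<iota> P0 \<pi> where "ses K \<iota> P0 \<pi> M" "proj P0" "pd_le A K n"
proof -
  obtain P d where P: "ob M" "\<And>i. proj (P i)" "d 0 \<in> Hom (P 0) M" "\<And>i. d (Suc i) \<in> Hom (P (Suc i)) (P i)"
    "epic M (d 0)" "\<And>i v. v \<in> car (P i) \<Longrightarrow> d i v = 0 \<longleftrightarrow> (\<exists>u. d (Suc i) u = v)" "\<And>i. i > Suc n \<Longrightarrow> mdim (P i) = 0"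
    by (rule pd_leE[OF assms], rule that)
  have ob: "ob (P i)" for i using P(2) by (simp add: proj_def)
  obtain K \<iota> where S: "ses K \<iota> (P 0) (d 0) M"
    by (rule ses_of_epic[OF ob P(1,3,5)])
  note D = sesD[OF S]
  have "d 0 \<circ> d (Suc 0) = 0"
    by (rule ext) (use P(6)[OF HomD(3)[OF P(4)], of 0] in auto)
  from ses_factor_left[OF S ob P(4) this] obtain e where e: "e \<in> Hom (P (Suc 0)) K" "\<iota> \<circ> e = d (Suc 0)" .
  have ie: "\<iota> (e v) = d (Suc 0) v" for v using fun_cong[OF e(2), of v] by simp
  have "pd_le A K n"
  proof (rule pd_leI[where P = "\<lambda>i. P (Suc i)" and d = "\<lambda>i. if i = 0 then e else d (Suc i)"])
    show "epic K (if 0 = (0::nat) then e else d (Suc 0))"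
      unfolding epic_def
    proof
      fix w assume w: "w \<in> car K"
      have "d 0 (\<iota> w) = 0" by (rule D(9))
      then obtain u where "d (Suc 0) u = \<iota> w" using P(6)[OF HomD(3)[OF D(4)]] by blast
      then have "e u = w" using monicD[OF D(6,4) _ HomD(3)[OF e(1)] w] ie by simp
      then show "\<exists>v. (if 0 = (0::nat) then e else d (Suc 0)) v = w" by auto
    qed
    show "(if i = 0 then e else d (Suc i)) v = 0 \<longleftrightarrow> (\<exists>u. (if Suc i = 0 then e else d (Suc (Suc i))) u = v)"
      if v: "v \<in> car (P (Suc i))" for i v
    proof (cases "i = 0")
      case True
      have "e v = 0 \<longleftrightarrow> \<iota> (e v) = 0"
        using D(6) HomD(3)[OF e(1)] Hom_lin(3)[OF D(4)] by (auto simp: monic_def)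
      then show ?thesis using True P(6)[OF v] by (simp add: ie)
    qed (use P(6)[OF v] in auto)
  qed (use P D e in auto)
  with S P(2) show ?thesis by (intro that[of K \<iota> "P 0" "d 0"]) auto
qed

lemma pd_le_0_proj:
  assumes "pd_le A M 0"
  shows "proj M"
proof -
  obtain P d where P: "ob M" "\<And>i. proj (P i)" "d 0 \<in> Hom (P 0) M" "\<And>i. d (Suc i) \<in> Hom (P (Suc i)) (P i)"
    "epic M (d 0)" "\<And>i v. v \<in> car (P i) \<Longrightarrow> d i v = 0 \<longleftrightarrow> (\<exists>u. d (Suc i) u = v)" "\<And>i. i > 0 \<Longrightarrow> mdim (P i) = 0"
    by (rule pd_leE[OF assms], rule that)
  have ob: "ob (P i)" for i using P(2) by (simp add: proj_def)
  have d1: "d (Suc 0) = 0" using Hom_from_zero[OF _ P(4)] P(7) by blast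
  have "monic (P 0) (d 0)"
    unfolding monic_def using P(6)[of _ 0] d1 by auto
  then obtain e where "e \<in> Hom M (P 0)" "d 0 \<circ> e = one M"
    by (rule mdim_bij[OF P(3) _ P(5) ob P(1)])
  then show ?thesis by (rule proj_retract[OF P(2,1) _ P(3)])
qed

lemma proj_Syz:
  assumes "proj P"
  shows "proj (Syz P)"
proof -
  have P: "ob P" using assms by (simp add: proj_def)
  note C = sesD[OF cover(1)[OF P]]
  obtain s where s: "s \<in> Hom P (Cov P)" "cov P \<circ> s = one P"
    by (rule projD[OF assms C(5,7) Hom_one[OF P] C(2,3)])
  obtain r where "r \<in> Hom (Cov P) (Syz P)" "r \<circ> syz P = one (Syz P)"
    by (rule ses_retraction[OF cover(1)[OF P] s])
  then show ?thesis by (rule proj_retract[OF proj_Cov[OF P] C(1,4)])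
qed

lemma ext_van_proj: "proj P \<Longrightarrow> ext_van k P N"
proof (induction k arbitrary: P)
  case 0
  then have P: "ob P" by (simp add: proj_def)
  note C = sesD[OF cover(1)[OF P]]
  obtain s where s: "s \<in> Hom P (Cov P)" "cov P \<circ> s = one P"
    by (rule projD[OF 0 C(5,7) Hom_one[OF P] C(2,3)])
  obtain r where r: "r \<in> Hom (Cov P) (Syz P)" "r \<circ> syz P = one (Syz P)"
    by (rule ses_retraction[OF cover(1)[OF P] s])
  show ?case
    unfolding ext_van.simps
  proof
    fix h assume h: "h \<in> Hom (Syz P) N"
    have "h \<circ> r \<circ> syz P = h" using r(2) Hom_comp_one[OF h] by (simp add: comp_assoc)
    then show "\<exists>h'\<in>Hom (Cov P) N. h' \<circ> syz P = h" using Hom_comp[OF h r(1)] by blast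
  qed
qed (simp add: proj_Syz)

text \<open>Extending the identity of the syzygy to the free cover splits the cover.\<close>

lemma proj_of_ext_van_Syz:
  assumes M: "ob M" and E: "ext_van 0 M (Syz M)"
  shows "proj M"
proof -
  note C = sesD[OF cover(1)[OF M]]
  obtain r where r: "r \<in> Hom (Cov M) (Syz M)" "r \<circ> syz M = one (Syz M)"
    using E Hom_one[OF C(1)] by auto
  obtain s where "s \<in> Hom M (Cov M)" "cov M \<circ> s = one M" by (rule ses_section[OF cover(1)[OF M] r])
  then show ?thesis by (rule proj_retract[OF proj_Cov[OF M] M _ C(5)])
qed

lemma pd_le_of_proj_Syz: "ob M \<Longrightarrow> proj ((Syz ^^ n) M) \<Longrightarrow> pd_le A M n"
proof (induction n arbitrary: M)
  case (Suc n)
  then have "pd_le A (Syz M) n" using ob_Syz by (simp add: funpow_swap1)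
  then show ?case by (rule pd_le_SucI[OF cover(1)[OF Suc.prems(1)] proj_Cov[OF Suc.prems(1)]])
qed (simp add: proj_pd_le_0)

lemma proj_retract_free: "proj P \<Longrightarrow> \<exists>r. retract P (mpow R r)"
proof -
  assume P: "proj P"
  then have ob: "ob P" by (simp add: proj_def)
  note C = sesD[OF cover(1)[OF ob]]
  obtain s where s: "s \<in> Hom P (Cov P)" "cov P \<circ> s = one P"
    by (rule projD[OF P C(5,7) Hom_one[OF ob] C(2,3)])
  then have "retract P (Cov P)" using C(5) by (rule_tac retractI)
  then show ?thesis using cover(2)[OF ob] by auto
qed

text \<open>The resolution spliced from the chosen covers is one of those over which
  \<open>ext_zero\<close> quantifies. Degree \<open>Suc n\<close> corresponds to index
  \<open>n\<close>.\<close>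

lemma ext_van_of_ext_zero:
  assumes "ob M" "ext_zero A (Suc n) M N" "ob N"
  shows "ext_van n M N"
proof -
  let ?M = "\<lambda>i. (Syz ^^ i) M"
  let ?P = "\<lambda>i. Cov (?M i)"
  let ?d = "\<lambda>i. case i of 0 \<Rightarrow> cov M | Suc j \<Rightarrow> syz (?M j) \<circ> cov (?M (Suc j))"
  note C = sesD[OF cover(1)[OF ob_Syz_pow[OF assms(1)]]]
  have cv: "cov (?M (Suc i)) \<in> Hom (?P (Suc i)) (Syz (?M i))" for i using C(5)[of "Suc i"] by simp
  have d: "?d (Suc i) \<in> Hom (?P (Suc i)) (?P i)" for i
    using Hom_comp[OF C(4) cv] by simp
  have ep: "epic (Syz (?M i)) (cov (?M (Suc i)))" for i using C(7)[of "Suc i"] by simp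
  have res: "proj_resolution A M ?P (\<lambda>i. mat_of (mdim (?P i)) (?d i))"
  proof (rule proj_resolutionI)
    show "?d i v = 0 \<longleftrightarrow> (\<exists>u. ?d (Suc i) u = v)" if v: "v \<in> car (?P i)" for i v
    proof -
      have "?d i v = 0 \<longleftrightarrow> cov (?M i) v = 0"
      proof (cases i)
        case (Suc j)
        then show ?thesis
          using C(6)[of j] HomD(3)[OF cv[of j]] Hom_lin(3)[OF C(4)[of j]] by (auto simp: monic_def)
      qed simp
      also have "\<dots> \<longleftrightarrow> (\<exists>u. syz (?M i) u = v)"
        using cover(1)[OF ob_Syz_pow[OF assms(1)], of i] v by (simp add: ses_def)
      also have "\<dots> \<longleftrightarrow> (\<exists>u. syz (?M i) (cov (?M (Suc i)) u) = v)"
        using ep[of i] HomD(2)[OF C(4)[of i]] unfolding epic_def by (metis trunc_in_vecs)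
      finally show ?thesis by simp
    qed
    show "?d 0 \<in> Hom (?P 0) M" "epic M (?d 0)" using C(5,7)[of 0] by auto
  qed (use assms(1) d proj_Cov[OF ob_Syz_pow] in auto)
  show ?thesis
    unfolding ext_van_Syz[of n] ext_van.simps
  proof
    fix h assume h: "h \<in> Hom (Syz (?M n)) N"
    \<comment> \<open>A map on the syzygy of order \<open>n + 1\<close> becomes a cocycle on the
      free module covering it; the cover is cancelled again at the end.\<close>
    let ?f = "h \<circ> cov (?M (Suc n))"
    have f: "?f \<in> Hom (?P (Suc n)) N" by (rule Hom_comp[OF h cv])
    let ?F = "mat_of (mdim (?P (Suc n))) ?f"
    have m: "mvec (mdim (?P i)) (mat_of (mdim (?P i)) (?d i)) = ?d i" for i
      using mvec_mat_of_Hom[OF d] mvec_mat_of_Hom[OF C(5)[of 0]] by (cases i) auto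
    have dwf: "is_hom A (?P (Suc i)) (?P i) (mat_of (mdim (?P (Suc i))) (?d (Suc i)))" for i
      using hom_of_Hom[OF d C(2) C(2)] .
    have F: "is_hom A (?P (Suc n)) N ?F" using hom_of_Hom[OF f C(2) assms(3)] .
    have "mmul (mdim (?P (Suc n))) ?F (mat_of (mdim (?P (Suc (Suc n)))) (?d (Suc (Suc n)))) = zmx"
    proof (rule mat_wf_eqI[OF mat_wf_mmul mat_wf_zmx])
      show "mvec (mdim (?P (Suc (Suc n)))) (mmul (mdim (?P (Suc n))) ?F (mat_of (mdim (?P (Suc (Suc n)))) (?d (Suc (Suc n)))))
        = mvec (mdim (?P (Suc (Suc n)))) zmx"
        unfolding mvec_mmul m mvec_mat_of_Hom[OF f] mvec_zmx
        by (rule ext) (use C(9)[of "Suc n"] Hom_lin(3)[OF h] in simp)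
    qed (use F dwf[of "Suc n"] in \<open>auto simp only: is_hom_def\<close>)
    with assms(2) res F obtain g where g: "is_hom A (?P n) N g"
      "?F = mmul (mdim (?P n)) g (mat_of (mdim (?P (Suc n))) (?d (Suc n)))"
      unfolding ext_zero_def diff_Suc_1 by blast
    let ?g = "mvec (mdim (?P n)) g"
    have "mvec (mdim (?P (Suc n))) ?F = mvec (mdim (?P (Suc n))) (mmul (mdim (?P n)) g (mat_of (mdim (?P (Suc n))) (?d (Suc n))))"
      by (simp only: g(2))
    then have "?f = ?g \<circ> ?d (Suc n)"
      unfolding mvec_mmul m mvec_mat_of_Hom[OF f] .
    then have "?g \<circ> syz (?M n) \<circ> cov (?M (Suc n)) = h \<circ> cov (?M (Suc n))"
      by (simp add: comp_assoc)
    then have "?g \<circ> syz (?M n) = h"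
      by (rule epic_cancel[OF cv ep Hom_comp[OF Hom_of_hom[OF g(1)] C(4)] h])
    then show "\<exists>h'\<in>Hom (?P n) N. h' \<circ> syz (?M n) = h" using Hom_of_hom[OF g(1)] by blast
  qed
qed

end

section \<open>Projective dimension read off from the vanishing of Ext\<close>

context fd_algebra_inj
begin

lemma ext_van_of_pd_le: "pd_le A M n \<Longrightarrow> ob N \<Longrightarrow> k \<ge> n \<Longrightarrow> ext_van k M N"
proof (induction n arbitrary: M k)
  case 0
  then show ?case using ext_van_proj pd_le_0_proj by blast
next
  case (Suc n)
  obtain K \<iota> P \<pi> where K: "ses K \<iota> P \<pi> M" "proj P" "pd_le A K n"
    using pd_le_SucE[OF Suc.prems(1)] .
  obtain j where j: "k = Suc j" "j \<ge> n" using Suc.prems(3) by (cases k) auto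
  show ?case
    unfolding j(1) using ext_van_left_quotient[OF K(1) Suc.prems(2) Suc.IH[OF K(3) Suc.prems(2) j(2)]] ext_van_proj[OF K(2)]
    by blast
qed

lemma pd_le_of_ext_van:
  assumes "ob M" "\<And>N. ob N \<Longrightarrow> ext_van n M N"
  shows "pd_le A M n"
proof (rule pd_le_of_proj_Syz[OF assms(1) proj_of_ext_van_Syz])
  show "ob ((Syz ^^ n) M)" using assms(1) by (rule ob_Syz_pow)
  then show "ext_van 0 ((Syz ^^ n) M) (Syz ((Syz ^^ n) M))"
    using assms(2)[OF ob_Syz[of "(Syz ^^ n) M"]] unfolding ext_van_Syz[of n] by blast
qed

text \<open>Let \<open>n\<close> be the exact projective dimension. The \<open>n\<close>-th syzygy
  is projective, hence a summand of a free module, so Ext^n(M,R) = 0 gives Ext^n of \<open>M\<close>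
  into that syzygy zero as well. This splits the cover of the preceding syzygy and contradicts
  minimality of \<open>n\<close>.\<close>

lemma pd_le_of_ext_van_R:
  assumes "finite_pd A M" "\<And>k. k \<ge> m \<Longrightarrow> ext_van k M R"
  shows "pd_le A M m"
proof -
  define n where "n = (LEAST n. pd_le A M n)"
  have n: "pd_le A M n"
    unfolding n_def using assms(1) by (auto simp: finite_pd_def intro: LeastI)
  then have M: "ob M" by (rule pd_le_ob)
  have "n \<le> m"
  proof (rule ccontr)
    assume "\<not> n \<le> m"
    then obtain j where j: "n = Suc j" "j \<ge> m" by (cases n) auto
    have "proj ((Syz ^^ n) M)"
    proof (rule proj_of_ext_van_Syz[OF ob_Syz_pow[OF M]])
      show "ext_van 0 ((Syz ^^ n) M) (Syz ((Syz ^^ n) M))"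
        using ext_van_of_pd_le[OF n ob_Syz[OF ob_Syz_pow[OF M]] order_refl] unfolding ext_van_Syz[of n] .
    qed
    then obtain r where "retract ((Syz ^^ n) M) (mpow R r)" using proj_retract_free by blast
    then have "ext_van j M ((Syz ^^ n) M)"
      using ext_van_retract_right ext_van_mpow_right[OF M ob_R assms(2)[OF j(2)]] by blast
    then have "proj ((Syz ^^ j) M)"
      using proj_of_ext_van_Syz[OF ob_Syz_pow[OF M]] unfolding j(1) ext_van_Syz[of j] by simp
    then have "pd_le A M j" by (rule pd_le_of_proj_Syz[OF M])
    then have "n \<le> j" unfolding n_def by (rule Least_le)
    with j(1) show False by simp
  qed
  then show ?thesis by (rule pd_le_mono[OF n])
qed

lemma ext_van_Add_right: "ob T \<Longrightarrow> in_Add A T X \<Longrightarrow> ob M \<Longrightarrow> ext_van k M T \<Longrightarrow> ext_van k M X"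
  using in_Add_iff ext_van_retract_right ext_van_mpow_right by blast

lemma ext_van_Add_left: "ob T \<Longrightarrow> in_Add A T X \<Longrightarrow> ob N \<Longrightarrow> ext_van k T N \<Longrightarrow> ext_van k X N"
  using in_Add_iff ext_van_retract_left ext_van_mpow_left ob_mpow by blast

end

section \<open>Indecomposable modules\<close>

context fd_algebra
begin

lemma vecs_Suc: "v n = 0 \<Longrightarrow> v \<in> vecs (Suc n) \<Longrightarrow> v \<in> vecs n"
  unfolding mem_vecs by (metis Suc_leI le_neq_implies_less)

text \<open>A vector \<open>w\<close> outside the image could be assigned to one additional
  coordinate, which would embed a space of dimension \<open>mdim M + 1\<close> into
  \<open>N\<close>.\<close>

lemma mdim_eq_epic:
  assumes "\<phi> \<in> Hom M N" "monic M \<phi>" "mdim M = mdim N"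
  shows "epic N \<phi>"
proof (rule ccontr)
  assume "\<not> epic N \<phi>"
  then obtain w where w: "w \<in> car N" "\<And>v. \<phi> v \<noteq> w" by (auto simp: epic_def)
  let ?m = "mdim M"
  let ?\<psi> = "\<lambda>v. \<phi> v + scl (v ?m) w"
  have "Suc ?m \<le> mdim N"
  proof (rule lin_inj_dim_le)
    show "lin ?\<psi>"
      by (intro linI) (simp_all add: Hom_lin[OF assms(1)] vec_apply vs.scale_left_distrib vs.scale_right_distrib algebra_simps)
    show "?\<psi> v \<in> vecs (mdim N)" for v
      by (intro vs.subspace_add vs.subspace_scale subspace_vecs w HomD(3)[OF assms(1)])
    show "v = 0" if v: "v \<in> vecs (Suc ?m)" "?\<psi> v = 0" for v
    proof -
      have c: "v ?m = 0"
      proof (rule ccontr)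
        assume c: "v ?m \<noteq> 0"
        have "\<phi> v = - scl (v ?m) w" using v(2) by (simp add: eq_neg_iff_add_eq_0)
        then have "\<phi> (scl (- inverse (v ?m)) v) = scl (- inverse (v ?m)) (- scl (v ?m) w)"
          by (simp only: Hom_lin(2)[OF assms(1)])
        also have "\<dots> = w" using c by simp
        finally show False using w(2) by blast
      qed
      then have "v \<in> car M" using v(1) by (rule_tac vecs_Suc)
      moreover have "\<phi> v = 0" using v(2) c by simp
      ultimately show ?thesis using assms(2) by (simp add: monic_def)
    qed
  qed
  then show False using assms(3) by simp
qed

text \<open>A nonzero kernel vector \<open>u\<close>, placed on an additional coordinate next to a
  linear section, would embed a space of dimension \<open>mdim N + 1\<close> into
  \<open>M\<close>.\<close>

lemma mdim_eq_monic:
  assumes "\<phi> \<in> Hom M N" "epic N \<phi>" "mdim M = mdim N"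
  shows "monic M \<phi>"
  unfolding monic_def
proof (intro ballI impI, rule ccontr)
  fix u assume u: "u \<in> car M" "\<phi> u = 0" "u \<noteq> 0"
  from vp.linear_exists_right_inverse_on[OF HomD(1)[OF assms(1)] vs.subspace_UNIV]
  obtain \<sigma> where s: "lin \<sigma>" "\<And>w. w \<in> range \<phi> \<Longrightarrow> \<phi> (\<sigma> w) = w" by blast
  let ?n = "mdim N"
  let ?\<psi> = "\<lambda>v. one M (\<sigma> (one N v)) + scl (v ?n) u"
  have "Suc ?n \<le> mdim M"
  proof (rule lin_inj_dim_le)
    show "lin ?\<psi>"
      by (intro linI) (simp_all add: lin_simps[OF s(1)] lin_simps[OF lin_trunc] vec_apply
          vs.scale_left_distrib vs.scale_right_distrib algebra_simps)
    show "?\<psi> v \<in> vecs (mdim M)" for v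
      by (intro vs.subspace_add vs.subspace_scale subspace_vecs u trunc_in_vecs)
    show "v = 0" if v: "v \<in> vecs (Suc ?n)" "?\<psi> v = 0" for v
    proof -
      have "one N v \<in> range \<phi>" using assms(2) trunc_in_vecs unfolding epic_def by (metis rangeI)
      then have "\<phi> (?\<psi> v) = one N v"
        using s(2) by (simp add: Hom_lin[OF assms(1)] HomD(2)[OF assms(1)] u(2))
      then have z: "one N v = 0" using v(2) by (simp add: Hom_lin[OF assms(1)])
      then have "scl (v ?n) u = 0"
        using v(2) by (simp add: lin_simps[OF s(1)] lin_simps[OF lin_trunc])
      then have "v ?n = 0" using u(3) by simp
      then have "v \<in> car N" using v(1) by (rule_tac vecs_Suc)
      then show ?thesis using z by (simp add: trunc_vecs)
    qed
  qed
  then show False using assms(3) by simp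
qed

section \<open>Isomorphism invariance, split sequences and direct decompositions\<close>

lemma isom_mdim:
  assumes "isom M N"
  shows "mdim M = mdim N"
proof -
  obtain f g where f: "f \<in> Hom M N" "g \<in> Hom N M" "g \<circ> f = one M" "f \<circ> g = one N" by (rule isomE[OF assms])
  show ?thesis
    using mdim_monic[OF f(1) retract_monic[OF f(1,2,3)]] mdim_monic[OF f(2) retract_monic[OF f(2,1,4)]] by simp
qed

lemma isom_zero: "mdim M = 0 \<Longrightarrow> mdim N = 0 \<Longrightarrow> isom M N"
  by (rule isomI[OF Hom_zero Hom_zero])
    (auto simp: fun_eq_iff[where f = "_ \<circ> _"] simp flip: one_zero_iff)

lemma isom_refl: "ob M \<Longrightarrow> isom M M"
  by (rule isomI[OF Hom_one Hom_one]) (auto simp: fun_eq_iff[where f = "_ \<circ> _"])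

lemma isom_split_ses:
  assumes S: "ses X f Y g Z" "s \<in> Hom Z Y" "g \<circ> s = one Z"
    and S': "ses X' f' Y' g' Z'" "s' \<in> Hom Z' Y'" "g' \<circ> s' = one Z'"
    and i: "isom X X'" "isom Z Z'"
  shows "isom Y Y'"
proof -
  obtain a a' where a: "a \<in> Hom X X'" "a' \<in> Hom X' X" "a' \<circ> a = one X" "a \<circ> a' = one X'"
    by (rule isomE[OF i(1)])
  obtain c c' where c: "c \<in> Hom Z Z'" "c' \<in> Hom Z' Z" "c' \<circ> c = one Z" "c \<circ> c' = one Z'"
    by (rule isomE[OF i(2)])
  obtain b b' where "b \<in> Hom Y Y'" "b' \<in> Hom Y' Y" "b' \<circ> b = one Y" "b \<circ> b' = one Y'"
    by (rule ses_split_iso[OF S S' a c])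
  then show ?thesis by (rule isomI)
qed

lemma isom_dsum_of_split_ses:
  assumes "ses X f Y g Z" "s \<in> Hom Z Y" "g \<circ> s = one Z"
  shows "isom Y (dsum X Z)"
proof -
  note D = sesD[OF assms(1)]
  have "prr X Z \<circ> inr X Z = one Z" by (rule ext) (simp add: biproduct_apply)
  then show ?thesis
    by (rule isom_split_ses[OF assms ses_dsum[OF D(1,3)] biproduct_Hom(2)[OF D(1,3)]])
      (simp_all add: isom_refl D)
qed

lemma ses_flip:
  assumes S: "ses X f Y g Z" "s \<in> Hom Z Y" "g \<circ> s = one Z"
  obtains r where "ses Z s Y r X" "r \<circ> f = one X"
proof -
  note D = sesD[OF S(1)]
  obtain r where r: "r \<in> Hom Y X" "r \<circ> f = one X" "r \<circ> s = 0" "f \<circ> r = one Y - (s \<circ> g)"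
    by (rule ses_retraction[OF S])
  have "r v = 0 \<longleftrightarrow> (\<exists>u. s u = v)" if v: "v \<in> car Y" for v
  proof
    assume "r v = 0"
    then have "s (g v) = v"
      using fun_cong[OF r(4), of v] by (simp add: Hom_lin[OF D(4)] trunc_vecs[OF v])
    then show "\<exists>u. s u = v" by blast
  next
    assume "\<exists>u. s u = v"
    then show "r v = 0" using fun_cong[OF r(3)] by auto
  qed
  then have "ses Z s Y r X"
    unfolding ses_def using D r(1) S(2) retract_monic[OF S(2) D(5) S(3)] retract_epic[OF r(2)] by blast
  with r(2) show ?thesis by (rule_tac that)
qed

text \<open>The decomposition is returned as a split sequence together with its reverse: both ends
  are then visibly retracts of \<open>X\<close>, and the reverse has the shape of the dual of the
  original.\<close>

lemma decomposition:
  assumes X: "ob X" "mdim X \<noteq> 0" "\<not> indecomposable A X"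
  obtains Y Z f g s r where "ses Y f X g Z" "s \<in> Hom Z X" "g \<circ> s = one Z" "ses Z s X r Y" "r \<circ> f = one Y"
    "mdim Y < mdim X" "mdim Z < mdim X" "mdim Y \<noteq> 0"
proof -
  obtain Y Z where YZ: "ob Y" "ob Z" "mdim Y \<noteq> 0" "mdim Z \<noteq> 0" "is_iso A X (dsum Y Z)"
    using X unfolding indecomposable_def by blast
  then have i: "isom X (dsum Y Z)" using isom_iff[OF X(1) ob_dsum] by blast
  then obtain a a' where a: "a \<in> Hom X (dsum Y Z)" "a' \<in> Hom (dsum Y Z) X" "a' \<circ> a = one X" "a \<circ> a' = one (dsum Y Z)"
    by (rule isomE)
  have aa: "a (a' v) = one (dsum Y Z) v" "a' (a v) = one X v" for v
    using fun_cong[OF a(4), of v] fun_cong[OF a(3), of v] by auto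
  have dim: "mdim X = mdim Y + mdim Z" using isom_mdim[OF i] by simp
  note B = biproduct_Hom[OF YZ(1,2)] and D = ses_dsum[OF YZ(1,2)]
  let ?f = "a' \<circ> inl Y" and ?g = "prr Y Z \<circ> a" and ?s = "a' \<circ> inr Y Z"
  have hs: "?f \<in> Hom Y X" "?g \<in> Hom X Z" "?s \<in> Hom Z X"
    using Hom_comp[OF a(2) B(1)] Hom_comp[OF B(4) a(1)] Hom_comp[OF a(2) B(2)] by auto
  have gs: "?g \<circ> ?s = one Z"
    by (rule ext) (simp add: aa Hom_one_left[OF B(2), simplified] biproduct_apply)
  have rf: "(prl Y \<circ> a) \<circ> ?f = one Y"
    by (rule ext) (simp add: aa Hom_one_left[OF B(1), simplified] biproduct_apply)
  have "ses Y ?f X ?g Z"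
    unfolding ses_def
  proof (intro conjI ballI X YZ hs)
    show "monic Y ?f" by (rule retract_monic[OF hs(1) Hom_comp[OF B(3) a(1)] rf])
    show "epic Z ?g" by (rule retract_epic[OF gs])
    show "?g v = 0 \<longleftrightarrow> (\<exists>u. ?f u = v)" if v: "v \<in> car X" for v
    proof
      assume "?g v = 0"
      then obtain u where "inl Y u = a v"
        using ses_exact[OF D HomD(3)[OF a(1)]] by auto
      then have "?f u = v" using aa(2)[of v] trunc_vecs[OF v] by simp
      then show "\<exists>u. ?f u = v" by blast
    qed (auto simp: aa Hom_one_left[OF B(1), simplified] biproduct_apply)
  qed
  moreover from ses_flip[OF this hs(3) gs] obtain r where "ses Z ?s X r Y" "r \<circ> ?f = one Y" .
  ultimately show ?thesis using hs(3) gs dim YZ(3,4) by (intro that[of Y ?f ?g Z ?s r]) auto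
qed

lemma exists_indecomposable_retract: "ob Y \<Longrightarrow> mdim Y \<noteq> 0 \<Longrightarrow> \<exists>Q. indecomposable A Q \<and> retract Q Y"
proof (induction "mdim Y" arbitrary: Y rule: less_induct)
  case less
  show ?case
  proof (cases "indecomposable A Y")
    case True
    then show ?thesis using isom_retract[OF isom_refl[OF less.prems(1)]] by blast
  next
    case False
    obtain Z W f g s r where Z: "ses Z f Y g W" "ses W s Y r Z" "r \<circ> f = one Z" "mdim Z < mdim Y" "mdim Z \<noteq> 0"
      by (rule decomposition[OF less.prems False])
    then obtain Q where "indecomposable A Q" "retract Q Z"
      using less.hyps[OF Z(4) sesD(1)[OF Z(1)] Z(5)] by blast
    moreover have "retract Z Y" by (rule retractI[OF sesD(4)[OF Z(1)] sesD(5)[OF Z(2)] Z(3)])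
    ultimately show ?thesis using retract_trans by blast
  qed
qed

text \<open>Positive exponents only: \<open>f ^^ 0\<close> is the identity on all sequences, while
  the identity morphism of \<open>Q\<close> is \<open>one Q\<close>.\<close>

lemma Hom_funpow: "f \<in> Hom Q Q \<Longrightarrow> f ^^ Suc n \<in> Hom Q Q"
proof (induction n)
  case (Suc n)
  then have "f \<circ> f ^^ Suc n \<in> Hom Q Q" by (intro Hom_comp)
  then show ?case by (simp only: funpow.simps)
qed simp

text \<open>Fitting's lemma: the image of a power \<open>h\<close> of \<open>f\<close> of minimal dimension satisfies
  \<open>range h = range (h \<circ> h)\<close> and hence is a direct summand.\<close>
lemma indecomposable_local:
  assumes Q: "indecomposable A Q" and f: "f \<in> Hom Q Q" and g: "g \<in> Hom Q Q" and fg: "f + g = one Q"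
  shows "(\<exists>k\<in>Hom Q Q. f \<circ> k = one Q \<and> k \<circ> f = one Q) \<or> (\<exists>k\<in>Hom Q Q. g \<circ> k = one Q \<and> k \<circ> g = one Q)"
proof -
  have ob: "ob Q" using Q by (simp add: indecomposable_def)
  have inv: "\<exists>k\<in>Hom Q Q. e \<circ> k = one Q \<and> k \<circ> e = one Q" if "e \<in> Hom Q Q" "monic Q e \<or> epic Q e" for e
  proof -
    have "monic Q e" "epic Q e" using that mdim_eq_epic[OF that(1)] mdim_eq_monic[OF that(1)] by auto
    from mdim_bij[OF that(1) this ob ob] show ?thesis by metis
  qed
  let ?img = "\<lambda>n I \<iota>. ob I \<and> \<iota> \<in> Hom I Q \<and> monic I \<iota> \<and> range \<iota> = range (f ^^ Suc n)"
  define d where "d = (LEAST d. \<exists>n I \<iota>. ?img n I \<iota> \<and> mdim I = d)"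
  have ex: "\<exists>I \<iota>. ?img n I \<iota>" for n
    using exists_image[OF ob Hom_funpow[OF f, of n]] by metis
  then have "\<exists>d n I \<iota>. ?img n I \<iota> \<and> mdim I = d" by blast
  then have "\<exists>n I \<iota>. ?img n I \<iota> \<and> mdim I = d" unfolding d_def by (rule LeastI_ex)
  then obtain n I \<iota> where I: "?img n I \<iota>" "mdim I = d" by blast
  have dmin: "d \<le> mdim J" if "?img m J j" for m J j
    unfolding d_def using that by (intro Least_le) blast
  define h where "h = f ^^ Suc n"
  have h: "h \<in> Hom Q Q" unfolding h_def by (rule Hom_funpow[OF f])
  have ran: "range \<iota> = range h" using I(1) unfolding h_def by blast
  obtain J j where J: "?img (n + Suc n) J j" using ex by blast
  have "f ^^ Suc (n + Suc n) = h \<circ> h"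
    unfolding h_def using funpow_add[of "Suc n" "Suc n" f] by simp
  then have hh: "j v \<in> range (h \<circ> h)" for v using J by (metis rangeI)
  have "\<exists>u. \<iota> u = j v" for v
  proof -
    have "j v \<in> range \<iota>" using hh[of v] ran by auto
    then show ?thesis by (metis rangeE)
  qed
  then obtain \<kappa> where k: "\<kappa> \<in> Hom J I" "\<iota> \<circ> \<kappa> = j"
    using factor_monic[of \<iota> I Q J j] I J by blast
  have mk: "monic J \<kappa>"
    unfolding monic_def
  proof (intro ballI impI)
    fix v assume v: "v \<in> car J" "\<kappa> v = 0"
    have "j v = 0" using fun_cong[OF k(2), of v] v(2) Hom_lin(3) I(1) by auto
    then show "v = 0" using J v(1) by (simp add: monic_def)
  qed
  \<comment> \<open>The image of \<open>h \<circ> h\<close> lies in that of \<open>h\<close> and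
    cannot be smaller, by the choice of \<open>d\<close>; hence the two images coincide.\<close>
  have "mdim J = mdim I" using mdim_monic[OF k(1) mk] dmin[OF J] I(2) by simp
  then have ek: "epic I \<kappa>" by (rule mdim_eq_epic[OF k(1) mk])
  have "\<exists>u. \<iota> u = h v" for v using ran by (metis rangeE rangeI)
  then obtain e where e: "e \<in> Hom Q I" "\<iota> \<circ> e = h"
    using factor_monic[of \<iota> I Q Q h] I(1) ob h by blast
  have ie: "\<iota> (e v) = h v" for v using fun_cong[OF e(2), of v] by simp
  \<comment> \<open>Since \<open>h\<close> maps its own image onto itself, its restriction there is
    invertible; this yields a retraction of \<open>Q\<close> onto the image.\<close>
  have "epic I (e \<circ> \<iota>)"
    unfolding epic_def
  proof
    fix i assume i: "i \<in> car I"
    then obtain v where "\<kappa> v = i" using ek by (auto simp: epic_def)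
    then have "\<iota> i = j v" using fun_cong[OF k(2), of v] by auto
    moreover note hh[of v]
    ultimately obtain q where "\<iota> i = h (h q)" by auto
    then have "\<iota> i = \<iota> (e (\<iota> (e q)))" by (simp only: ie)
    then have "e (\<iota> (e q)) = i"
      using monicD[of I \<iota> Q] I(1) i HomD(3)[OF e(1)] by metis
    then show "\<exists>v. (e \<circ> \<iota>) v = i" by auto
  qed
  moreover have ei: "e \<circ> \<iota> \<in> Hom I I" using Hom_comp[OF e(1)] I(1) by blast
  ultimately obtain u where u: "u \<in> Hom I I" "u \<circ> (e \<circ> \<iota>) = one I"
    using mdim_bij[OF ei mdim_eq_monic[OF ei]] I(1) by blast
  then have ret: "(u \<circ> e) \<circ> \<iota> = one I" by (simp add: comp_assoc)
  obtain C c where C: "ses I \<iota> Q c C" using ses_of_monic[of I Q \<iota>] I(1) ob by blast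
  obtain s where s: "s \<in> Hom C Q" "c \<circ> s = one C"
    by (rule ses_section[OF C Hom_comp[OF u(1) e(1)] ret])
  have "is_iso A Q (dsum I C)"
    using isom_dsum_of_split_ses[OF C s] isom_iff[OF ob ob_dsum] sesD(1,3)[OF C] by blast
  then have "mdim I = 0 \<or> mdim C = 0"
    using Q sesD(1,3)[OF C] unfolding indecomposable_def by blast
  then show ?thesis
  proof
    assume "mdim I = 0"
    then have h0: "h = 0" using e(2) I(1) Hom_from_zero[of I \<iota> Q] by (auto simp: fun_eq_iff[where f = "_ \<circ> _"])
    \<comment> \<open>Here \<open>f\<close> is nilpotent. On the kernel of \<open>g\<close> it acts
      as the identity, so that kernel is zero.\<close>
    have "monic Q g"
      unfolding monic_def
    proof (intro ballI impI)
      fix v assume v: "v \<in> car Q" "g v = 0"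
      then have fv: "f v = v" using fun_cong[OF fg, of v] by (simp add: trunc_vecs)
      have "(f ^^ m) v = v" for m by (induction m) (simp_all add: fv)
      from this[of "Suc n"] show "v = 0" using fun_cong[OF h0, of v] unfolding h_def by simp
    qed
    then show ?thesis using inv[OF g] by blast
  next
    assume C0: "mdim C = 0"
    have "epic Q f"
      unfolding epic_def
    proof
      fix w assume w: "w \<in> car Q"
      have "c w = 0" using Hom_to_zero[OF C0 sesD(5)[OF C]] by simp
      then obtain i where "\<iota> i = w" using ses_exact[OF C w] by blast
      then have "w \<in> range h" using ran by blast
      then show "\<exists>v. f v = w" by (auto simp: h_def)
    qed
    then show ?thesis using inv[OF f] by blast
  qed
qed

end

section \<open>The duality\<close>

locale algebra_duality = fd_algebra A for A :: "'k::field alg" +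
  fixes Fo :: "'k modl \<Rightarrow> 'k modl" and Fm :: "'k modl \<Rightarrow> 'k modl \<Rightarrow> 'k mx \<Rightarrow> 'k mx"
  assumes dual: "is_duality A Fo Fm"
begin

definition D :: "'k modl \<Rightarrow> 'k modl \<Rightarrow> ((nat \<Rightarrow> 'k) \<Rightarrow> nat \<Rightarrow> 'k) \<Rightarrow> (nat \<Rightarrow> 'k) \<Rightarrow> nat \<Rightarrow> 'k" where
  "D M N \<phi> = mvec (mdim (Fo N)) (Fm M N (mat_of (mdim M) \<phi>))"

lemma D_ob: "ob M \<Longrightarrow> ob (Fo M)"
  using dual by (simp add: is_duality_def)

lemma Fm_hom: "ob M \<Longrightarrow> ob N \<Longrightarrow> is_hom A M N f \<Longrightarrow> is_hom A (Fo N) (Fo M) (Fm M N f)"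
  using dual unfolding is_duality_def by blast

lemma D_Hom: "ob M \<Longrightarrow> ob N \<Longrightarrow> \<phi> \<in> Hom M N \<Longrightarrow> D M N \<phi> \<in> Hom (Fo N) (Fo M)"
  unfolding D_def by (intro Hom_of_hom Fm_hom hom_of_Hom)

lemma D_one: "ob M \<Longrightarrow> D M M (one M) = one (Fo M)"
proof -
  assume M: "ob M"
  have "mat_of (mdim M) (one M) = idm (mdim M)"
    using mat_of_mvec[OF mat_wf_idm] by (simp add: mvec_idm)
  moreover have "Fm M M (idm (mdim M)) = idm (mdim (Fo M))"
    using dual M unfolding is_duality_def by blast
  ultimately show ?thesis by (simp add: D_def mvec_idm)
qed

lemma D_comp:
  assumes "ob L" "ob M" "ob N" "f \<in> Hom L M" "g \<in> Hom M N"
  shows "D L N (g \<circ> f) = D L M f \<circ> D M N g"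
proof -
  let ?f = "mat_of (mdim L) f" and ?g = "mat_of (mdim M) g"
  have h: "is_hom A L M ?f" "is_hom A M N ?g" using assms by (auto intro: hom_of_Hom)
  have "mat_of (mdim L) (g \<circ> f) = mmul (mdim M) ?g ?f"
  proof (rule mat_wf_eqI)
    show "mat_wf (mdim N) (mdim L) (mat_of (mdim L) (g \<circ> f))"
      using hom_of_Hom[OF Hom_comp[OF assms(5,4)] assms(1,3)] by (simp add: is_hom_def)
    show "mat_wf (mdim N) (mdim L) (mmul (mdim M) ?g ?f)" using h by (auto simp: is_hom_def intro: mat_wf_mmul)
    show "mvec (mdim L) (mat_of (mdim L) (g \<circ> f)) = mvec (mdim L) (mmul (mdim M) ?g ?f)"
      by (simp add: mvec_mmul mvec_mat_of_Hom[OF Hom_comp[OF assms(5,4)]] mvec_mat_of_Hom[OF assms(4)] mvec_mat_of_Hom[OF assms(5)])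
  qed
  moreover have "Fm L N (mmul (mdim M) ?g ?f) = mmul (mdim (Fo M)) (Fm L M ?f) (Fm M N ?g)"
    using dual assms(1-3) h unfolding is_duality_def by blast
  ultimately show ?thesis by (simp add: D_def mvec_mmul)
qed

lemma D_ses:
  assumes "ses X f Y g Z"
  shows "ses (Fo Z) (D Y Z g) (Fo Y) (D X Y f) (Fo X)"
proof -
  note S = sesD[OF assms]
  let ?f = "mat_of (mdim X) f" and ?g = "mat_of (mdim Y) g"
  have h: "is_hom A X Y ?f" "is_hom A Y Z ?g" using S by (auto intro: hom_of_Hom)
  have m: "mvec (mdim X) ?f = f" "mvec (mdim Y) ?g = g" using S mvec_mat_of_Hom by blast+
  have "inj_map (mdim X) ?f" "surj_map (mdim Y) (mdim Z) ?g" "exact_at (mdim X) (mdim Y) ?f ?g"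
    unfolding inj_map_iff surj_map_iff exact_at_iff m using assms by (auto simp: ses_def)
  then have "inj_map (mdim (Fo Z)) (Fm Y Z ?g) \<and> surj_map (mdim (Fo Y)) (mdim (Fo X)) (Fm X Y ?f) \<and>
     exact_at (mdim (Fo Z)) (mdim (Fo Y)) (Fm Y Z ?g) (Fm X Y ?f)"
    using dual S(1-3) h unfolding is_duality_def by blast
  then show ?thesis
    unfolding ses_def inj_map_iff surj_map_iff exact_at_iff D_def[symmetric]
    using D_ob D_Hom S by simp
qed

lemma D_inject:
  assumes "ob M" "ob N" "\<phi> \<in> Hom M N" "\<psi> \<in> Hom M N" "D M N \<phi> = D M N \<psi>"
  shows "\<phi> = \<psi>"
proof -
  let ?f = "mat_of (mdim M) \<phi>" and ?g = "mat_of (mdim M) \<psi>"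
  have h: "is_hom A M N ?f" "is_hom A M N ?g" using assms by (auto intro: hom_of_Hom)
  have "Fm M N ?f = Fm M N ?g"
    using hom_eqI[OF Fm_hom[OF assms(1,2) h(1)] Fm_hom[OF assms(1,2) h(2)]] assms(5) by (simp add: D_def)
  moreover have "inj_on (Fm M N) {f. is_hom A M N f}"
    using dual assms(1,2) unfolding is_duality_def bij_betw_def by blast
  ultimately have "?f = ?g" using h by (auto dest: inj_onD)
  then show ?thesis using mvec_mat_of_Hom[OF assms(3)] mvec_mat_of_Hom[OF assms(4)] by metis
qed

lemma D_full:
  assumes "ob M" "ob N" "\<psi> \<in> Hom (Fo N) (Fo M)"
  obtains \<phi> where "\<phi> \<in> Hom M N" "D M N \<phi> = \<psi>"
proof -
  have "bij_betw (Fm M N) {f. is_hom A M N f} {g. is_hom A (Fo N) (Fo M) g}"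
    using dual assms(1,2) unfolding is_duality_def by blast
  moreover have "is_hom A (Fo N) (Fo M) (mat_of (mdim (Fo N)) \<psi>)"
    using assms D_ob by (intro hom_of_Hom)
  ultimately obtain f where f: "is_hom A M N f" "Fm M N f = mat_of (mdim (Fo N)) \<psi>"
    unfolding bij_betw_def by (metis (mono_tags, lifting) imageE mem_Collect_eq)
  have "D M N (mvec (mdim M) f) = \<psi>"
    by (simp add: D_def mat_of_mvec_hom[OF f(1)] f(2) mvec_mat_of_Hom[OF assms(3)])
  with Hom_of_hom[OF f(1)] show ?thesis by (rule that)
qed

lemma D_dense:
  assumes "ob N"
  obtains M where "ob M" "isom N (Fo M)"
proof -
  have "\<forall>N. ob N \<longrightarrow> (\<exists>M. ob M \<and> is_iso A N (Fo M))"
    using dual unfolding is_duality_def by (elim conjE)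
  then obtain M where M: "ob M" "is_iso A N (Fo M)" using assms by blast
  then have "isom N (Fo M)" by (simp add: isom_iff[OF assms D_ob[OF M(1)]])
  with M(1) show ?thesis by (rule that)
qed

text \<open>Additivity is not among the axioms of \<open>is_duality\<close>, so exactness must
  detect zero: two consecutive identities of \<open>Z\<close> form a short exact sequence when
  \<open>Z\<close> is zero, and the dual sequence makes the identity of \<open>Fo Z\<close>
  vanish.\<close>

lemma D_mdim_zero:
  assumes Z: "ob Z" "mdim Z = 0"
  shows "mdim (Fo Z) = 0"
proof -
  have "ses Z (one Z) Z (one Z) Z"
    unfolding ses_def using Z Hom_one[OF Z(1)] car_zero[OF Z(2)] one_zero_iff[of Z]
    by (auto simp: monic_def epic_def)
  from sesD(8)[OF D_ses[OF this]] have "one (Fo Z) \<circ> one (Fo Z) = 0" by (simp add: D_one[OF Z(1)])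
  then have "one (Fo Z) = 0" by (simp add: Hom_one_comp[OF Hom_one[OF D_ob[OF Z(1)]]])
  then show ?thesis by (simp add: one_zero_iff)
qed

text \<open>The zero map factors through the zero module, whose dual is zero.\<close>

lemma D_zero:
  assumes "ob M" "ob N"
  shows "D M N 0 = 0"
proof -
  have "(0 :: (nat \<Rightarrow> 'k) \<Rightarrow> nat \<Rightarrow> 'k) \<circ> (0 :: (nat \<Rightarrow> 'k) \<Rightarrow> nat \<Rightarrow> 'k) = 0" by (rule ext) simp
  then have "D M N 0 = D M zmod 0 \<circ> D zmod N 0"
    using D_comp[OF assms(1) ob_zmod assms(2) Hom_zero Hom_zero] by simp
  also have "D zmod N 0 = 0"
    by (rule Hom_to_zero[OF D_mdim_zero[OF ob_zmod mdim_zmod] D_Hom[OF ob_zmod assms(2) Hom_zero]])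
  also have "D M zmod 0 \<circ> (0 :: (nat \<Rightarrow> 'k) \<Rightarrow> nat \<Rightarrow> 'k) = 0"
    by (rule ext) (simp add: Hom_lin[OF D_Hom[OF assms(1) ob_zmod Hom_zero]])
  finally show ?thesis .
qed

text \<open>With \<open>c\<close> the cokernel of \<open>f\<close>, both \<open>D M N f\<close> and
  \<open>D N C c\<close> are injective and their composite is zero, so \<open>Fo C\<close> is zero.
  Faithfulness then gives \<open>C = 0\<close>.\<close>

lemma D_reflects_epic:
  assumes "ob M" "ob N" "f \<in> Hom M N" "monic (Fo N) (D M N f)"
  shows "epic N f"
proof -
  obtain C c where C: "ob C" "c \<in> Hom N C" "epic C c" "\<And>v. v \<in> car N \<Longrightarrow> c v = 0 \<longleftrightarrow> (\<exists>u. f u = v)"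
    by (rule exists_cokernel[OF assms(2,3)], rule that)
  obtain K k where K: "ses K k N c C" by (rule ses_of_epic[OF assms(2) C(1-3)])
  note S = sesD[OF D_ses[OF K]]
  have "c \<circ> f = 0"
    by (rule ext) (use C(4)[OF HomD(3)[OF assms(3)]] in auto)
  then have z: "D M N f \<circ> D N C c = 0"
    using D_comp[OF assms(1,2) C(1) assms(3) C(2)] D_zero[OF assms(1) C(1)] by simp
  have "one (Fo C) v = 0" for v
  proof -
    have "D M N f (D N C c (one (Fo C) v)) = 0" using fun_cong[OF z] by simp
    then have "D N C c (one (Fo C) v) = 0"
      using assms(4) HomD(3)[OF S(4)] by (simp add: monic_def)
    then show ?thesis using S(6) by (simp add: monic_def)
  qed
  then have "one (Fo C) = 0" by (intro ext[where g = 0]) simp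
  then have "D C C (one C) = D C C 0" by (simp add: D_one[OF C(1)] D_zero[OF C(1,1)])
  then have "one C = 0" by (rule D_inject[OF C(1,1) Hom_one[OF C(1)] Hom_zero])
  then have "mdim C = 0" by (simp add: one_zero_iff)
  then have "c = 0" using Hom_to_zero[OF _ C(2)] by blast
  then show ?thesis using C(4) by (simp add: epic_def)
qed

text \<open>Density and fullness turn an extension problem into \<open>Fo P\<close> into a lifting
  problem out of \<open>P\<close> along an epimorphism.\<close>

lemma D_proj_inj:
  assumes "proj P"
  shows "inj_mod (Fo P)"
  unfolding inj_mod_def
proof (intro conjI allI impI)
  have P: "ob P" using assms by (simp add: proj_def)
  then show "ob (Fo P)" by (rule D_ob)
  fix X Y f h
  assume X: "ob X" and Y: "ob Y" and f: "f \<in> Hom X Y" "monic X f" and h: "h \<in> Hom X (Fo P)"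
  obtain X' where X': "ob X'" "isom X (Fo X')" by (rule D_dense[OF X])
  obtain Y' where Y': "ob Y'" "isom Y (Fo Y')" by (rule D_dense[OF Y])
  obtain a a' where a: "a \<in> Hom X (Fo X')" "a' \<in> Hom (Fo X') X" "a' \<circ> a = one X" "a \<circ> a' = one (Fo X')"
    by (rule isomE[OF X'(2)])
  obtain b b' where b: "b \<in> Hom Y (Fo Y')" "b' \<in> Hom (Fo Y') Y" "b' \<circ> b = one Y" "b \<circ> b' = one (Fo Y')"
    by (rule isomE[OF Y'(2)])
  obtain f' where f': "f' \<in> Hom Y' X'" "D Y' X' f' = b \<circ> f \<circ> a'"
    by (rule D_full[OF Y'(1) X'(1) Hom_comp[OF Hom_comp[OF b(1) f(1)] a(2)]])
  obtain h' where h': "h' \<in> Hom P X'" "D P X' h' = h \<circ> a'"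
    by (rule D_full[OF P X'(1) Hom_comp[OF h a(2)]])
  have "monic (Fo X') (D Y' X' f')"
    unfolding f'(2) monic_def
  proof (intro ballI impI)
    fix v assume v: "v \<in> car (Fo X')" "(b \<circ> f \<circ> a') v = 0"
    have "f (a' v) = 0"
      using v(2) retract_monic[OF b(1,2,3)] HomD(3)[OF f(1)] by (simp add: monic_def)
    then have "a' v = 0" using f(2) HomD(3)[OF a(2)] by (simp add: monic_def)
    then show "v = 0" using retract_monic[OF a(2,1,4)] v(1) by (simp add: monic_def)
  qed
  then have "epic X' f'" by (rule D_reflects_epic[OF Y'(1) X'(1) f'(1)])
  then obtain k where k: "k \<in> Hom P Y'" "f' \<circ> k = h'"
    by (rule projD[OF assms f'(1) _ h'(1) Y'(1) X'(1)])
  have "D P Y' k \<circ> (b \<circ> f \<circ> a') = h \<circ> a'"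
    using D_comp[OF P Y'(1) X'(1) k(1) f'(1)] k(2) f'(2) h'(2) by simp
  then have "(D P Y' k \<circ> b \<circ> f) \<circ> (a' \<circ> a) = h \<circ> (a' \<circ> a)" by (metis comp_assoc)
  moreover have "D P Y' k \<circ> b \<in> Hom Y (Fo P)" by (rule Hom_comp[OF D_Hom[OF P Y'(1) k(1)] b(1)])
  ultimately show "\<exists>h'\<in>Hom Y (Fo P). h' \<circ> f = h"
    using a(3) Hom_comp_one[OF h] Hom_comp_one[OF Hom_comp[OF _ f(1)]] by metis
qed

lemma D_enough_inj:
  assumes "ob N"
  shows "\<exists>I j q S. inj_mod I \<and> ses N j I q S"
proof -
  obtain M where M: "ob M" "isom N (Fo M)" by (rule D_dense[OF assms])
  obtain a a' where a: "a \<in> Hom N (Fo M)" "a' \<in> Hom (Fo M) N" "a' \<circ> a = one N"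
    by (rule isomE[OF M(2)])
  note S = sesD[OF D_ses[OF cover(1)[OF M(1)]]]
  let ?j = "D (Cov M) M (cov M) \<circ> a"
  have j: "?j \<in> Hom N (Fo (Cov M))" by (rule Hom_comp[OF S(4) a(1)])
  have "monic N ?j"
    unfolding monic_def
  proof (intro ballI impI)
    fix v assume v: "v \<in> car N" "?j v = 0"
    then have "a v = 0" using S(6) HomD(3)[OF a(1)] by (simp add: monic_def)
    then show "v = 0" using retract_monic[OF a] v(1) by (simp add: monic_def)
  qed
  then obtain C q where "ses N ?j (Fo (Cov M)) q C" by (rule ses_of_monic[OF assms S(2) j])
  then show ?thesis using D_proj_inj[OF proj_Cov[OF M(1)]] by blast
qed

sublocale fd_algebra_inj A
  by unfold_locales (rule D_enough_inj)

end

section \<open>Coresolutions by tilting summands\<close>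

context fd_algebra
begin

text \<open>\<open>C'\<close> is an \<open>n\<close>-th cosyzygy of \<open>C\<close> relative to
  Add(T): the long exact sequence is stored as its chain of short ones, so that dimension shifting
  is plain induction.\<close>

primrec cosyz :: "'k modl \<Rightarrow> nat \<Rightarrow> 'k modl \<Rightarrow> 'k modl \<Rightarrow> bool" where
  "cosyz T 0 C C' \<longleftrightarrow> C = C'"
| "cosyz T (Suc n) C C' \<longleftrightarrow> (\<exists>X C1 f g. in_Add A T X \<and> ses C f X g C1 \<and> cosyz T n C1 C')"

lemma cosyz_snoc:
  "cosyz T (Suc n) C C' \<longleftrightarrow> (\<exists>X C1 f g. cosyz T n C C1 \<and> in_Add A T X \<and> ses C1 f X g C')"
proof (induction n arbitrary: C)
  case (Suc n)
  have "cosyz T (Suc (Suc n)) C C' \<longleftrightarrow> (\<exists>X C1 f g. in_Add A T X \<and> ses C f X g C1 \<and> cosyz T (Suc n) C1 C')"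
    by (rule cosyz.simps(2))
  also have "\<dots> \<longleftrightarrow> (\<exists>Y C2 f g. cosyz T (Suc n) C C2 \<and> in_Add A T Y \<and> ses C2 f Y g C')"
    unfolding Suc.IH unfolding cosyz.simps by blast
  finally show ?case .
qed simp

text \<open>Replacing the first map by its cokernel shortens the sequence by one. At length one the
  only map is an isomorphism, so its source lies in Add(T) too.\<close>

lemma coresolution_cosyz:
  assumes "ob T" "exact_seq A X f (Suc m)" "\<forall>i\<in>{1..Suc m}. in_Add A T (X i)"
  shows "\<exists>C'. in_Add A T C' \<and> cosyz T m (X 0) C'"
  using assms(2-)
proof (induction m arbitrary: X f)
  case 0
  have ob: "ob (X 0)" "ob (X 1)" and f: "is_hom A (X 0) (X 1) (f 0)"
    and mon: "monic (X 0) (mvec (mdim (X 0)) (f 0))" and ep: "epic (X 1) (mvec (mdim (X 0)) (f 0))"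
    using 0(1) by (simp_all add: exact_seq_def inj_map_iff surj_map_iff)
  obtain g where "g \<in> Hom (X 1) (X 0)" "g \<circ> mvec (mdim (X 0)) (f 0) = one (X 0)"
    by (rule mdim_bij[OF Hom_of_hom[OF f] mon ep ob])
  then have "retract (X 0) (X 1)" using Hom_of_hom[OF f] by (rule_tac retractI)
  then have "in_Add A T (X 0)" using in_Add_retract[OF assms(1) _ ob(1)] 0(2) by auto
  then show ?case by auto
next
  case (Suc m)
  let ?g = "\<lambda>i. mvec (mdim (X i)) (f i)"
  have ob: "ob (X i)" if "i \<le> Suc (Suc m)" for i using that Suc.prems(1) by (simp add: exact_seq_def)
  have fh: "is_hom A (X i) (X (Suc i)) (f i)" if "i < Suc (Suc m)" for i
    using that Suc.prems(1) by (simp add: exact_seq_def)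
  have g: "?g i \<in> Hom (X i) (X (Suc i))" if "i < Suc (Suc m)" for i by (rule Hom_of_hom[OF fh[OF that]])
  have mon: "monic (X 0) (?g 0)" using Suc.prems(1) by (simp add: exact_seq_def inj_map_iff)
  have ex: "\<forall>v\<in>car (X (Suc i)). ?g (Suc i) v = 0 \<longleftrightarrow> (\<exists>u. ?g i u = v)" if "i \<le> m" for i
    using that Suc.prems(1) by (simp add: exact_seq_def exact_at_iff)
  have g0: "?g 0 \<in> Hom (X 0) (X (Suc 0))" by (rule g) simp
  have g1: "?g (Suc 0) \<in> Hom (X (Suc 0)) (X (Suc (Suc 0)))" by (rule g) simp
  obtain C c where C: "ses (X 0) (?g 0) (X (Suc 0)) c C"
    by (rule ses_of_monic[OF ob ob g0 mon]) auto
  note S = sesD[OF C]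
  have "?g (Suc 0) \<circ> ?g 0 = 0"
    by (rule ext) (use ex[of 0] HomD(3)[OF g0] in auto)
  \<comment> \<open>The cokernel of the first map embeds into the term after next by exactness; this
    embedding starts the shortened sequence.\<close>
  from ses_factor_right[OF C g1 this] obtain e where e: "e \<in> Hom C (X (Suc (Suc 0)))" "e \<circ> c = ?g (Suc 0)" .
  have ec: "e (c v) = ?g (Suc 0) v" for v using fun_cong[OF e(2), of v] by simp
  have rane: "(\<exists>u. e u = w) \<longleftrightarrow> (\<exists>v. ?g (Suc 0) v = w)" for w
    using S(7) HomD(2)[OF e(1)] ec unfolding epic_def by (metis trunc_in_vecs)
  have mone: "monic C e"
    unfolding monic_def
  proof (intro ballI impI)
    fix w assume w: "w \<in> car C" "e w = 0"
    obtain v where v: "v \<in> car (X (Suc 0))" "c v = w" using epicD[OF S(7) w(1) S(5)] by blast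
    then have "?g (Suc 0) v = 0" using ec w(2) by metis
    then obtain u where "?g 0 u = v" using ex[of 0] v(1) by blast
    then show "w = 0" using S(9)[of u] v(2) by simp
  qed
  let ?E = "mat_of (mdim C) e"
  have E: "mvec (mdim C) ?E = e" by (rule mvec_mat_of_Hom[OF e(1)])
  let ?X = "\<lambda>i. case i of 0 \<Rightarrow> C | Suc j \<Rightarrow> X (Suc (Suc j))"
  let ?f = "\<lambda>i. case i of 0 \<Rightarrow> ?E | Suc j \<Rightarrow> f (Suc (Suc j))"
  have "exact_seq A ?X ?f (Suc m)"
    unfolding exact_seq_def
  proof (intro conjI allI impI)
    show "ob (?X i)" if "i \<le> Suc m" for i using that ob S(3) by (cases i) auto
    show "is_hom A (?X i) (?X (Suc i)) (?f i)" if "i < Suc m" for i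
      using that fh hom_of_Hom[OF e(1) S(3) ob] by (cases i) auto
    show "inj_map (mdim (?X 0)) (?f 0)" by (simp add: inj_map_iff E mone)
    show "surj_map (mdim (?X (Suc m - 1))) (mdim (?X (Suc m))) (?f (Suc m - 1))"
    proof (cases m)
      case 0
      have "epic (X (Suc (Suc 0))) (?g (Suc 0))"
        using Suc.prems(1) 0 by (simp add: exact_seq_def surj_map_iff)
      then have "epic (X (Suc (Suc 0))) e" by (simp add: epic_def rane)
      then show ?thesis using 0 by (simp add: surj_map_iff E)
    next
      case (Suc k)
      then show ?thesis using Suc.prems(1) by (simp add: exact_seq_def)
    qed
    show "exact_at (mdim (?X i)) (mdim (?X (Suc i))) (?f i) (?f (Suc i))" if "Suc i < Suc m" for i
      using that ex[of "Suc i"] by (cases i) (simp_all add: exact_at_iff E rane)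
  qed simp
  moreover have "\<forall>i\<in>{1..Suc m}. in_Add A T (?X i)"
    using Suc.prems(2) by (auto split: nat.split)
  ultimately obtain C' where C': "in_Add A T C'" "cosyz T m (?X 0) C'" using Suc.IH by blast
  have "in_Add A T (X (Suc 0))" using Suc.prems(2) by auto
  then have "cosyz T (Suc m) (X 0) C'" using C C'(2) by auto
  with C'(1) show ?case by blast
qed

lemma ext_van_cosyz_down:
  assumes "ob M" "cosyz T n C C'" "ext_van k M C'" "\<And>X j. in_Add A T X \<Longrightarrow> j > k \<Longrightarrow> ext_van j M X"
  shows "ext_van (k + n) M C"
  using assms(2)
proof (induction n arbitrary: C)
  case (Suc n)
  then obtain X C1 f g where X: "in_Add A T X" "ses C f X g C1" "cosyz T n C1 C'" by auto
  show ?case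
    using ext_van_sub[OF X(2) assms(1) Suc.IH[OF X(3)]] assms(4)[OF X(1), of "Suc (k + n)"] by simp
qed (use assms(3) in simp)

text \<open>Shifting in the opposite direction. The terms from Add(T) must now contribute nothing
  already at index \<open>k\<close>.\<close>

lemma ext_van_cosyz_up:
  assumes "ob M" "cosyz T n C C'" "ext_van (k + n) M C" "\<And>X j. in_Add A T X \<Longrightarrow> j \<ge> k \<Longrightarrow> ext_van j M X"
  shows "ext_van k M C'"
  using assms(2,3)
proof (induction n arbitrary: C)
  case (Suc n)
  then obtain X C1 f g where X: "in_Add A T X" "ses C f X g C1" "cosyz T n C1 C'" by auto
  have "ext_van (k + n) M C1"
    using ext_van_quotient[OF X(2) assms(1) assms(4)[OF X(1)]] Suc.prems(2) by simp
  then show ?case by (rule Suc.IH[OF X(3)])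
qed simp

end

locale self_dual_tilting = algebra_duality A Fo Fm
  for A :: "'k::field alg" and Fo :: "'k modl \<Rightarrow> 'k modl" and Fm :: "'k modl \<Rightarrow> 'k modl \<Rightarrow> 'k mx \<Rightarrow> 'k mx" +
  fixes T :: "'k modl"
  assumes tilting: "gen_tilting A T"
    and self_dual: "\<forall>Q. indecomposable A Q \<and> in_Add A T Q \<longrightarrow> is_iso A (Fo Q) Q"
begin

section \<open>Self-duality and homological properties of Add(T)\<close>

abbreviation "AddT \<equiv> in_Add A T"

definition "p = pd A T"

lemma ob_T: "ob T"
  using tilting by (simp add: gen_tilting_def)

lemma AddT_ob: "AddT X \<Longrightarrow> ob X"
  by (simp add: in_Add_def)

lemma AddT_retract: "AddT N \<Longrightarrow> ob M \<Longrightarrow> retract M N \<Longrightarrow> AddT M"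
  by (rule in_Add_retract[OF ob_T])

lemma pd_le_T: "pd_le A T p"
  unfolding p_def pd_def using tilting by (auto simp: gen_tilting_def finite_pd_def intro: LeastI)

lemma ext_van_T_T: "ext_van k T T"
  using tilting ob_T by (intro ext_van_of_ext_zero) (auto simp: gen_tilting_def)

text \<open>For decomposable \<open>X\<close>, the dual of \<open>0 \<rightarrow> Y \<rightarrow> X
  \<rightarrow> Z \<rightarrow> 0\<close> is a split sequence from the dual of \<open>Z\<close> to
  the dual of \<open>Y\<close>. It is compared with the reversed sequence from \<open>Z\<close> to
  \<open>Y\<close>, whose ends are isomorphic to these by induction.\<close>

lemma AddT_self_dual: "AddT X \<Longrightarrow> isom (Fo X) X"
proof (induction "mdim X" arbitrary: X rule: less_induct)
  case less
  have X: "ob X" using less.prems by (rule AddT_ob)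
  consider "mdim X = 0" | "indecomposable A X" | "mdim X \<noteq> 0" "\<not> indecomposable A X" by blast
  then show ?case
  proof cases
    case 1
    then show ?thesis using isom_zero D_mdim_zero[OF X] by blast
  next
    case 2
    then show ?thesis using self_dual less.prems isom_iff[OF D_ob[OF X] X] by blast
  next
    case 3
    obtain Y Z f g s r where YZ: "ses Y f X g Z" "s \<in> Hom Z X" "g \<circ> s = one Z" "ses Z s X r Y" "r \<circ> f = one Y"
      "mdim Y < mdim X" "mdim Z < mdim X"
      by (rule decomposition[OF X 3])
    note S = sesD[OF YZ(1)] and S' = sesD[OF YZ(4)]
    have "AddT Y" by (rule AddT_retract[OF less.prems S(1) retractI[OF S(4) S'(5) YZ(5)]])
    then have iY: "isom (Fo Y) Y" by (rule less.hyps[OF YZ(6)])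
    have "AddT Z" by (rule AddT_retract[OF less.prems S(3) retractI[OF YZ(2) S(5) YZ(3)]])
    then have iZ: "isom (Fo Z) Z" by (rule less.hyps[OF YZ(7)])
    have "D Y X f \<circ> D X Y r = one (Fo Y)"
      using D_comp[OF S(1,2,1,4) S'(5)] by (simp add: YZ(5) D_one[OF S(1)])
    from isom_split_ses[OF D_ses[OF YZ(1)] D_Hom[OF S(2,1) S'(5)] this YZ(4) S(4) YZ(5) iZ iY]
    show ?thesis .
  qed
qed

lemma AddT_D: "AddT X \<Longrightarrow> AddT (Fo X)"
  using AddT_retract[OF _ D_ob isom_retract[OF AddT_self_dual]] AddT_ob by blast

lemma ext_van_AddT: "AddT X \<Longrightarrow> AddT Y \<Longrightarrow> ext_van k X Y"
  using ext_van_Add_left[OF ob_T _ AddT_ob] ext_van_Add_right[OF ob_T _ ob_T ext_van_T_T] by blast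

text \<open>The dual of a projective resolution is an injective coresolution, so the injective
  dimension of \<open>Fo X\<close> is at most the projective dimension of \<open>X\<close>.\<close>

lemma ext_van_D_of_pd_le: "pd_le A X n \<Longrightarrow> ob M \<Longrightarrow> k \<ge> n \<Longrightarrow> ext_van k M (Fo X)"
proof (induction n arbitrary: X k)
  case 0
  then show ?case using ext_van_inj D_proj_inj pd_le_0_proj by blast
next
  case (Suc n)
  obtain K \<iota> P \<pi> where K: "ses K \<iota> P \<pi> X" "proj P" "pd_le A K n"
    using pd_le_SucE[OF Suc.prems(1)] .
  obtain j where j: "k = Suc j" "j \<ge> n" using Suc.prems(3) by (cases k) auto
  show ?case
    unfolding j(1) using ext_van_sub[OF D_ses[OF K(1)] Suc.prems(2) Suc.IH[OF K(3) Suc.prems(2) j(2)]]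
      ext_van_inj[OF D_proj_inj[OF K(2)] Suc.prems(2)] by blast
qed

text \<open>\<open>T \<cong> T\<^sup>\<star>\<close> has injective dimension at most \<open>pd T\<close>.\<close>
lemma ext_van_to_AddT:
  assumes "AddT X" "ob M" "k \<ge> p"
  shows "ext_van k M X"
proof -
  have "AddT T"
  proof -
    have "mpow T 1 = dsum T zmod" by simp
    moreover have "retract T (dsum T zmod)"
      by (rule retractI[OF biproduct_Hom(1,3)[OF ob_T ob_zmod]]) (rule ext, simp add: biproduct_apply)
    ultimately show ?thesis using in_Add_iff[OF ob_T] ob_T by metis
  qed
  then have "retract T (Fo T)" using AddT_self_dual isom_sym isom_retract by blast
  then have "ext_van k M T"
    using ext_van_D_of_pd_le[OF pd_le_T assms(2,3)] ext_van_retract_right by blast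
  then show ?thesis by (rule ext_van_Add_right[OF ob_T assms(1,2)])
qed

lemma ext_van_from_AddT: "AddT X \<Longrightarrow> ob N \<Longrightarrow> k \<ge> p \<Longrightarrow> ext_van k X N"
  using ext_van_Add_left[OF ob_T] ext_van_of_pd_le[OF pd_le_T] by blast

text \<open>The index counts maps between terms of Add(T): \<open>Y\<close> is the last term
  \<open>T\<^sub>m\<close> of \<open>m + 1\<close> terms, and \<open>m = 0\<close> means that
  \<open>Y\<close> is the regular module itself.\<close>

definition cores :: "nat \<Rightarrow> 'k modl \<Rightarrow> bool" where
  "cores m Y \<longleftrightarrow> AddT Y \<and> cosyz T m R Y"

lemma cores_exists: "\<exists>m Y. cores m Y"
proof -
  obtain m X f where X: "X 0 = R" "\<forall>i\<in>{1..Suc m}. AddT (X i)" "exact_seq A X f (Suc m)"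
    using tilting by (auto simp: gen_tilting_def)
  from coresolution_cosyz[OF ob_T X(3,2)] show ?thesis unfolding cores_def X(1) by blast
qed

lemma p_le_cores:
  assumes "cores m Y"
  shows "p \<le> m"
proof -
  have "ext_van k T R" if k: "k \<ge> m" for k
  proof -
    have "ext_van (k - m + m) T R"
      by (rule ext_van_cosyz_down[where T = T and C' = Y])
        (use assms ob_T ext_van_Add_right[OF ob_T _ ob_T ext_van_T_T] in \<open>auto simp: cores_def\<close>)
    then show ?thesis using k by simp
  qed
  moreover have "finite_pd A T" using pd_le_T by (auto simp: finite_pd_def)
  ultimately have "pd_le A T m" by (rule_tac pd_le_of_ext_van_R)
  then show ?thesis unfolding p_def pd_def by (rule Least_le)
qed

lemma pd_le_upper:
  assumes "cores m Y" "finite_pd A M"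
  shows "pd_le A M (p + m)"
proof (rule pd_le_of_ext_van_R[OF assms(2)])
  fix k assume k: "k \<ge> p + m"
  have M: "ob M" using assms(2) pd_le_ob by (auto simp: finite_pd_def)
  have "ext_van (k - m + m) M R"
    by (rule ext_van_cosyz_down[where T = T and C' = Y])
      (use assms M k ext_van_to_AddT in \<open>auto simp: cores_def\<close>)
  then show "ext_van k M R" using k by simp
qed

text \<open>The dualized coresolution resolves the dual of the regular module by objects of Add(T),
  all of projective dimension at most \<open>p\<close>. Any finite bound is enough here: finiteness
  is what makes the sharp upper estimate applicable.\<close>

lemma finite_pd_D_R:
  assumes "cores m Y"
  shows "finite_pd A (Fo R)"
proof -
  have "\<exists>b. \<forall>k\<ge>b. \<forall>N. ob N \<longrightarrow> ext_van k (Fo C) N" if "cosyz T n C Y" for n C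
    using that
  proof (induction n arbitrary: C)
    case 0
    then have "AddT (Fo C)" using assms by (simp add: cores_def AddT_D)
    then show ?case using ext_van_from_AddT by blast
  next
    case (Suc n)
    then obtain X C1 f g where X: "AddT X" "ses C f X g C1" "cosyz T n C1 Y" by auto
    obtain b where b: "\<And>k N. k \<ge> b \<Longrightarrow> ob N \<Longrightarrow> ext_van k (Fo C1) N" using Suc.IH[OF X(3)] by blast
    have "ext_van k (Fo C) N" if k: "k \<ge> Suc (max b p)" and N: "ob N" for k N
    proof -
      obtain j where j: "k = Suc j" "j \<ge> b" "k \<ge> p" using k by (cases k) auto
      show ?thesis
        using ext_van_left_quotient[OF D_ses[OF X(2)] N b[OF j(2) N]] ext_van_from_AddT[OF AddT_D[OF X(1)] N j(3)] j(1)
        by simp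
    qed
    then show ?case by blast
  qed
  then obtain b where b: "\<forall>k\<ge>b. \<forall>N. ob N \<longrightarrow> ext_van k (Fo R) N" using assms unfolding cores_def by blast
  then have "pd_le A (Fo R) b" by (intro pd_le_of_ext_van D_ob ob_R) auto
  then show ?thesis by (auto simp: finite_pd_def)
qed

text \<open>Counterpart of the upward shift in the first variable: dualizing turns the cosyzygy
  sequences into syzygy sequences.\<close>

lemma ext_van_D_cosyz:
  assumes "cosyz T n C C'" "ext_van (k + n) (Fo C) N" "ob N" "\<And>X j. AddT X \<Longrightarrow> j \<ge> k \<Longrightarrow> ext_van j X N"
  shows "ext_van k (Fo C') N"
  using assms(1,2)
proof (induction n arbitrary: C)
  case (Suc n)
  then obtain X C1 f g where X: "AddT X" "ses C f X g C1" "cosyz T n C1 C'" by auto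
  have "ext_van (k + n) (Fo C1) N"
    using ext_van_left_sub[OF D_ses[OF X(2)] assms(3) assms(4)[OF AddT_D[OF X(1)]]] Suc.prems(2) by simp
  then show ?case by (rule Suc.IH[OF X(3)])
qed simp

text \<open>If \<open>Y\<close> is the last term of a coresolution of \<open>A\<close> of length \<open>m = n + 1\<close> and \<open>pd(A\<^sup>\<star>) < 2m\<close>, then
  every map \<open>Y\<^sup>\<star> \<rightarrow> Y\<close> is null-homotopic. Applied to \<open>Y\<^sup>\<star> \<rightarrow> Q\<^sup>\<star> \<cong> Q \<rightarrow> Y\<close> for an indecomposable summand
  \<open>Q\<close> of \<open>Y\<close>, this splits \<open>Q\<close> off both \<open>Y\<close> and the term before it.\<close>
lemma shorten_coresolution:
  assumes C: "cosyz T n R C" and S: "ses C c X d Y" and X: "AddT X" and Y: "AddT Y" "mdim Y \<noteq> 0"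
    and pd: "pd_le A (Fo R) (Suc (2 * n))"
  obtains Y' where "cores (Suc n) Y'" "mdim Y' < mdim Y"
proof -
  note DS = sesD[OF S]
  have "cores (Suc n) Y"
    using C S X Y unfolding cores_def cosyz_snoc by blast
  then have p: "p \<le> Suc n" by (rule p_le_cores)
  \<comment> \<open>With \<open>m = n + 1\<close> this is Ext^{2m} of the dual of \<open>R\<close>
    into \<open>R\<close>, one degree above the assumed bound \<open>2 * n + 1\<close>.\<close>
  have "ext_van (Suc n + n) (Fo R) R"
    using ext_van_of_pd_le[OF pd ob_R, of "Suc (2 * n)"] by (simp add: mult_2)
  \<comment> \<open>Shifting \<open>n\<close> steps along the coresolution relies on the injective
    dimension \<open>p\<close> of Add(T), which is at most \<open>n + 1\<close>.\<close>
  then have "ext_van (Suc n) (Fo R) C"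
    by (rule ext_van_cosyz_up[OF D_ob[OF ob_R] C]) (use p ext_van_to_AddT[OF _ D_ob[OF ob_R]] in auto)
  \<comment> \<open>Another \<open>n\<close> steps, now in the first variable, end at Ext^2(Fo C,
    C). The terms skipped satisfy Ext^i(Z,C) = 0 for \<open>i \<ge> 2\<close>, since
    \<open>C\<close> is the kernel of a map within Add(T).\<close>
  then have E: "ext_van 1 (Fo C) C"
  proof (rule_tac ext_van_D_cosyz[OF C])
    fix Z j assume Z: "AddT Z" and j: "1 \<le> (j::nat)"
    then obtain i where i: "j = Suc i" by (cases j) auto
    show "ext_van j Z C"
      unfolding i by (rule ext_van_sub[OF S AddT_ob[OF Z] ext_van_AddT[OF Z Y(1)] ext_van_AddT[OF Z X]])
  qed (simp_all add: DS)
  obtain Q where Q: "indecomposable A Q" "retract Q Y"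
    using exists_indecomposable_retract[OF DS(3) Y(2)] by blast
  have obQ: "ob Q" using Q(1) by (simp add: indecomposable_def)
  obtain i q where iq: "i \<in> Hom Q Y" "q \<in> Hom Y Q" "q \<circ> i = one Q" using Q(2) by (auto simp: retract_def)
  have "isom (Fo Q) Q"
    by (rule AddT_self_dual[OF AddT_retract[OF Y(1) obQ Q(2)]])
  then obtain \<alpha> \<beta> where a: "\<alpha> \<in> Hom (Fo Q) Q" "\<beta> \<in> Hom Q (Fo Q)" "\<beta> \<circ> \<alpha> = one (Fo Q)" "\<alpha> \<circ> \<beta> = one Q"
    by (rule isomE)
  let ?i = "D Q Y i" and ?q = "D Y Q q" and ?d = "D X Y d"
  have Di: "?i \<in> Hom (Fo Y) (Fo Q)" and Dq: "?q \<in> Hom (Fo Q) (Fo Y)" and Dd: "?d \<in> Hom (Fo Y) (Fo X)"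
    using D_Hom obQ DS iq by blast+
  have iqs: "?i \<circ> ?q = one (Fo Q)"
    using D_comp[OF obQ DS(3) obQ iq(1,2)] by (simp add: iq(3) D_one[OF obQ])
  obtain t s where ts: "t \<in> Hom (Fo X) Y" "s \<in> Hom (Fo Y) X" "i \<circ> \<alpha> \<circ> ?i = (t \<circ> ?d) + (d \<circ> s)"
    by (rule ext2_null_homotopic[OF S D_ses[OF S] E ext_van_AddT[OF AddT_D[OF X] X] Hom_comp[OF Hom_comp[OF iq(1) a(1)] Di]])
  \<comment> \<open>Sandwiching the null-homotopy between \<open>q\<close> and
    \<open>?q \<circ> \<beta>\<close> recovers the identity of \<open>Q\<close> as a sum;
    \<open>?u\<close> passes through \<open>Fo X\<close> and \<open>?w\<close> through
    \<open>X\<close>.\<close>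
  let ?u = "(q \<circ> t) \<circ> (?d \<circ> ?q \<circ> \<beta>)" and ?w = "(q \<circ> d) \<circ> (s \<circ> ?q \<circ> \<beta>)"
  have hq: "?d \<circ> ?q \<circ> \<beta> \<in> Hom Q (Fo X)" "s \<circ> ?q \<circ> \<beta> \<in> Hom Q X" "q \<circ> t \<in> Hom (Fo X) Q" "q \<circ> d \<in> Hom X Q"
    by (intro Hom_comp[OF Hom_comp[OF Dd Dq] a(2)] Hom_comp[OF Hom_comp[OF ts(2) Dq] a(2)]
        Hom_comp[OF iq(2) ts(1)] Hom_comp[OF iq(2) DS(5)])+
  have u: "?u \<in> Hom Q Q" by (rule Hom_comp[OF hq(3,1)])
  have w: "?w \<in> Hom Q Q" by (rule Hom_comp[OF hq(4,2)])
  have uw: "?u + ?w = one Q"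
  proof
    fix v
    let ?z = "?q (\<beta> v)"
    have "t (?d ?z) + d (s ?z) = i (\<alpha> (?i ?z))" using fun_cong[OF ts(3), of ?z] by simp
    also have "?i ?z = \<beta> v" using fun_cong[OF iqs, of "\<beta> v"] Hom_one_left[OF a(2)] by simp
    also have "\<alpha> (\<beta> v) = one Q v" using fun_cong[OF a(4), of v] by simp
    finally have "q (t (?d ?z) + d (s ?z)) = one Q v"
      using fun_cong[OF iq(3), of "one Q v"] by simp
    then show "(?u + ?w) v = one Q v" by (simp add: Hom_lin[OF iq(2)])
  qed
  from indecomposable_local[OF Q(1) u w uw] have "\<exists>r\<in>Hom Q X. (q \<circ> d) \<circ> r = one Q"
  proof (elim disjE bexE conjE)
    fix k assume k: "k \<in> Hom Q Q" "?w \<circ> k = one Q"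
    then have "(q \<circ> d) \<circ> ((s \<circ> ?q \<circ> \<beta>) \<circ> k) = one Q" by (simp add: comp_assoc)
    then show ?thesis using Hom_comp[OF hq(2) k(1)] by blast
  next
    fix k assume k: "k \<in> Hom Q Q" "k \<circ> ?u = one Q"
    \<comment> \<open>If \<open>?u\<close> is invertible, \<open>Q\<close> splits off
      \<open>Fo X\<close> rather than \<open>X\<close>. This \<open>?\<rho>\<close> is a left
      inverse of the dual of \<open>q \<circ> d\<close>, and its preimage under the full and
      faithful duality is a right inverse of \<open>q \<circ> d\<close>.\<close>
    let ?\<rho> = "\<beta> \<circ> k \<circ> (q \<circ> t)"
    have "?\<rho> \<in> Hom (Fo X) (Fo Q)" by (rule Hom_comp[OF Hom_comp[OF a(2) k(1)] hq(3)])
    then obtain r where r: "r \<in> Hom Q X" "D Q X r = ?\<rho>" by (rule D_full[OF obQ DS(2)])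
    have Dqd: "D X Q (q \<circ> d) = ?d \<circ> ?q" by (rule D_comp[OF DS(2,3) obQ DS(5) iq(2)])
    have "D Q Q ((q \<circ> d) \<circ> r) = ?\<rho> \<circ> (?d \<circ> ?q)"
      using D_comp[OF obQ DS(2) obQ r(1) hq(4)] by (simp add: r(2) Dqd)
    also have "\<dots> = one (Fo Q)"
    proof
      fix v
      have "v' = k (q (t (?d (?q (\<beta> v')))))" if "v' \<in> car Q" for v'
        using fun_cong[OF k(2), of v'] that by (simp add: trunc_vecs)
      from this[OF HomD(3)[OF a(1), of v]] have "\<alpha> v = k (q (t (?d (?q (\<beta> (\<alpha> v))))))" .
      moreover have ba: "\<beta> (\<alpha> v) = one (Fo Q) v" using fun_cong[OF a(3), of v] by simp
      ultimately have "\<alpha> v = k (q (t (?d (?q v))))" by (simp add: HomD(2)[OF Dq])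
      then show "(?\<rho> \<circ> (?d \<circ> ?q)) v = one (Fo Q) v" using ba by simp
    qed
    finally have "D Q Q ((q \<circ> d) \<circ> r) = D Q Q (one Q)" by (simp add: D_one[OF obQ])
    then have "(q \<circ> d) \<circ> r = one Q"
      by (rule D_inject[OF obQ obQ Hom_comp[OF hq(4) r(1)] Hom_one[OF obQ]])
    then show ?thesis using r(1) by blast
  qed
  then obtain r where r: "r \<in> Hom Q X" "(q \<circ> d) \<circ> r = one Q" by blast
  \<comment> \<open>The kernels of \<open>q \<circ> d\<close> and of \<open>q\<close> are the
    complements of \<open>Q\<close> in \<open>X\<close> and in \<open>Y\<close>; the sequence
    starting at \<open>C\<close> restricts to them, so the cosyzygy \<open>C\<close> is
    kept.\<close>
  obtain X' x where X': "ses X' x X (q \<circ> d) Q"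
    by (rule ses_of_epic[OF DS(2) obQ hq(4) retract_epic[OF r(2)]])
  obtain Y' y where Y': "ses Y' y Y q Q"
    by (rule ses_of_epic[OF DS(3) obQ iq(2) retract_epic[OF iq(3)]])
  note DX = sesD[OF X'] and DY = sesD[OF Y']
  obtain rx where "rx \<in> Hom X X'" "rx \<circ> x = one X'" by (rule ses_retraction[OF X' r])
  then have AX: "AddT X'" by (rule AddT_retract[OF X DX(1) retractI[OF DX(4)]])
  obtain ry where "ry \<in> Hom Y Y'" "ry \<circ> y = one Y'" by (rule ses_retraction[OF Y' iq(1,3)])
  then have AY: "AddT Y'" by (rule AddT_retract[OF Y(1) DY(1) retractI[OF DY(4)]])
  have "(q \<circ> d) \<circ> c = 0" by (rule ext) (simp add: DS(9) Hom_lin[OF iq(2)])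
  from ses_factor_left[OF X' DS(1,4) this] obtain c' where c': "c' \<in> Hom C X'" "x \<circ> c' = c" .
  have xc: "x (c' v) = c v" for v using fun_cong[OF c'(2), of v] by simp
  have "q \<circ> (d \<circ> x) = 0" using DX(8) by (simp add: comp_assoc)
  from ses_factor_left[OF Y' DX(1) Hom_comp[OF DS(5) DX(4)] this]
  obtain d' where d': "d' \<in> Hom X' Y'" "y \<circ> d' = d \<circ> x" .
  have yd: "y (d' v) = d (x v)" for v using fun_cong[OF d'(2), of v] by simp
  have "ses C c' X' d' Y'"
    unfolding ses_def
  proof (intro conjI ballI DS DX DY c' d')
    show "monic C c'"
      unfolding monic_def
    proof (intro ballI impI)
      fix v assume v: "v \<in> car C" "c' v = 0"
      then have "c v = 0" using xc[of v] by (simp add: Hom_lin[OF DX(4)])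
      then show "v = 0" using DS(6) v(1) by (simp add: monic_def)
    qed
    show "epic Y' d'"
      unfolding epic_def
    proof
      fix z assume z: "z \<in> car Y'"
      obtain v where v: "v \<in> car X" "d v = y z" using epicD[OF DS(7) HomD(3)[OF DY(4)] DS(5)] by blast
      then have "(q \<circ> d) v = 0" by (simp add: DY(9))
      then obtain v' where "x v' = v" using ses_exact[OF X' v(1)] by blast
      then have "y (d' v') = y z" using yd[of v'] v(2) by simp
      then show "\<exists>v. d' v = z" using monicD[OF DY(6,4) _ HomD(3)[OF d'(1)] z] by blast
    qed
    show "d' v = 0 \<longleftrightarrow> (\<exists>u. c' u = v)" if v: "v \<in> car X'" for v
    proof
      assume "d' v = 0"
      then have "d (x v) = 0" using yd[of v] by (simp add: Hom_lin[OF DY(4)])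
      then obtain u where "c u = x v" using ses_exact[OF S HomD(3)[OF DX(4)]] by blast
      then have "x (c' u) = x v" by (simp add: xc)
      then show "\<exists>u. c' u = v" using monicD[OF DX(6,4) _ HomD(3)[OF c'(1)] v] by blast
    next
      assume "\<exists>u. c' u = v"
      then obtain u where "c' u = v" ..
      then have "y (d' v) = 0" using yd[of v] xc[of u] by (simp add: DS(9))
      then show "d' v = 0" using DY(6) HomD(3)[OF d'(1)] by (simp add: monic_def)
    qed
  qed
  then have "cores (Suc n) Y'" using C AX AY unfolding cores_def cosyz_snoc by blast
  moreover have "mdim Y' < mdim Y"
  proof -
    have "mdim Y' \<le> mdim Y" by (rule mdim_monic[OF DY(4,6)])
    moreover have "mdim Y' \<noteq> mdim Y"
    proof
      assume "mdim Y' = mdim Y"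
      then have ep: "epic Y y" by (rule mdim_eq_epic[OF DY(4,6)])
      have "q = 0"
        by (rule epic_cancel[OF DY(4) ep iq(2) Hom_zero]) (use DY(8) in \<open>simp add: fun_eq_iff[where f = "_ \<circ> _"]\<close>)
      then have "one Q v = 0" for v using fun_cong[OF iq(3), of v] by simp
      then have "one Q = 0" by (intro ext[where g = 0]) simp
      then show False using Q(1) by (simp add: one_zero_iff indecomposable_def)
    qed
    ultimately show ?thesis by simp
  qed
  ultimately show ?thesis by (rule that)
qed

text \<open>A zero last term makes the preceding map an isomorphism, so \<open>C\<close> itself lies
  in Add(T) and can end the coresolution.\<close>

lemma cores_of_zero_last:
  assumes "cores (Suc n) Y" "mdim Y = 0"
  shows "\<exists>Y'. cores n Y'"
proof -
  obtain X C f g where X: "cosyz T n R C" "AddT X" "ses C f X g Y"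
    using assms(1) unfolding cores_def cosyz_snoc by blast
  note D = sesD[OF X(3)]
  have "epic X f"
    using X(3) Hom_to_zero[OF assms(2) D(5)] by (simp add: ses_def epic_def)
  then obtain h where "h \<in> Hom X C" "h \<circ> f = one C" by (rule mdim_bij[OF D(4,6) _ D(1,2)])
  then have "AddT C" by (rule AddT_retract[OF X(2) D(1) retractI[OF D(4)]])
  with X(1) show ?thesis unfolding cores_def by blast
qed

lemma fdim_eq: "fdim A = enat (2 * pd A T)"
proof -
  define m where "m = (LEAST m. \<exists>Y. cores m Y)"
  have "\<exists>Y. cores m Y" unfolding m_def using cores_exists by (rule LeastI_ex)
  moreover define e where "e = (LEAST e. \<exists>Y. cores m Y \<and> mdim Y = e)"
  ultimately have "\<exists>Y. cores m Y \<and> mdim Y = e" unfolding e_def by (rule_tac LeastI_ex) blast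
  then obtain Y where Y: "cores m Y" "mdim Y = e" by blast
  have mmin: "m \<le> k" if "cores k Z" for k Z unfolding m_def using that by (intro Least_le) blast
  have emin: "e \<le> mdim Z" if "cores m Z" for Z unfolding e_def using that by (intro Least_le) blast
  have pm: "p \<le> m" by (rule p_le_cores[OF Y(1)])
  have fin: "finite_pd A (Fo R)" by (rule finite_pd_D_R[OF Y(1)])
  then have pdR: "pd_le A (Fo R) (pd A (Fo R))"
    unfolding pd_def by (auto simp: finite_pd_def intro: LeastI)
  have up: "pd A M \<le> p + m" if "finite_pd A M" for M
    unfolding pd_def by (rule Least_le, rule pd_le_upper[OF Y(1) that])
  have low: "2 * m \<le> pd A (Fo R)"
  proof (rule ccontr)
    assume n: "\<not> 2 * m \<le> pd A (Fo R)"
    then obtain n where m: "m = Suc n" by (cases m) auto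
    have pd: "pd_le A (Fo R) (Suc (2 * n))" using pd_le_mono[OF pdR] n m by simp
    \<comment> \<open>Otherwise there would be a coresolution of smaller length, against the choice
      of \<open>m\<close>.\<close>
    have "mdim Y \<noteq> 0" using cores_of_zero_last[of n Y] Y(1) mmin[of n] m by auto
    moreover obtain X C c d where "cosyz T n R C" "AddT X" "ses C c X d Y"
      using Y(1) unfolding m cores_def cosyz_snoc by blast
    ultimately obtain Y' where "cores (Suc n) Y'" "mdim Y' < mdim Y"
      using shorten_coresolution[OF _ _ _ _ _ pd] Y(1) unfolding cores_def by metis
    then show False using emin[of Y'] Y(2) m by simp
  qed
  \<comment> \<open>The bounds \<open>2 * m \<le> pd A (Fo R) \<le> p + m\<close> and
    \<open>p \<le> m\<close> leave only equality, so the dual of the regular module attains the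
    supremum.\<close>
  from up[OF fin] low pm have mp: "m = p" and pdR: "pd A (Fo R) = 2 * p" by simp_all
  show ?thesis
    unfolding fdim_def p_def[symmetric]
  proof (rule antisym)
    show "Sup {enat (pd A M) |M. ob M \<and> finite_pd A M} \<le> enat (2 * p)"
      by (rule Sup_least) (use up mp in \<open>auto simp: mult_2\<close>)
    show "enat (2 * p) \<le> Sup {enat (pd A M) |M. ob M \<and> finite_pd A M}"
      by (rule Sup_upper) (use pdR fin D_ob[OF ob_R] in force)
  qed
qed

end

theorem theorem1:
  fixes A :: "'k::field alg" and T :: "'k modl"
    and Fo :: "'k modl \<Rightarrow> 'k modl" and Fm :: "'k modl \<Rightarrow> 'k modl \<Rightarrow> 'k mx \<Rightarrow> 'k mx"
  assumes "alg_closed TYPE('k)"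
    and "is_fd_algebra A"
    and "fdim A < \<infinity>"
    and "is_duality A Fo Fm"
    and "gen_tilting A T"
    and "\<forall>Q. indecomposable A Q \<and> in_Add A T Q \<longrightarrow> is_iso A (Fo Q) Q"
  shows "fdim A = enat (2 * pd A T)"
proof -
  interpret self_dual_tilting A Fo Fm T
    by unfold_locales (fact assms)+
  show ?thesis by (rule fdim_eq)
qed

end
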